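(* Let $n\ge 2$, $k \geq 2$ and $1 \leq \ell \leq \lfloor n/2 \rfloor$ be integers. Then the multiplicity of the weight $k\Lambda_0-\gamma_\ell$ in the irreducible highest weight $\widehat{sl}(n)$-module $V(k\Lambda_0)$ is $$mult_{k\Lambda_0}(k\Lambda_0 - \gamma_\ell) = \sum_{\lambda \vdash \ell,\ ht(\lambda) \leq k} (f^\lambda)^2 .$$
   Context: $\mathfrak g=\widehat{sl}(n)=sl(n)\otimes\mathbb C[t,t^{-1}]\oplus\mathbb C c\oplus\mathbb C d$ is the affine Kac-Moody Lie algebra, where $sl(n)$ is the Lie algebra of trace zero $n\times n$ complex matrices, $c$ is the canonical central element and $d=1\otimes t\frac{d}{dt}$ is the degree derivation. Its generalized Cartan matrix $A=(a_{ij})_{0\le i,j\le n-1}$ is, for $n\ge 3$, given by $a_{ii}=2$, $a_{ij}=-1$ if $|i-j|=1$, $a_{0,n-1}=a_{n-1,0}=-1$, and $a_{ij}=0$ otherwise; for $n=2$, $a_{00}=a_{11}=2$ and $a_{01}=a_{10}=-2$. The Cartan subalgebra is $\mathfrak h=\mathrm{span}_{\mathbb C}\{h_0,h_1,\ldots,h_{n-1},d\}$, with simple coroots $h_0,\ldots,h_{n-1}$ and simple roots $\alpha_0,\ldots,\alpha_{n-1}\in\mathfrak h^*$, where $\alpha_j(h_i)=a_{ij}$. The fundamental weights $\Lambda_0,\ldots,\Lambda_{n-1}\in\mathfrak h^*$ are defined by $\Lambda_i(h_j)=\delta_{ij}$, $\Lambda_i(d)=0$. For a dominant integral weight $\Lambda$,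 $V(\Lambda)$ is the irreducible highest weight $\mathfrak g$-module of highest weight $\Lambda$; for $\mu\in\mathfrak h^*$, $mult_\Lambda(\mu)=\dim V(\Lambda)_\mu$, where $V(\Lambda)_\mu=\{v\in V(\Lambda)\mid h(v)=\mu(h)v\ \forall h\in\mathfrak h\}$. For $1\le\ell\le\lfloor n/2\rfloor$, $$\gamma_\ell=\ell\alpha_0+\sum_{i=1}^{\ell-1}(\ell-i)\alpha_i+\sum_{i=1}^{\ell-1}(\ell-i)\alpha_{n-i}.$$ For a partition $\lambda\vdash\ell$, $f^\lambda$ is the number of standard Young tableaux of shape $\lambda$, and $ht(\lambda)$ is the number of nonzero parts (rows) of $\lambda$. *)

theory Defs
  imports Complex_Main "HOL-Library.FuncSet" "Jordan_Normal_Form.Matrix"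
begin

text \<open>An element \<open>\<Sum>m. X m \<otimes> t^m + a c + b d\<close> of the affine algebra is represented by
  \<open>Affine X a b\<close>. Matrix indices run over \<open>{0..<n}\<close> instead of \<open>{1..n}\<close>.\<close>

datatype affine = Affine (loop_part: "int \<Rightarrow> complex mat") (c_part: complex) (d_part: complex)

definition mat_trace :: "complex mat \<Rightarrow> complex" where
  "mat_trace A = (\<Sum>i<dim_row A. A $$ (i, i))"

definition affine_sl :: "nat \<Rightarrow> affine set" where
  "affine_sl n = {x. (\<forall>m. loop_part x m \<in> carrier_mat n n \<and> mat_trace (loop_part x m) = 0)
                   \<and> finite {m. loop_part x m \<noteq> 0\<^sub>m n n}}"

definition affine_add :: "affine \<Rightarrow> affine \<Rightarrow> affine" where
  "affine_add x y = Affine (\<lambda>m. loop_part x m + loop_part y m)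
                      (c_part x + c_part y) (d_part x + d_part y)"

definition affine_smult :: "complex \<Rightarrow> affine \<Rightarrow> affine" where
  "affine_smult s x = Affine (\<lambda>m. s \<cdot>\<^sub>m loop_part x m) (s * c_part x) (s * d_part x)"

text \<open>\<open>[X \<otimes> t^p, Y \<otimes> t^q] = [X, Y] \<otimes> t^(p+q) + p \<delta>\<^bsub>p+q,0\<^esub> tr(XY) c\<close>, with \<open>c\<close> central and
  \<open>[d, X \<otimes> t^p] = p X \<otimes> t^p\<close>; the sums below are the bilinear extension.\<close>

definition affine_bracket :: "nat \<Rightarrow> affine \<Rightarrow> affine \<Rightarrow> affine" where
  "affine_bracket n x y = (let X = loop_part x; Y = loop_part y; S = {p. X p \<noteq> 0\<^sub>m n n} in
     Affine
       (\<lambda>m. mat n n (\<lambda>(i, j).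
          (\<Sum>p\<in>S. (X p * Y (m - p) - Y (m - p) * X p) $$ (i, j))
          + of_int m * (d_part x * Y m $$ (i, j) - d_part y * X m $$ (i, j))))
       (\<Sum>p\<in>S. of_int p * mat_trace (X p * Y (- p)))
       0)"

definition elem_mat :: "nat \<Rightarrow> nat \<Rightarrow> nat \<Rightarrow> complex mat" where
  "elem_mat n p q = mat n n (\<lambda>(i, j). if i = p \<and> j = q then 1 else 0)"

definition tensor_t :: "nat \<Rightarrow> complex mat \<Rightarrow> int \<Rightarrow> affine" where
  "tensor_t n A m = Affine (\<lambda>p. if p = m then A else 0\<^sub>m n n) 0 0"

definition central_c :: "nat \<Rightarrow> affine" where
  "central_c n = Affine (\<lambda>p. 0\<^sub>m n n) 1 0"

definition deriv_d :: "nat \<Rightarrow> affine" where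
  "deriv_d n = Affine (\<lambda>p. 0\<^sub>m n n) 0 1"

definition chev_e :: "nat \<Rightarrow> nat \<Rightarrow> affine" where
  "chev_e n i = (if i = 0 then tensor_t n (elem_mat n (n - 1) 0) 1
                 else tensor_t n (elem_mat n (i - 1) i) 0)"

definition coroot :: "nat \<Rightarrow> nat \<Rightarrow> affine" where
  "coroot n i =
     (if i = 0
      then affine_add (tensor_t n (elem_mat n (n - 1) (n - 1) - elem_mat n 0 0) 0) (central_c n)
      else tensor_t n (elem_mat n (i - 1) (i - 1) - elem_mat n i i) 0)"

text \<open>The complex linear span of \<open>h\<^sub>0, \<dots>, h\<^bsub>n-1\<^esub>, d\<close>.\<close>

inductive_set cartan :: "nat \<Rightarrow> affine set" for n :: nat where
  coroot: "i < n \<Longrightarrow> coroot n i \<in> cartan n"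
| deriv: "deriv_d n \<in> cartan n"
| add: "x \<in> cartan n \<Longrightarrow> y \<in> cartan n \<Longrightarrow> affine_add x y \<in> cartan n"
| smult: "x \<in> cartan n \<Longrightarrow> affine_smult s x \<in> cartan n"

text \<open>The coefficient of \<open>h\<^sub>i\<close> in \<open>h = \<Sum>\<^sub>i a\<^sub>i h\<^sub>i + b d\<close>: the coefficient of \<open>c\<close> in \<open>h\<close> is \<open>a\<^sub>0\<close>, and
  the diagonal entries of the degree zero matrix part are
  \<open>a\<^sub>1 - a\<^sub>0, a\<^sub>2 - a\<^sub>1, \<dots>, a\<^sub>0 - a\<^bsub>n-1\<^esub>\<close>.\<close>

definition coroot_coord :: "nat \<Rightarrow> affine \<Rightarrow> complex" where
  "coroot_coord i h = c_part h + (\<Sum>j<i. loop_part h 0 $$ (j, j))"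

text \<open>The linear functional on the Cartan subalgebra with prescribed values \<open>u i\<close> at \<open>h\<^sub>i\<close> and
  \<open>w\<close> at \<open>d\<close>. Elements of the dual of the Cartan subalgebra are represented by functions that only
  matter on \<open>cartan n\<close>.\<close>

definition dual_ext :: "nat \<Rightarrow> (nat \<Rightarrow> complex) \<Rightarrow> complex \<Rightarrow> affine \<Rightarrow> complex" where
  "dual_ext n u w h = (\<Sum>i<n. u i * coroot_coord i h) + w * d_part h"

definition affine_gcm :: "nat \<Rightarrow> nat \<Rightarrow> nat \<Rightarrow> int" where
  "affine_gcm n i j =
     (if i = j then 2
      else if n = 2 then - 2
      else if i = j + 1 \<or> j = i + 1 \<or> (i = 0 \<and> j = n - 1) \<or> (i = n - 1 \<and> j = 0) then - 1
      else 0)"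

text \<open>Since \<open>e\<^sub>0\<close> has degree one in \<open>t\<close> and the other \<open>e\<^sub>j\<close> have degree zero, \<open>\<alpha>\<^sub>j(d) = \<delta>\<^bsub>j0\<^esub>\<close>.\<close>

definition simple_root :: "nat \<Rightarrow> nat \<Rightarrow> affine \<Rightarrow> complex" where
  "simple_root n j = dual_ext n (\<lambda>i. of_int (affine_gcm n i j)) (if j = 0 then 1 else 0)"

definition fund_weight :: "nat \<Rightarrow> nat \<Rightarrow> affine \<Rightarrow> complex" where
  "fund_weight n i = dual_ext n (\<lambda>j. if i = j then 1 else 0) 0"

definition gamma_wt :: "nat \<Rightarrow> nat \<Rightarrow> affine \<Rightarrow> complex" where
  "gamma_wt n l h = of_nat l * simple_root n 0 h
     + (\<Sum>i=1..l - 1. of_nat (l - i) * simple_root n i h)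
     + (\<Sum>i=1..l - 1. of_nat (l - i) * simple_root n (n - i) h)"

locale affine_module = vector_space scale
  for scale :: "complex \<Rightarrow> 'v::ab_group_add \<Rightarrow> 'v" +
  fixes n :: nat
    and act :: "affine \<Rightarrow> 'v \<Rightarrow> 'v"
  assumes act_linear: "x \<in> affine_sl n \<Longrightarrow> Vector_Spaces.linear scale scale (act x)"
    and act_add: "x \<in> affine_sl n \<Longrightarrow> y \<in> affine_sl n \<Longrightarrow>
                    act (affine_add x y) v = act x v + act y v"
    and act_smult: "x \<in> affine_sl n \<Longrightarrow> act (affine_smult s x) v = scale s (act x v)"
    and act_bracket: "x \<in> affine_sl n \<Longrightarrow> y \<in> affine_sl n \<Longrightarrow>
                    act (affine_bracket n x y) v = act x (act y v) - act y (act x v)"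
begin

definition submodule :: "'v set \<Rightarrow> bool" where
  "submodule W \<longleftrightarrow> subspace W \<and> (\<forall>x\<in>affine_sl n. \<forall>w\<in>W. act x w \<in> W)"

definition irreducible_module :: bool where
  "irreducible_module \<longleftrightarrow>
     (UNIV :: 'v set) \<noteq> {0} \<and> (\<forall>W. submodule W \<longrightarrow> W = {0} \<or> W = UNIV)"

definition highest_weight_vector :: "(affine \<Rightarrow> complex) \<Rightarrow> 'v \<Rightarrow> bool" where
  "highest_weight_vector \<Lambda> v \<longleftrightarrow> v \<noteq> 0 \<and> (\<forall>i<n. act (chev_e n i) v = 0)
     \<and> (\<forall>h\<in>cartan n. act h v = scale (\<Lambda> h) v)"

definition highest_weight_module :: "(affine \<Rightarrow> complex) \<Rightarrow> bool" where
  "highest_weight_module \<Lambda> \<longleftrightarrow>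
     (\<exists>v. highest_weight_vector \<Lambda> v \<and> (\<forall>W. submodule W \<and> v \<in> W \<longrightarrow> W = UNIV))"

definition weight_space :: "(affine \<Rightarrow> complex) \<Rightarrow> 'v set" where
  "weight_space \<mu> = {v. \<forall>h\<in>cartan n. act h v = scale (\<mu> h) v}"

definition weight_mult :: "(affine \<Rightarrow> complex) \<Rightarrow> nat" where
  "weight_mult \<mu> = dim (weight_space \<mu>)"

end

text \<open>\<open>V(\<Lambda>)\<close> is determined up to isomorphism: the following says that the whole type \<open>'v\<close>
  with the given operations is a copy of it.\<close>

locale irreducible_highest_weight_module = affine_module scale n act
  for scale :: "complex \<Rightarrow> 'v::ab_group_add \<Rightarrow> 'v"
    and n :: nat
    and act :: "affine \<Rightarrow> 'v \<Rightarrow> 'v" +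
  fixes \<Lambda> :: "affine \<Rightarrow> complex"
  assumes irreducible: "irreducible_module"
    and highest_weight: "highest_weight_module \<Lambda>"

definition partitions_of :: "nat \<Rightarrow> nat list set" where
  "partitions_of l = {ps. sorted_wrt (\<ge>) ps \<and> 0 \<notin> set ps \<and> sum_list ps = l}"

definition young_cells :: "nat list \<Rightarrow> (nat \<times> nat) set" where
  "young_cells ps = {(i, j). i < length ps \<and> j < ps ! i}"

definition standard_tableaux :: "nat list \<Rightarrow> (nat \<times> nat \<Rightarrow> nat) set" where
  "standard_tableaux ps = {T \<in> extensional (young_cells ps).
     bij_betw T (young_cells ps) {1..sum_list ps}
     \<and> (\<forall>i j. (i, j + 1) \<in> young_cells ps \<longrightarrow> T (i, j) < T (i, j + 1))
     \<and> (\<forall>i j. (i + 1, j) \<in> young_cells ps \<longrightarrow> T (i, j) < T (i + 1, j))}"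

definition num_syt :: "nat list \<Rightarrow> nat" where
  "num_syt ps = card (standard_tableaux ps)"


subsection \<open>Consistency of the conventions\<close>

lemma finite_partitions_of: "finite (partitions_of l)"
proof -
  have *: "length ps \<le> sum_list ps" if "0 \<notin> set ps" for ps :: "nat list"
    using that by (induction ps) auto
  have "partitions_of l \<subseteq> {ps. set ps \<subseteq> {..l} \<and> length ps \<le> l}"
    using * by (auto simp: partitions_of_def member_le_sum_list)
  then show ?thesis
    by (rule finite_subset) (rule finite_lists_length_le, simp)
qed

lemma finite_standard_tableaux: "finite (standard_tableaux ps)"
proof -
  have "young_cells ps = Sigma {..<length ps} (\<lambda>i. {..<ps ! i})"
    by (auto simp: young_cells_def)
  then have "finite (young_cells ps)" by simp
  moreover have "standard_tableaux ps \<subseteq> (young_cells ps) \<rightarrow>\<^sub>E {1..sum_list ps}"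
    by (auto simp: standard_tableaux_def PiE_def bij_betw_def)
  ultimately show ?thesis
    by (meson finite_PiE finite_atLeastAtMost finite_subset)
qed

lemma coroot_coord_coroot:
  assumes "i < n" "j < n" "2 \<le> n"
  shows "coroot_coord i (coroot n j) = (if i = j then 1 else 0)"
proof -
  have D: "elem_mat n p p $$ (q, q) = (if q = p then 1 else 0)" if "q < n" for p q
    using that by (auto simp: elem_mat_def)
  have dim: "dim_row (elem_mat n p q) = n" "dim_col (elem_mat n p q) = n" for p q
    by (simp_all add: elem_mat_def)
  have "(\<Sum>q<i. loop_part (coroot n j) 0 $$ (q, q))
      = (\<Sum>q<i. if j = 0 then (if q = n - 1 then 1 else 0) - (if q = 0 then 1 else 0)
                 else (if q = j - 1 then 1 else 0) - (if q = j then 1 else 0))"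
    using assms
    by (intro sum.cong refl)
       (auto simp: coroot_def tensor_t_def affine_add_def central_c_def D dim)
  moreover have "c_part (coroot n j) = (if j = 0 then 1 else 0)"
    by (simp add: coroot_def tensor_t_def affine_add_def central_c_def)
  ultimately have "coroot_coord i (coroot n j) = (if j = 0 then 1 else 0)
      + (\<Sum>q<i. if j = 0 then (if q = n - 1 then 1 else 0) - (if q = 0 then 1 else 0)
                else (if q = j - 1 then 1 else 0) - (if q = j then 1 else 0))"
    by (simp only: coroot_coord_def)
  also have "\<dots> = (if i = j then 1 else 0)"
    using assms by (cases "j = 0") (auto simp: sum_subtractf)
  finally show ?thesis .
qed

lemma dual_ext_coroot:
  assumes "j < n" "2 \<le> n"
  shows "dual_ext n u w (coroot n j) = u j"
proof -
  have "(\<Sum>i<n. u i * coroot_coord i (coroot n j)) = (\<Sum>i<n. if i = j then u i else 0)"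
    using assms by (intro sum.cong) (auto simp: coroot_coord_coroot)
  also have "\<dots> = u j"
    using assms by simp
  finally have "(\<Sum>i<n. u i * coroot_coord i (coroot n j)) = u j" .
  moreover have "d_part (coroot n j) = 0"
    by (simp add: coroot_def tensor_t_def affine_add_def central_c_def)
  ultimately show ?thesis
    unfolding dual_ext_def by simp
qed

lemma dual_ext_deriv: "dual_ext n u w (deriv_d n) = w"
proof -
  have "coroot_coord i (deriv_d n) = 0" if "i < n" for i
    using that by (simp add: coroot_coord_def deriv_d_def)
  then show ?thesis
    by (simp add: dual_ext_def deriv_d_def)
qed

lemma affine_sl_dims:
  assumes "x \<in> affine_sl n"
  shows "dim_row (loop_part x m) = n" "dim_col (loop_part x m) = n"
proof -
  have "loop_part x m \<in> carrier_mat n n"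
    using assms unfolding affine_sl_def by blast
  then show "dim_row (loop_part x m) = n" "dim_col (loop_part x m) = n"
    by (rule carrier_matD)+
qed

lemma dual_ext_add:
  assumes "x \<in> affine_sl n" "y \<in> affine_sl n"
  shows "dual_ext n u w (affine_add x y) = dual_ext n u w x + dual_ext n u w y"
proof -
  have c: "coroot_coord i (affine_add x y) = coroot_coord i x + coroot_coord i y" if "i < n" for i
  proof -
    have "(\<Sum>j<i. loop_part (affine_add x y) 0 $$ (j, j))
        = (\<Sum>j<i. loop_part x 0 $$ (j, j) + loop_part y 0 $$ (j, j))"
      using that affine_sl_dims[OF assms(1)] affine_sl_dims[OF assms(2)]
      by (intro sum.cong refl) (simp add: affine_add_def)
    moreover have "c_part (affine_add x y) = c_part x + c_part y"
      by (simp add: affine_add_def)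
    ultimately show ?thesis
      unfolding coroot_coord_def by (simp only: sum.distrib ac_simps)
  qed
  have "(\<Sum>i<n. u i * coroot_coord i (affine_add x y))
      = (\<Sum>i<n. u i * coroot_coord i x + u i * coroot_coord i y)"
    by (intro sum.cong) (simp_all add: c distrib_left)
  moreover have "d_part (affine_add x y) = d_part x + d_part y"
    by (simp add: affine_add_def)
  ultimately show ?thesis
    unfolding dual_ext_def by (simp only: sum.distrib distrib_left ac_simps)
qed

lemma dual_ext_smult:
  assumes "x \<in> affine_sl n"
  shows "dual_ext n u w (affine_smult s x) = s * dual_ext n u w x"
proof -
  have c: "coroot_coord i (affine_smult s x) = s * coroot_coord i x" if "i < n" for i
  proof -
    have "(\<Sum>j<i. loop_part (affine_smult s x) 0 $$ (j, j))
        = (\<Sum>j<i. s * loop_part x 0 $$ (j, j))"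
      using that affine_sl_dims[OF assms]
      by (intro sum.cong refl) (simp add: affine_smult_def)
    moreover have "c_part (affine_smult s x) = s * c_part x"
      by (simp add: affine_smult_def)
    ultimately show ?thesis
      unfolding coroot_coord_def by (simp only: sum_distrib_left distrib_left)
  qed
  have "(\<Sum>i<n. u i * coroot_coord i (affine_smult s x)) = (\<Sum>i<n. s * (u i * coroot_coord i x))"
    by (intro sum.cong) (simp_all add: c)
  moreover have "d_part (affine_smult s x) = s * d_part x"
    by (simp add: affine_smult_def)
  ultimately show ?thesis
    unfolding dual_ext_def by (simp only: sum_distrib_left distrib_left mult.left_commute)
qed

end

theory Submission
  imports Defs "HOL-Combinatorics.Permutations"
begin

text \<open>
Matrix indices run over \<open>{..<n}\<close>. The weight \<open>k \<Lambda>\<^sub>0 - \<gamma>\<^sub>l\<close> has \<open>t\<close>-degree \<open>-l\<close>, and its finite part is the sum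
of the \<open>\<epsilon>\<^sub>i\<close> with \<open>i < l\<close> minus the sum of the \<open>\<epsilon>\<^sub>j\<close> with \<open>n - l \<le> j\<close>. The highest weight vector \<open>v\<close> is killed
by \<open>sl(n)\<close> and by all positive powers of \<open>t\<close>, so the module is spanned by monomials in units
\<open>E\<^bsub>ij\<^esub> t^-a\<close>, \<open>a \<ge> 1\<close>, applied to \<open>v\<close>. Each factor supplies at most one of the required rows \<open>i < l\<close> and one of
the required columns, hence \<open>l\<close> factors of degree -1 are just enough, and the weight space is
spanned by the \<open>l!\<close> vectors \<open>w\<^sub>p = \<Prod>\<^bsub>i<l\<^esub> E\<^bsub>i,n-l+p(i)\<^esub> t^-1 v\<close> (\<open>corner_weight_monomials\<close>,
\<open>corner_space_spanned\<close>).

By irreducibility a vector of this weight is determined by its images in \<open>\<complex> v\<close> under the opposite monomials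
\<open>\<Prod>\<^bsub>i<l\<^esub> E\<^bsub>n-l+q(i),i\<^esub> t\<close> (\<open>corner_space_nondegenerate\<close>). Contracting the factors one at a time, the image of
\<open>w\<^sub>p\<close> is \<open>sgn p sgn q\<close> times \<open>k\<close> to the number of cycles of \<open>q\<inverse> p\<close>, and this power is the number of
colourings \<open>e : {..<l} \<rightarrow> {..<k}\<close> with \<open>e \<circ> p = e \<circ> q\<close> (\<open>gram\<close>). Up to signs it is the Gram matrix of the permutation
operators on the \<open>l\<close>-th tensor power of \<open>\<complex>\<^sup>k\<close>. Two things follow.

  \<^item> If \<open>p\<close> increases on \<open>k + 1\<close> positions, the sum of the \<open>w\<^bsub>p r\<^esub>\<close> over all permutations \<open>r\<close> of these positions
    vanishes, because two of the positions get the same colour (\<open>antisymmetric_relation\<close>). This expresses \<open>w\<^sub>p\<close> by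
    lexicographically larger permutations.
  \<^item> If the positions can be given \<open>k\<close> colours such that \<open>p\<close> decreases on each colour, the colouring gives a
    functional on the span of the \<open>w\<^sub>p\<close> which is triangular for the lexicographic order. Hence the \<open>w\<^sub>p\<close> for
    these \<open>p\<close> are linearly independent (\<open>colourable_independent\<close>).

By Schensted's theorem each permutation is of one of these two kinds, according to whether the first row of its
insertion tableau is longer than \<open>k\<close> or not, and the Robinson--Schensted correspondence matches the second kind
with pairs of standard tableaux of equal shape with first row of length at most \<open>k\<close> (\<open>rsk_bij\<close>). After
transposition these are the pairs counted by \<open>\<Sum> (f\<^sup>\<lambda>)\<^sup>2\<close> over partitions with at most \<open>k\<close> parts.
\<close>

section \<open>Row insertion on lattice words\<close>

lemma count_list_Cons: "count_list (x # xs) y = count_list xs y + (if x = y then 1 else 0)"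
  by simp

text \<open>With the conditional outside the sum the two sides of a count are compared by linear arithmetic.\<close>

declare count_list.simps(2) [simp del] count_list_Cons [simp]

text \<open>Lattice words (Yamanouchi words) encode standard tableaux: the letter at a position is the row, counted from
1, of the entry at that position. The letter 0 marks an unused position, so that partial tableaux with
entries in \<open>{..<L}\<close> are words of the fixed length \<open>L\<close>.\<close>

definition lattice_word :: "nat list \<Rightarrow> bool" where
  "lattice_word w \<longleftrightarrow>
     (\<forall>m d. d \<ge> 1 \<longrightarrow> count_list (take m w) (Suc d) \<le> count_list (take m w) d)"

lemma lattice_word_snoc:
  "lattice_word (w @ [r]) \<longleftrightarrow> lattice_word w \<and> (r \<ge> 2 \<longrightarrow> count_list w r < count_list w (r - 1))"
proof
  assume L: "lattice_word (w @ [r])"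
  have "lattice_word w"
    unfolding lattice_word_def
  proof (intro allI impI)
    fix m d :: nat assume "d \<ge> 1"
    with L have "count_list (take (min m (length w)) (w @ [r])) (Suc d)
        \<le> count_list (take (min m (length w)) (w @ [r])) d"
      unfolding lattice_word_def by blast
    then show "count_list (take m w) (Suc d) \<le> count_list (take m w) d"
      by (cases "m \<le> length w") (auto simp: min_def)
  qed
  moreover have "count_list w r < count_list w (r - 1)" if "r \<ge> 2"
    using L[unfolded lattice_word_def, rule_format, of "r - 1" "Suc (length w)"] that
    by (cases r) auto
  ultimately show "lattice_word w \<and> (r \<ge> 2 \<longrightarrow> count_list w r < count_list w (r - 1))"
    by blast
next
  assume R: "lattice_word w \<and> (r \<ge> 2 \<longrightarrow> count_list w r < count_list w (r - 1))"
  show "lattice_word (w @ [r])"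
    unfolding lattice_word_def
  proof (intro allI impI)
    fix m d :: nat assume d: "d \<ge> 1"
    have 1: "count_list (take m w) (Suc d) \<le> count_list (take m w) d"
      using R d unfolding lattice_word_def by blast
    show "count_list (take m (w @ [r])) (Suc d) \<le> count_list (take m (w @ [r])) d"
      using 1 R d by (cases "m \<le> length w") auto
  qed
qed

lemma lattice_word_prefix: "lattice_word (u @ v) \<Longrightarrow> lattice_word u"
  by (induction v rule: rev_induct) (auto simp: lattice_word_snoc simp flip: append_assoc)

lemma lattice_word_le: "lattice_word w \<Longrightarrow> d \<ge> 1 \<Longrightarrow> count_list w (Suc d) \<le> count_list w d"
  unfolding lattice_word_def by (metis order_refl take_all_iff)

text \<open>In this encoding row insertion is one scan of the word. The travelling row number \<open>d\<close> turns the next letter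
\<open>d\<close> into \<open>Suc d\<close>, that is, the next larger entry of row \<open>d\<close> is bumped into row \<open>Suc d\<close>, and then
\<open>Suc d\<close> travels on. The final value \<open>bump_row\<close> is the row of the new cell.\<close>

primrec bump :: "nat \<Rightarrow> nat list \<Rightarrow> nat list" where
  "bump d [] = []"
| "bump d (r # w) = (if r = d then Suc d # bump (Suc d) w else r # bump d w)"

primrec bump_row :: "nat \<Rightarrow> nat list \<Rightarrow> nat" where
  "bump_row d [] = d"
| "bump_row d (r # w) = (if r = d then bump_row (Suc d) w else bump_row d w)"

lemma length_bump [simp]: "length (bump d w) = length w"
  by (induction w arbitrary: d) auto

lemma bump_append: "bump d (u @ w) = bump d u @ bump (bump_row d u) w"
  by (induction u arbitrary: d) auto

lemma bump_row_append: "bump_row d (u @ w) = bump_row (bump_row d u) w"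
  by (induction u arbitrary: d) auto

lemma bump_absent: "d \<notin> set w \<Longrightarrow> bump d w = w" "d \<notin> set w \<Longrightarrow> bump_row d w = d"
  by (induction w) auto

lemma bump_row_ge: "d \<le> bump_row d w"
proof (induction w arbitrary: d)
  case (Cons r w)
  from Cons[of d] Cons[of "Suc d"] show ?case by auto
qed simp

text \<open>Reading from the right, the travelling row number and the original letters can be recovered.\<close>

lemma bump_inj:
  "length v = length w \<Longrightarrow> bump d v = bump e w \<Longrightarrow> bump_row d v = bump_row e w \<Longrightarrow> v = w \<and> d = e"
proof (induction v arbitrary: w rule: rev_induct)
  case (snoc r v)
  then obtain s w' where w: "w = w' @ [s]" by (metis length_0_conv length_append_singleton nat.simps(3) rev_exhaust)
  from snoc.prems snoc.IH[of w'] show ?case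
    unfolding w by (auto simp: bump_append bump_row_append split: if_splits)
qed simp

definition row_insert :: "nat list \<Rightarrow> nat \<Rightarrow> nat list" where
  "row_insert P x = take x P @ 1 # bump 1 (drop (Suc x) P)"

definition new_row :: "nat list \<Rightarrow> nat \<Rightarrow> nat" where
  "new_row P x = bump_row 1 (drop (Suc x) P)"

lemma count_bump:
  assumes "x \<ge> 1"
  shows "count_list (u @ 1 # bump 1 v) x = count_list (u @ 0 # v) x + (if x = bump_row 1 v then 1 else 0)"
proof (induction v rule: rev_induct)
  case (snoc r v)
  have "bump_row 1 v \<ge> 1" by (rule bump_row_ge)
  with snoc show ?case using assms by (auto simp: bump_append bump_row_append)
qed (use assms in auto)

text \<open>Besides the lattice property the induction along the word carries the statement that the new cell fits
under the shape reached so far; the latter also makes the recording word a lattice word.\<close>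

lemma lattice_bump:
  assumes "lattice_word (u @ 0 # v)"
  shows "lattice_word (u @ 1 # bump 1 v) \<and>
     (bump_row 1 v \<ge> 2 \<longrightarrow>
       count_list (u @ 0 # v) (bump_row 1 v) < count_list (u @ 0 # v) (bump_row 1 v - 1))"
  using assms
proof (induction v rule: rev_induct)
  case Nil
  then show ?case
    using lattice_word_snoc[of u 0] lattice_word_snoc[of u 1] by auto
next
  case (snoc r v)
  let ?e = "bump_row 1 v" and ?P = "u @ 0 # v" and ?P' = "u @ 1 # bump 1 v"
  have e: "?e \<ge> 1" by (rule bump_row_ge)
  have L: "lattice_word ?P" and r: "r \<ge> 2 \<Longrightarrow> count_list ?P r < count_list ?P (r - 1)"
    using snoc.prems lattice_word_snoc[of ?P r] by auto
  have L': "lattice_word ?P'" and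
    E: "?e \<ge> 2 \<Longrightarrow> count_list ?P ?e < count_list ?P (?e - 1)"
    using snoc.IH[OF L] by auto
  have c: "count_list ?P' x = count_list ?P x + (if x = ?e then 1 else 0)" if "x \<ge> 1" for x
    using count_bump[OF that] .
  show ?case
  proof (cases "r = ?e")
    case True
    have "count_list ?P (Suc ?e) \<le> count_list ?P ?e" using lattice_word_le[OF L e] .
    then have "lattice_word (?P' @ [Suc ?e])"
      using L' e c[of "Suc ?e"] c[of ?e] unfolding lattice_word_snoc by auto
    moreover have "count_list (?P @ [?e]) (Suc ?e) < count_list (?P @ [?e]) ?e"
      using \<open>count_list ?P (Suc ?e) \<le> count_list ?P ?e\<close> e by (cases ?e) auto
    ultimately show ?thesis using True e
      by (auto simp: bump_append bump_row_append split: if_splits)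
  next
    case False
    have "lattice_word (?P' @ [r])"
      unfolding lattice_word_snoc using L' r c[of r] c[of "r - 1"] False by auto
    moreover have "?e \<ge> 2 \<Longrightarrow> count_list (?P @ [r]) ?e < count_list (?P @ [r]) (?e - 1)"
      using E False by auto
    ultimately show ?thesis using False
      by (simp add: bump_append bump_row_append)
  qed
qed

text \<open>Reverse insertion: a removable corner of the shape determines where the scan ended.\<close>

lemma bump_surj:
  assumes "lattice_word w" "d \<ge> 1" "count_list w (Suc d) < count_list w d"
  shows "\<exists>u v. w = u @ 1 # bump 1 v \<and> bump_row 1 v = d \<and> lattice_word (u @ 0 # v)"
  using assms
proof (induction d arbitrary: w)
  case (Suc d w)
  \<comment> \<open>The last \<open>Suc d\<close> in \<open>w\<close> must be the letter bumped last; put \<open>d\<close> back in its place and recurse on the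
    part before it.\<close>
  have "Suc d \<in> set w" using Suc.prems(3) count_list_0_iff[of w "Suc d"] by linarith
  then obtain a b where w: "w = a @ Suc d # b" and b: "Suc d \<notin> set b"
    using split_list_last by metis
  have La: "lattice_word (a @ [Suc d])"
    using Suc.prems(1) lattice_word_prefix[of "a @ [Suc d]" b] w by simp
  \<comment> \<open>Undoing a bump lowers the count of \<open>Suc d\<close> by one from here on. Past the last \<open>Suc d\<close> this is
    harmless because the counts of \<open>Suc d\<close> and \<open>Suc (Suc d)\<close> still differ at the end of \<open>w\<close>.\<close>
  have key: "lattice_word (p @ x # b)"
    if p: "lattice_word p" "x \<le> d" "x \<ge> 2 \<longrightarrow> count_list p x < count_list p (x - 1)"
       "\<And>y. y \<ge> 1 \<Longrightarrow> count_list (p @ [x]) y = count_list a y" for p x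
  proof -
    have "lattice_word (p @ x # b')" if "b = b' @ c" for b' c
      using that
    proof (induction b' arbitrary: c rule: rev_induct)
      case Nil
      then show ?case using p by (simp add: lattice_word_snoc)
    next
      case (snoc r b')
      have "lattice_word (p @ x # b')" using snoc.IH[of "r # c"] snoc.prems by simp
      moreover have "count_list (p @ x # b') r < count_list (p @ x # b') (r - 1)" if r: "r \<ge> 2"
      proof -
        have rd: "r \<noteq> Suc d" using b snoc.prems by auto
        have 1: "count_list (p @ x # b') y = count_list a y + count_list b' y" if "y \<ge> 1" for y
          using p(4)[OF that] by (auto split: if_splits)
        have "lattice_word (a @ Suc d # b' @ [r])"
          using Suc.prems(1) lattice_word_prefix[of "a @ Suc d # b' @ [r]" c] w snoc.prems by simp
        then have 2: "count_list (a @ Suc d # b') r < count_list (a @ Suc d # b') (r - 1)"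
          using r lattice_word_snoc[of "a @ Suc d # b'" r] by simp
        show ?thesis
        proof (cases "r = Suc (Suc d)")
          case True
          have "count_list b' (Suc d) = 0" "count_list b (Suc d) = 0"
            using b snoc.prems by (auto simp: count_list_0_iff)
          then show ?thesis using Suc.prems(3) 1[of r] 1[of "r - 1"] True
            unfolding w snoc.prems by (simp)
        next
          case False
          then have "r - 1 \<noteq> Suc d" "r - 1 \<ge> 1" using r by simp_all
          then show ?thesis using 1[of r] 1[of "r - 1"] r rd 2 by auto
        qed
      qed
      ultimately show ?case using lattice_word_snoc[of "p @ x # b'" r] by simp
    qed
    from this[of b "[]"] show ?thesis by simp
  qed
  show ?case
  proof (cases "d = 0")
    case True
    have "lattice_word a" using La lattice_word_snoc by blast
    then have "lattice_word (a @ 0 # b)" using key[of a 0] True by auto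
    moreover have "bump 1 b = b" "bump_row 1 b = 1" using b True by (auto simp: bump_absent)
    ultimately show ?thesis using w True by (intro exI[of _ a] exI[of _ b]) simp
  next
    case False
    then have d: "d \<ge> 1" by simp
    have L: "lattice_word a" "count_list a (Suc d) < count_list a d"
      using La d by (auto simp: lattice_word_snoc)
    from Suc.IH[OF L(1) d L(2)] obtain u v where
      a: "a = u @ 1 # bump 1 v" and v: "bump_row 1 v = d" and Luv: "lattice_word (u @ 0 # v)"
      by blast
    have c: "count_list a x = count_list (u @ 0 # v) x + (if x = d then 1 else 0)" if "x \<ge> 1" for x
      using count_bump[OF that, of u v] a v by simp
    have "d \<ge> 2 \<longrightarrow> count_list (u @ 0 # v) d < count_list (u @ 0 # v) (d - 1)"
      using lattice_bump[OF Luv] v by simp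
    moreover have "count_list ((u @ 0 # v) @ [d]) y = count_list a y" if "y \<ge> 1" for y
      using c[OF that] by simp
    ultimately have "lattice_word ((u @ 0 # v) @ d # b)" using key[of "u @ 0 # v" d] Luv by blast
    moreover have "bump 1 (v @ d # b) = bump 1 v @ Suc d # b" "bump_row 1 (v @ d # b) = Suc d"
      using v b by (auto simp: bump_append bump_row_append bump_absent)
    ultimately show ?thesis using w a by (intro exI[of _ u] exI[of _ "v @ d # b"]) simp
  qed
qed simp

text \<open>Both members of the pair are lattice words: the first is indexed by the values that have been inserted, the
second by the times at which they were inserted.\<close>

definition rsk :: "nat \<Rightarrow> nat list \<Rightarrow> nat list \<times> nat list" where
  "rsk L xs = foldl (\<lambda>(P, Q) x. (row_insert P x, Q @ [new_row P x])) (replicate L 0, []) xs"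

lemma rsk_Nil: "rsk L [] = (replicate L 0, [])" by (simp add: rsk_def)

lemma rsk_snoc: "rsk L (xs @ [x]) =
  (row_insert (fst (rsk L xs)) x, snd (rsk L xs) @ [new_row (fst (rsk L xs)) x])"
  by (simp add: rsk_def case_prod_beta)

definition partial_perms :: "nat \<Rightarrow> nat \<Rightarrow> nat list set" where
  "partial_perms L m = {xs. distinct xs \<and> set xs \<subseteq> {..<L} \<and> length xs = m}"

definition tableau_pairs :: "nat \<Rightarrow> nat \<Rightarrow> (nat list \<times> nat list) set" where
  "tableau_pairs L m = {(P, Q). length P = L \<and> length Q = m \<and> 0 \<notin> set Q
     \<and> lattice_word P \<and> lattice_word Q \<and> (\<forall>d\<ge>1. count_list P d = count_list Q d)}"

lemma partial_perms_snoc: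
  "xs @ [x] \<in> partial_perms L (Suc m) \<longleftrightarrow> xs \<in> partial_perms L m \<and> x < L \<and> x \<notin> set xs"
  by (auto simp: partial_perms_def)

lemma partial_perms_SucE:
  assumes "ys \<in> partial_perms L (Suc m)"
  obtains xs x where "ys = xs @ [x]" "xs \<in> partial_perms L m" "x < L" "x \<notin> set xs"
  using assms partial_perms_snoc
  by (metis (mono_tags, lifting) length_0_conv mem_Collect_eq nat.simps(3) partial_perms_def rev_exhaust)

lemma row_insert_split:
  assumes "x < length P" "P ! x = 0"
  obtains u v where "P = u @ 0 # v" "length u = x"
    "row_insert P x = u @ 1 # bump 1 v" "new_row P x = bump_row 1 v"
proof
  show "P = take x P @ 0 # drop (Suc x) P" using assms by (metis id_take_nth_drop)
qed (use assms in \<open>auto simp: row_insert_def new_row_def\<close>)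

lemma bump_nth_0: "d \<ge> 1 \<Longrightarrow> i < length v \<Longrightarrow> bump d v ! i = 0 \<longleftrightarrow> v ! i = 0"
proof (induction v arbitrary: d i)
  case (Cons r v)
  then show ?case by (cases i) auto
qed simp

lemma row_insert_nth_0:
  assumes "x < length P" "P ! x = 0" "i < length P"
  shows "row_insert P x ! i = 0 \<longleftrightarrow> P ! i = 0 \<and> i \<noteq> x"
proof -
  from row_insert_split[OF assms(1,2)] obtain u v where
    P: "P = u @ 0 # v" "length u = x" "row_insert P x = u @ 1 # bump 1 v" by metis
  show ?thesis
  proof (cases "i > x")
    case True
    then obtain j where j: "i = Suc (x + j)" using less_imp_Suc_add by blast
    then have "j < length v" using P(1,2) assms(3) by simp
    then show ?thesis unfolding P(3) unfolding P(1) P(2)[symmetric] j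
      using bump_nth_0[of 1 j v] P(2) j by (simp add: nth_append)
  next
    case False
    then show ?thesis unfolding P(3) unfolding P(1) using P(2)
      by (cases "i = x") (auto simp: nth_append)
  qed
qed

lemma rsk_props:
  assumes "xs \<in> partial_perms L m"
  shows "rsk L xs \<in> tableau_pairs L m
    \<and> (\<forall>i<L. fst (rsk L xs) ! i = 0 \<longleftrightarrow> i \<notin> set xs)"
  using assms
proof (induction m arbitrary: xs)
  case 0
  then have "xs = []" by (simp add: partial_perms_def)
  moreover have "lattice_word (replicate L 0)" "lattice_word []"
    by (auto simp: lattice_word_def count_list_0_iff dest: in_set_takeD)
  moreover have "count_list (replicate L (0::nat)) d = 0" if "d \<ge> 1" for d
    using that by (simp add: count_list_0_iff)
  ultimately show ?case by (auto simp: rsk_Nil tableau_pairs_def)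
next
  case (Suc m ys)
  then obtain xs x where ys: "ys = xs @ [x]" "xs \<in> partial_perms L m" "x < L" "x \<notin> set xs"
    using partial_perms_SucE by metis
  obtain P Q where PQ: "rsk L xs = (P, Q)" by fastforce
  note IH = Suc.IH[OF ys(2), unfolded PQ]
  have x: "x < length P" "P ! x = 0" using IH ys by (auto simp: tableau_pairs_def)
  from row_insert_split[OF x] obtain u v where
    P: "P = u @ 0 # v" "length u = x" "row_insert P x = u @ 1 # bump 1 v"
     "new_row P x = bump_row 1 v" by metis
  let ?e = "bump_row 1 v"
  have L: "lattice_word P" "lattice_word Q" "0 \<notin> set Q" "length P = L" "length Q = m"
    "\<And>d. d \<ge> 1 \<Longrightarrow> count_list P d = count_list Q d"
    using IH by (auto simp: tableau_pairs_def)
  have e: "?e \<ge> 1" by (rule bump_row_ge)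
  have "lattice_word (Q @ [?e])"
    unfolding lattice_word_snoc using L e lattice_bump[of u v] P(1) by auto
  moreover have "count_list (row_insert P x) d = count_list (Q @ [?e]) d" if "d \<ge> 1" for d
    using count_bump[OF that, of u v] P(1,3) L(6)[OF that] by simp
  moreover have "lattice_word (row_insert P x)" using lattice_bump[of u v] P L by auto
  ultimately have "(row_insert P x, Q @ [?e]) \<in> tableau_pairs L (Suc m)"
    using L e P by (auto simp: tableau_pairs_def)
  moreover have "\<forall>i<L. row_insert P x ! i = 0 \<longleftrightarrow> i \<notin> set ys"
    using row_insert_nth_0[OF x] IH L ys by auto
  ultimately show ?case using ys P(4) PQ by (simp add: rsk_snoc)
qed

lemma row_insert_inj:
  assumes "x < length P" "P ! x = 0" "y < length P'" "P' ! y = 0"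
    and "row_insert P x = row_insert P' y" "new_row P x = new_row P' y"
  shows "P = P' \<and> x = y"
proof -
  from row_insert_split[OF assms(1,2)] obtain u v where
    P: "P = u @ 0 # v" "length u = x" "row_insert P x = u @ 1 # bump 1 v"
     "new_row P x = bump_row 1 v" by metis
  from row_insert_split[OF assms(3,4)] obtain u' v' where
    P': "P' = u' @ 0 # v'" "length u' = y" "row_insert P' y = u' @ 1 # bump 1 v'"
     "new_row P' y = bump_row 1 v'" by metis
  have l: "length P = length P'"
    using arg_cong[OF assms(5), of length] P(1,3) P'(1,3) by simp
  \<comment> \<open>Only the unused position turns 0 into 1. If two insertions with equal result started at different
    positions, undoing the later part of the earlier one would pass through the start of the other,
    where a letter 1 was not yet bumped although the travelling row is still 1.\<close>
  have not_less: False
    if bm: "u1 @ 1 # bump 1 v1 = u2 @ 1 # bump 1 v2" and br: "bump_row 1 v1 = bump_row 1 v2"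
      and lt: "length u1 < length u2" for u1 v1 u2 v2
  proof -
    have "u2 ! length u1 = (u2 @ 1 # bump 1 v2) ! length u1" using lt by (simp add: nth_append)
    also have "\<dots> = 1" using arg_cong[OF bm, of "\<lambda>w. w ! length u1"] by simp
    finally have u2: "u2 = take (length u1) u2 @ 1 # drop (Suc (length u1)) u2"
      using lt id_take_nth_drop by metis
    obtain u0 w where u0: "u2 = u0 @ 1 # w" "length u0 = length u1"
      using u2 lt by (metis length_take min.absorb4)
    have "bump 1 v1 = w @ 1 # bump 1 v2"
      using bm u0(2) unfolding u0(1) by simp
    define a b where "a = take (length w) v1" and "b = drop (length w) v1"
    have v1: "v1 = a @ b" by (simp add: a_def b_def)
    have la: "length a = length w"
      using arg_cong[OF \<open>bump 1 v1 = w @ 1 # bump 1 v2\<close>, of length] by (simp add: a_def)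
    have b: "bump (bump_row 1 a) b = 1 # bump 1 v2"
      using \<open>bump 1 v1 = w @ 1 # bump 1 v2\<close> la unfolding v1 bump_append by simp
    define e where "e = bump_row 1 a"
    have e1: "e \<ge> 1" unfolding e_def by (rule bump_row_ge)
    obtain r c where bc: "b = r # c" using b by (cases b) auto
    have "r = 1" "r \<noteq> e" "bump e c = bump 1 v2" using b e1 unfolding bc e_def[symmetric]
      by (auto split: if_splits)
    moreover have "bump_row e c = bump_row 1 v2"
      using br \<open>r \<noteq> e\<close> unfolding v1 bump_row_append bc e_def[symmetric] by simp
    ultimately have "e = 1" using bump_inj[of c v2 e 1] by (metis length_bump)
    with \<open>r = 1\<close> \<open>r \<noteq> e\<close> show False by simp
  qed
  have eq: "u @ 1 # bump 1 v = u' @ 1 # bump 1 v'" "bump_row 1 v = bump_row 1 v'"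
    using assms(5,6) P P' by simp_all
  have "length u = length u'"
    using not_less[OF eq] not_less[OF eq[symmetric]] by (metis linorder_neqE_nat)
  then have "u = u'" "bump 1 v = bump 1 v'" using eq(1) by simp_all
  moreover have "v = v'" using bump_inj[of v v' 1 1] eq(2) calculation(2) by (metis length_bump)
  ultimately show ?thesis using P P' by simp
qed

theorem rsk_bij: "bij_betw (rsk L) (partial_perms L m) (tableau_pairs L m)"
proof -
  have "inj_on (rsk L) (partial_perms L m)"
  proof (induction m)
    case 0
    show ?case by (auto simp: partial_perms_def inj_on_def)
  next
    case (Suc m)
    show ?case
    proof (rule inj_onI)
      fix a b assume "a \<in> partial_perms L (Suc m)" "b \<in> partial_perms L (Suc m)"
        and eq: "rsk L a = rsk L b"
      then obtain xs x ys y where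
        a: "a = xs @ [x]" "xs \<in> partial_perms L m" "x < L" "x \<notin> set xs" and
        b: "b = ys @ [y]" "ys \<in> partial_perms L m" "y < L" "y \<notin> set ys"
        by (metis partial_perms_SucE)
      have l: "length (fst (rsk L xs)) = L" "length (fst (rsk L ys)) = L"
        using rsk_props a b by (auto simp: tableau_pairs_def case_prod_beta)
      have z: "fst (rsk L xs) ! x = 0" "fst (rsk L ys) ! y = 0"
        using rsk_props a b by blast+
      have "fst (rsk L xs) = fst (rsk L ys) \<and> x = y"
        using row_insert_inj[of x "fst (rsk L xs)" y "fst (rsk L ys)"] l z a b eq
        by (simp add: rsk_snoc)
      moreover have "snd (rsk L xs) = snd (rsk L ys)" using eq a b by (simp add: rsk_snoc)
      ultimately have "rsk L xs = rsk L ys" "x = y" by (auto intro: prod_eqI)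
      then show "a = b" using inj_onD[OF Suc, of xs ys] a b by simp
    qed
  qed
  moreover have "tableau_pairs L m \<subseteq> rsk L ` partial_perms L m"
  proof (induction m)
    case 0
    have "P = replicate L 0" if "length P = L" "\<forall>d\<ge>1. count_list P d = 0" for P :: "nat list"
      using that by (metis One_nat_def count_list_0_iff not_less_eq_eq replicate_eqI zero_le le_0_eq not0_implies_Suc Suc_le_mono)
    then have "tableau_pairs L 0 \<subseteq> {rsk L []}" by (auto simp: tableau_pairs_def rsk_Nil)
    then show ?case by (auto simp: partial_perms_def)
  next
    case (Suc m)
    show ?case
    proof
      fix z assume z: "z \<in> tableau_pairs L (Suc m)"
      then obtain P Q d where zz: "z = (P, Q @ [d])" and lQ: "length Q = m"
        by (auto simp: tableau_pairs_def length_Suc_conv_rev)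
      have L: "length P = L" "lattice_word P" "lattice_word Q" "0 \<notin> set Q" "d \<ge> 1"
        "\<And>x. x \<ge> 1 \<Longrightarrow> count_list P x = count_list Q x + (if x = d then 1 else 0)"
        using z unfolding zz by (auto simp: tableau_pairs_def lattice_word_snoc)
      have "count_list P (Suc d) < count_list P d"
        using L(6)[of d] L(6)[of "Suc d"] lattice_word_le[OF L(3,5)] L(5) by simp
      from bump_surj[OF L(2,5) this] obtain u v where
        uv: "P = u @ 1 # bump 1 v" "bump_row 1 v = d" "lattice_word (u @ 0 # v)" by blast
      have "count_list (u @ 0 # v) x = count_list Q x" if "x \<ge> 1" for x
        using count_bump[OF that, of u v] uv L(6)[OF that] by simp
      then have "(u @ 0 # v, Q) \<in> tableau_pairs L m"
        using L uv lQ by (auto simp: tableau_pairs_def)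
      then obtain xs where xs: "xs \<in> partial_perms L m" "rsk L xs = (u @ 0 # v, Q)"
        using Suc by (metis imageE subsetD)
      have lu: "length u < L" using L(1) uv(1) by simp
      have "length u \<notin> set xs" using rsk_props[OF xs(1)] xs(2) lu by force
      then have "xs @ [length u] \<in> partial_perms L (Suc m)"
        using xs lu partial_perms_snoc by blast
      moreover have "rsk L (xs @ [length u]) = z"
        using uv by (simp add: rsk_snoc xs zz row_insert_def new_row_def)
      ultimately show "z \<in> rsk L ` partial_perms L (Suc m)" by (metis imageI)
    qed
  qed
  moreover have "rsk L ` partial_perms L m \<subseteq> tableau_pairs L m" using rsk_props by blast
  ultimately show ?thesis by (simp add: bij_betw_def subset_antisym)
qed


section \<open>Increasing subsequences and the first row\<close>

lemma take_bump: "take j (bump d v) = bump d (take j v)"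
proof (induction v arbitrary: d j)
  case (Cons r v)
  then show ?case by (cases j) auto
qed simp

lemma bump_nth_1: "d \<ge> 1 \<Longrightarrow> i < length v \<Longrightarrow> bump d v ! i = 1 \<Longrightarrow> v ! i = 1"
proof (induction v arbitrary: d i)
  case (Cons r v)
  then show ?case by (cases i) (auto split: if_splits)
qed simp

lemma bump_row_gt: "d \<in> set v \<Longrightarrow> bump_row d v > d"
proof (induction v)
  case (Cons r v)
  then show ?case using bump_row_ge[of "Suc d" v] by auto
qed simp

lemma count_list_mono_take: "i \<le> j \<Longrightarrow> count_list (take i w) x \<le> count_list (take j w) x"
proof -
  assume "i \<le> j"
  then have "take j w = take i w @ drop i (take j w)"
    by (metis append_take_drop_id min.absorb1 take_take)
  then show ?thesis by (metis count_list_append le_add1)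
qed

lemma take_row_insert:
  assumes "length u < j"
  shows "take j (u @ 1 # bump 1 v) = u @ 1 # bump 1 (take (j - Suc (length u)) v)"
    and "take j (u @ 0 # v) = u @ 0 # take (j - Suc (length u)) v"
proof -
  obtain q where "j = Suc (length u + q)" using assms less_imp_Suc_add by blast
  then show "take j (u @ 1 # bump 1 v) = u @ 1 # bump 1 (take (j - Suc (length u)) v)"
    and "take j (u @ 0 # v) = u @ 0 # take (j - Suc (length u)) v"
    by (simp_all add: take_bump)
qed

lemma count_take_row_insert:
  assumes "x < length P" "P ! x = 0"
  shows "count_list (take j P) 1 \<le> count_list (take j (row_insert P x)) 1"
proof -
  from row_insert_split[OF assms] obtain u v where
    P: "P = u @ 0 # v" "length u = x" "row_insert P x = u @ 1 # bump 1 v" by metis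
  show ?thesis
  proof (cases "j \<le> x")
    case True
    then show ?thesis unfolding P(3) unfolding P(1) using P(2) by simp
  next
    case False
    then show ?thesis unfolding P(3) unfolding P(1) using P(2)
      by (simp only: take_row_insert count_bump)
  qed
qed

text \<open>Colour each inserted value by the number of entries of the first row to its left at that moment. The number
of first row entries in an initial segment of the values never decreases, so a later value of the same
colour has to be smaller.\<close>

lemma rsk_colouring:
  assumes "xs \<in> partial_perms L m"
  shows "\<exists>c. (\<forall>i<m. c i < count_list (take (Suc (xs ! i)) (fst (rsk L xs))) 1)
    \<and> (\<forall>j<m. \<forall>i<j. c i = c j \<longrightarrow> xs ! j < xs ! i)"
  using assms
proof (induction m arbitrary: xs)
  case (Suc m ys)
  then obtain xs x where ys: "ys = xs @ [x]" "xs \<in> partial_perms L m" "x < L" "x \<notin> set xs"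
    using partial_perms_SucE by metis
  define P where "P = fst (rsk L xs)"
  have lxs: "length xs = m" using ys by (simp add: partial_perms_def)
  have PL: "length P = L" "P ! x = 0"
    using rsk_props[OF ys(2)] ys by (auto simp: tableau_pairs_def P_def case_prod_beta)
  have P': "fst (rsk L ys) = row_insert P x" by (simp add: ys rsk_snoc P_def)
  from Suc.IH[OF ys(2)] obtain c where
    c: "\<And>i. i < m \<Longrightarrow> c i < count_list (take (Suc (xs ! i)) P) 1"
      "\<And>i j. j < m \<Longrightarrow> i < j \<Longrightarrow> c i = c j \<Longrightarrow> xs ! j < xs ! i"
    unfolding P_def by blast
  define c' where "c' = c(m := count_list (take x P) 1)"
  have mono: "count_list (take j P) 1 \<le> count_list (take j (row_insert P x)) 1" for j
    using count_take_row_insert PL ys by simp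
  have "c' i < count_list (take (Suc (ys ! i)) (row_insert P x)) 1" if "i < Suc m" for i
  proof (cases "i = m")
    case True
    have "row_insert P x = take x P @ 1 # bump 1 (drop (Suc x) P)" by (simp add: row_insert_def)
    then have "take (Suc x) (row_insert P x) = take x P @ [1]" using PL ys by simp
    then show ?thesis using True lxs ys by (simp add: c'_def nth_append)
  next
    case False
    then have "c' i < count_list (take (Suc (ys ! i)) P) 1"
      using c(1)[of i] that lxs ys by (simp add: c'_def nth_append)
    with mono show ?thesis using order_less_le_trans by blast
  qed
  moreover have "ys ! j < ys ! i" if "j < Suc m" "i < j" "c' i = c' j" for i j
  proof (cases "j = m")
    case True
    \<comment> \<open>An earlier smaller value of the same colour would have left too many ones to the left of \<open>x\<close>.\<close>
    have "c i < count_list (take (Suc (xs ! i)) P) 1" using c(1) that True by simp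
    moreover have "c i = count_list (take x P) 1" using that True by (simp add: c'_def)
    ultimately have "\<not> xs ! i < x"
      using count_list_mono_take[of "Suc (xs ! i)" x P 1] by auto
    moreover have "xs ! i \<noteq> x" using ys(4) that True lxs by auto
    ultimately show ?thesis using True that ys lxs by (simp add: nth_append)
  next
    case False
    then show ?thesis using c(2)[of j i] that lxs ys by (simp add: c'_def nth_append)
  qed
  ultimately show ?case unfolding P' by blast
qed simp

definition increasing_at :: "nat list \<Rightarrow> nat set \<Rightarrow> bool" where
  "increasing_at xs I \<longleftrightarrow> I \<subseteq> {..<length xs} \<and> (\<forall>i\<in>I. \<forall>j\<in>I. i < j \<longrightarrow> xs ! i < xs ! j)"

lemma increasing_at_snoc:
  assumes "increasing_at xs I"
  shows "increasing_at (xs @ [x]) I"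
    and "\<forall>i\<in>I. xs ! i < x \<Longrightarrow> increasing_at (xs @ [x]) (insert (length xs) I)"
proof -
  have *: "\<And>i. i \<in> I \<Longrightarrow> i < length xs" using assms by (auto simp: increasing_at_def)
  show "increasing_at (xs @ [x]) I"
    using assms unfolding increasing_at_def by (auto simp: nth_append)
  show "increasing_at (xs @ [x]) (insert (length xs) I)" if "\<forall>i\<in>I. xs ! i < x"
    using assms that unfolding increasing_at_def by (auto simp: nth_append dest: *)
qed

text \<open>When a value enters the first row, its left neighbour there is the end of an increasing subsequence that it
prolongs.\<close>

lemma rsk_increasing:
  assumes "xs \<in> partial_perms L m" "y < L" "fst (rsk L xs) ! y = 1"
  shows "\<exists>I. increasing_at xs I \<and> card I = count_list (take (Suc y) (fst (rsk L xs))) 1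
    \<and> (\<forall>i\<in>I. xs ! i \<le> y)"
  using assms
proof (induction m arbitrary: xs y)
  case 0
  then have "xs = []" by (simp add: partial_perms_def)
  with 0 show ?case by (simp add: rsk_Nil)
next
  case (Suc m ys)
  then obtain xs x where ys: "ys = xs @ [x]" "xs \<in> partial_perms L m" "x < L" "x \<notin> set xs"
    using partial_perms_SucE by metis
  define P where "P = fst (rsk L xs)"
  have lxs: "length xs = m" using ys by (simp add: partial_perms_def)
  have PL: "length P = L" "P ! x = 0"
    using rsk_props[OF ys(2)] ys by (auto simp: tableau_pairs_def P_def case_prod_beta)
  have P': "fst (rsk L ys) = row_insert P x" by (simp add: ys rsk_snoc P_def)
  from row_insert_split[of x P] PL ys obtain u v where
    P: "P = u @ 0 # v" "length u = x" "row_insert P x = u @ 1 # bump 1 v" by metis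
  note IH = Suc.IH[OF ys(2), folded P_def]
  have old: ?case if Py: "P ! y = 1" and cnt: "count_list (take (Suc y) P) 1 = count_list (take (Suc y) (row_insert P x)) 1"
  proof -
    obtain I where I: "increasing_at xs I" "card I = count_list (take (Suc y) P) 1" "\<forall>i\<in>I. xs ! i \<le> y"
      using IH[OF Suc.prems(2) Py] by blast
    moreover have "\<forall>i\<in>I. ys ! i \<le> y"
      using I unfolding increasing_at_def ys(1) by (auto simp: nth_append)
    ultimately show ?thesis using increasing_at_snoc(1) cnt P' ys(1) by metis
  qed
  consider "y < x" | "y = x" | "y > x" by linarith
  then show ?case
  proof cases
    case 1
    then show ?thesis using old Suc.prems(3) unfolding P' P(3) unfolding P(1) using P(2)
      by (simp add: nth_append)
  next
    case 2
    have t: "take (Suc y) (row_insert P x) = u @ [1]" using P 2 by simp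
    obtain I where I: "increasing_at xs I" "card I = count_list u 1" "\<forall>i\<in>I. xs ! i < x"
    proof (cases "1 \<in> set u")
      case False
      then have "increasing_at xs {} \<and> card {} = count_list u 1"
        using count_list_0_iff[of u 1] by (simp add: increasing_at_def)
      then show ?thesis using that by blast
    next
      case True
      then obtain a b where u: "u = a @ 1 # b" "1 \<notin> set b" using split_list_last by metis
      have "length a < L" "P ! length a = 1" "take (Suc (length a)) P = a @ [1]" "length a < x"
        using P u PL by auto
      then obtain I where "increasing_at xs I" "card I = count_list (a @ [1]) 1" "\<forall>i\<in>I. xs ! i \<le> length a"
        using IH[of "length a"] by auto
      moreover have "count_list u 1 = count_list (a @ [1]) 1"
        using u count_list_0_iff[of b 1] by simp
      ultimately show ?thesis using that \<open>length a < x\<close> by fastforce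
    qed
    have "finite I" "m \<notin> I" using I(1) lxs by (auto simp: increasing_at_def finite_subset)
    then have "card (insert m I) = count_list (take (Suc y) (row_insert P x)) 1"
      using I(2) t by simp
    moreover have "increasing_at ys (insert m I)"
      using increasing_at_snoc(2)[OF I(1,3)] ys lxs by simp
    moreover have "\<forall>i\<in>insert m I. ys ! i \<le> y"
      using I lxs ys 2 unfolding increasing_at_def by (auto simp: nth_append less_imp_le)
    ultimately show ?thesis unfolding P' by blast
  next
    case 3
    define j where "j = y - Suc x"
    have y: "y = Suc (x + j)" using 3 by (simp add: j_def)
    have lv: "j < length v" using Suc.prems(2) PL P y by simp
    have "bump 1 v ! j = 1" using Suc.prems(3) unfolding P' P(3) y using P(2) by (simp add: nth_append)
    then have vj: "v ! j = 1" using bump_nth_1[OF _ lv, of 1] by simp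
    then have "1 \<in> set (take (Suc j) v)" using lv by (metis in_set_conv_nth length_take lessI min_less_iff_conj nth_take)
    from bump_row_gt[OF this] have "bump_row 1 (take (Suc j) v) \<noteq> 1" by simp
    then have "count_list (take (Suc y) P) 1 = count_list (take (Suc y) (row_insert P x)) 1"
      unfolding P(3) unfolding P(1) using P(2) y count_bump[of 1 u "take (Suc j) v"]
      by (simp only: take_row_insert) (simp add: take_row_insert)
    moreover have "P ! y = 1" using vj P y by (simp add: nth_append)
    ultimately show ?thesis using old by blast
  qed
qed

lemma increasing_at_subset: "increasing_at xs I \<Longrightarrow> J \<subseteq> I \<Longrightarrow> increasing_at xs J"
  unfolding increasing_at_def by blast

text \<open>This and \<open>first_row_increasing\<close> are the two halves of Schensted's theorem on the length of the first row.
They are all that is needed about increasing subsequences: the permutations with a first row of length at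
most \<open>k\<close> split into \<open>k\<close> decreasing sequences, the others contain an increasing sequence of length
\<open>Suc k\<close>.\<close>

lemma first_row_colouring:
  assumes "xs \<in> partial_perms L m" "count_list (fst (rsk L xs)) 1 \<le> k"
  shows "\<exists>c. (\<forall>i<m. c i < k) \<and> (\<forall>j<m. \<forall>i<j. c i = c j \<longrightarrow> xs ! j < xs ! i)"
proof -
  have "count_list (take j w) 1 \<le> count_list w 1" for j and w :: "nat list"
    by (metis append_take_drop_id count_list_append le_add1)
  then show ?thesis using rsk_colouring[OF assms(1)] assms(2)
    by (meson le_trans order_less_le_trans)
qed

lemma first_row_increasing:
  assumes "xs \<in> partial_perms L m" "k \<le> count_list (fst (rsk L xs)) 1"
  shows "\<exists>I. increasing_at xs I \<and> card I = k"
proof (cases "count_list (fst (rsk L xs)) 1 = 0")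
  case True
  then show ?thesis using assms(2) by (intro exI[of _ "{}"]) (simp add: increasing_at_def)
next
  case False
  define P where "P = fst (rsk L xs)"
  have "1 \<in> set P" using False count_list_0_iff[of P 1] unfolding P_def by metis
  then obtain a b where P: "P = a @ 1 # b" "1 \<notin> set b" using split_list_last by metis
  have "length P = L" using rsk_props[OF assms(1)] by (auto simp: tableau_pairs_def P_def case_prod_beta)
  then have "length a < L" "P ! length a = 1" using P by auto
  then obtain I where I: "increasing_at xs I" "card I = count_list (take (Suc (length a)) P) 1"
    using rsk_increasing[OF assms(1)] unfolding P_def by blast
  have "card I = count_list P 1" using I(2) P count_list_0_iff[of b 1] by simp
  with assms(2) obtain J where "J \<subseteq> I" "card J = k" unfolding P_def by (metis obtain_subset_with_card_n)
  then show ?thesis using increasing_at_subset[OF I(1)] by blast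
qed

section \<open>Standard tableaux as lattice words\<close>

text \<open>Tableaux are read by columns: the letter of an entry is its column, counted from 1. Compared with the rows
of the insertion tableau this is the transposed tableau, so that the length of the first row becomes the
number of parts.\<close>

definition column_height :: "nat list \<Rightarrow> nat \<Rightarrow> nat" where
  "column_height ps j = card {i. (i, j) \<in> young_cells ps}"

definition shape_words :: "nat list \<Rightarrow> nat list set" where
  "shape_words ps = {w. length w = sum_list ps \<and> 0 \<notin> set w \<and> lattice_word w
     \<and> (\<forall>j. count_list w (Suc j) = column_height ps j)}"

lemma down_closed_nat_set:
  assumes "finite (S :: nat set)" "\<And>a b. b \<in> S \<Longrightarrow> a \<le> b \<Longrightarrow> a \<in> S"
  shows "S = {..<card S}"
proof -
  have "\<exists>n. S = {..<n}"
  proof (cases "S = {}")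
    case False
    then have "S = {..<Suc (Max S)}"
      using assms Max_in[OF assms(1) False] Max_ge[OF assms(1)] by (auto simp: less_Suc_eq_le intro: assms(2)[OF Max_in[OF assms(1) False]])
    then show ?thesis by blast
  qed auto
  then show ?thesis by auto
qed

lemma young_cells_Sigma: "young_cells ps = Sigma {..<length ps} (\<lambda>i. {..<ps ! i})"
  by (auto simp: young_cells_def)

lemma card_young_cells: "card (young_cells ps) = sum_list ps"
  unfolding young_cells_Sigma by (simp add: sum_list_sum_nth atLeast0LessThan)

lemma young_cells_down:
  assumes "sorted_wrt (\<ge>) ps" "(i, j) \<in> young_cells ps" "i' \<le> i" "j' \<le> j"
  shows "(i', j') \<in> young_cells ps"
  using assms sorted_wrt_nth_less[OF assms(1), of i' i]
  by (cases "i' = i") (auto simp: young_cells_def)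

lemma column_height_iff:
  assumes "sorted_wrt (\<ge>) ps"
  shows "i < column_height ps j \<longleftrightarrow> (i, j) \<in> young_cells ps"
proof -
  have "finite {i. (i, j) \<in> young_cells ps}"
    by (rule finite_subset[of _ "{..<length ps}"]) (auto simp: young_cells_def)
  from down_closed_nat_set[OF this] young_cells_down[OF assms]
  have "{i. (i, j) \<in> young_cells ps} = {..<column_height ps j}"
    unfolding column_height_def by blast
  then show ?thesis by blast
qed

lemma column_height_0: "ps \<in> partitions_of l \<Longrightarrow> column_height ps 0 = length ps"
proof -
  assume "ps \<in> partitions_of l"
  then have "{i. (i, 0) \<in> young_cells ps} = {..<length ps}"
    by (auto simp: young_cells_def partitions_of_def) (metis gr0I nth_mem)
  then show ?thesis by (simp add: column_height_def)
qed

lemma partition_eqI: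
  assumes "ps \<in> partitions_of l" "qs \<in> partitions_of m" "column_height ps = column_height qs"
  shows "ps = qs"
proof (rule nth_equalityI)
  show l: "length ps = length qs" using assms column_height_0 by metis
  fix i assume i: "i < length ps"
  have "(i, j) \<in> young_cells ps \<longleftrightarrow> (i, j) \<in> young_cells qs" for j
    using assms column_height_iff by (auto simp: partitions_of_def simp flip: column_height_iff)
  then have "j < ps ! i \<longleftrightarrow> j < qs ! i" for j using i l by (simp add: young_cells_def)
  then show "ps ! i = qs ! i" by (metis linorder_neqE_nat order_less_irrefl)
qed

lemma count_list_map_upt: "count_list (map f [0..<m]) y = card {i. i < m \<and> f i = y}"
proof (induction m)
  case (Suc m)
  have "{i. i < Suc m \<and> f i = y} = {i. i < m \<and> f i = y} \<union> (if f m = y then {m} else {})"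
    by (auto simp: less_Suc_eq)
  then show ?case using Suc by (auto simp: card_insert_if)
qed simp

lemma count_list_occurrence:
  "i < count_list w y \<Longrightarrow> \<exists>m<length w. w ! m = y \<and> count_list (take m w) y = i"
proof (induction w rule: rev_induct)
  case (snoc r w)
  show ?case
  proof (cases "i < count_list w y")
    case True
    then obtain m where "m < length w" "w ! m = y" "count_list (take m w) y = i"
      using snoc.IH by blast
    then show ?thesis by (intro exI[of _ m]) (simp add: nth_append)
  next
    case False
    then show ?thesis using snoc.prems
      by (intro exI[of _ "length w"]) (auto split: if_splits)
  qed
qed simp

text \<open>The inverse reading: the cell of the entry at position \<open>m\<close> is found by counting the earlier occurrences of
its letter.\<close>

definition occurrence_cell :: "nat list \<Rightarrow> nat \<Rightarrow> nat \<times> nat" where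
  "occurrence_cell w m = (count_list (take m w) (w ! m), w ! m - 1)"

lemma count_take_less:
  assumes "m < m'" "m < length w"
  shows "count_list (take m w) (w ! m) < count_list (take m' w) (w ! m)"
proof -
  have "count_list (take (Suc m) w) (w ! m) = Suc (count_list (take m w) (w ! m))"
    using assms by (simp add: take_Suc_conv_app_nth)
  then show ?thesis using count_list_mono_take[of "Suc m" m' w "w ! m"] assms by simp
qed

lemma occurrence_cell_bij:
  assumes "0 \<notin> set w"
  shows "bij_betw (occurrence_cell w) {..<length w} {(i, j). i < count_list w (Suc j)}"
proof -
  have pos: "w ! m \<noteq> 0" if "m < length w" for m using assms that nth_mem by metis
  have "inj_on (occurrence_cell w) {..<length w}"
  proof (rule linorder_inj_onI)
    fix m m' assume m: "m < m'" "m \<in> {..<length w}" "m' \<in> {..<length w}"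
    show "occurrence_cell w m \<noteq> occurrence_cell w m'"
    proof
      assume eq: "occurrence_cell w m = occurrence_cell w m'"
      then have 1: "count_list (take m w) (w ! m) = count_list (take m' w) (w ! m')"
        and "w ! m - 1 = w ! m' - 1" unfolding occurrence_cell_def prod.inject by blast+
      moreover have "w ! m \<noteq> 0" "w ! m' \<noteq> 0"
        using pos[of m] pos[of m'] m(2,3) by blast+
      ultimately have 2: "w ! m' = w ! m" by (metis Suc_pred' not_gr_zero)
      have "count_list (take m w) (w ! m) < count_list (take m' w) (w ! m)"
        by (rule count_take_less) (use m in auto)
      with 1[unfolded 2] show False by linarith
    qed
  qed auto
  moreover have "occurrence_cell w ` {..<length w} \<subseteq> {(i, j). i < count_list w (Suc j)}"
  proof (rule image_subsetI)
    fix m assume "m \<in> {..<length w}"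
    then have m: "m < length w" by simp
    obtain y where y: "w ! m = Suc y" using pos[OF m] not0_implies_Suc by blast
    have "count_list (take m w) (Suc y) < count_list w (Suc y)"
      using count_take_less[OF m m] unfolding y by simp
    then show "occurrence_cell w m \<in> {(i, j). i < count_list w (Suc j)}"
      unfolding occurrence_cell_def y by simp
  qed
  moreover have "{(i, j). i < count_list w (Suc j)} \<subseteq> occurrence_cell w ` {..<length w}"
  proof (rule subsetI)
    fix p assume p: "p \<in> {(i, j). i < count_list w (Suc j)}"
    obtain i j where ij: "p = (i, j)" by (cases p)
    have i: "i < count_list w (Suc j)" using p unfolding ij by simp
    obtain m where "m < length w" "w ! m = Suc j" "count_list (take m w) (Suc j) = i"
      using count_list_occurrence[OF i] by (elim exE conjE) rule
    then have "p = occurrence_cell w m" "m \<in> {..<length w}"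
      by (simp_all add: ij occurrence_cell_def)
    then show "p \<in> occurrence_cell w ` {..<length w}" by (rule image_eqI)
  qed
  ultimately show ?thesis unfolding bij_betw_def by blast
qed

text \<open>The letter counts of a lattice word are the column heights of a partition, the conjugate of these counts.\<close>

lemma lattice_word_shape:
  assumes "lattice_word w" "0 \<notin> set w"
  shows "\<exists>ps\<in>partitions_of (length w). w \<in> shape_words ps"
proof -
  define C where "C = (\<lambda>d. count_list w (Suc d))"
  define r where "r = (\<lambda>i. card {d. i < C d})"
  have "C (Suc d) \<le> C d" for d using lattice_word_le[OF assms(1)] by (simp add: C_def)
  then have anti: "C b \<le> C a" if "a \<le> b" for a b using that by (rule lift_Suc_antimono_le)
  have "{d. i < C d} = {..<r i}" for i
  proof -
    have "{d. i < C d} \<subseteq> (\<lambda>x. x - 1) ` set w"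
    proof
      fix d assume "d \<in> {d. i < C d}"
      then have "Suc d \<in> set w" using count_list_0_iff[of w "Suc d"] by (auto simp: C_def)
      then show "d \<in> (\<lambda>x. x - 1) ` set w" by force
    qed
    then have "finite {d. i < C d}" by (rule finite_subset) simp
    then show ?thesis unfolding r_def
      by (rule down_closed_nat_set) (use anti in \<open>auto intro: order_less_le_trans\<close>)
  qed
  then have r: "d < r i \<longleftrightarrow> i < C d" for i d by blast
  define ps where "ps = map r [0..<C 0]"
  have cells: "(i, j) \<in> young_cells ps \<longleftrightarrow> i < C j" for i j
    using r[of j i] anti[of 0 j] by (auto simp: young_cells_def ps_def)
  have "r b \<le> r a" if "a \<le> b" for a b
  proof (rule ccontr)
    assume "\<not> r b \<le> r a"
    then have "b < C (r a)" using r[of "r a" b] by simp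
    then have "a < C (r a)" using that by simp
    then show False using r[of "r a" a] by simp
  qed
  then have "sorted_wrt (\<ge>) ps" unfolding ps_def by (auto simp: sorted_wrt_iff_nth_less)
  moreover have "0 \<notin> set ps"
  proof
    assume "0 \<in> set ps"
    then obtain i where "i < C 0" "r i = 0" unfolding ps_def by auto
    then show False using r[of 0 i] by simp
  qed
  moreover have "sum_list ps = length w"
  proof -
    have "young_cells ps = {(i, j). i < count_list w (Suc j)}"
      using cells by (auto simp: C_def)
    then show ?thesis using bij_betw_same_card[OF occurrence_cell_bij[OF assms(2)]]
      card_young_cells[of ps] by simp
  qed
  moreover have "count_list w (Suc j) = column_height ps j" for j
  proof -
    have "{i. (i, j) \<in> young_cells ps} = {..<C j}" using cells by auto
    then show ?thesis by (simp add: column_height_def C_def)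
  qed
  ultimately show ?thesis using assms by (auto simp: partitions_of_def shape_words_def)
qed

definition column_word :: "nat list \<Rightarrow> (nat \<times> nat \<Rightarrow> nat) \<Rightarrow> nat list" where
  "column_word ps T = map (\<lambda>m. Suc (snd (inv_into (young_cells ps) T (Suc m)))) [0..<sum_list ps]"

lemma standard_tableau_column_less:
  assumes "T \<in> standard_tableaux ps" "sorted_wrt (\<ge>) ps" "(i, j) \<in> young_cells ps" "i' < i"
  shows "T (i', j) < T (i, j)"
proof -
  have "(a, j) \<in> young_cells ps" if "a \<le> i" for a
    using young_cells_down[OF assms(2,3) that] by simp
  then have step: "T (a, j) < T (Suc a, j)" if "Suc a \<le> i" for a
    using assms(1) that by (auto simp: standard_tableaux_def)
  have "Suc i' + n \<le> i \<Longrightarrow> T (i', j) < T (Suc i' + n, j)" for n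
  proof (induction n)
    case (Suc n)
    then show ?case using step[of "Suc i' + n"] by simp
  qed (use step in simp)
  from this[of "i - Suc i'"] show ?thesis using assms(4) by simp
qed

lemma column_word_props:
  assumes T: "T \<in> standard_tableaux ps" and s: "sorted_wrt (\<ge>) ps"
  shows "column_word ps T \<in> shape_words ps"
    and "m < sum_list ps \<Longrightarrow>
      occurrence_cell (column_word ps T) m = inv_into (young_cells ps) T (Suc m)"
proof -
  let ?w = "column_word ps T" and ?C = "young_cells ps" and ?L = "sum_list ps"
  let ?U = "\<lambda>m. inv_into ?C T (Suc m)"
  have bij: "bij_betw T ?C {1..?L}" using T by (simp add: standard_tableaux_def)
  have U: "?U m \<in> ?C" "T (?U m) = Suc m" if "m < ?L" for m
    using bij_betw_inv_into_right[OF bij] bij_betw_apply[OF bij_betw_inv_into[OF bij]] that by auto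
  have TU: "?U (T c - 1) = c" "1 \<le> T c" "T c \<le> ?L" if "c \<in> ?C" for c
    using bij_betw_inv_into_left[OF bij that] bij_betw_apply[OF bij that] by auto
  have w: "length ?w = ?L" "m < ?L \<Longrightarrow> ?w ! m = Suc (snd (?U m))" for m
    by (auto simp: column_word_def)
  \<comment> \<open>A prefix of the column word sees the cells with entries up to \<open>m\<close>, column by column.\<close>
  have cnt: "count_list (take m ?w) (Suc j) = card {i. (i, j) \<in> ?C \<and> T (i, j) \<le> m}" if "m \<le> ?L" for m j
  proof -
    have "take m ?w = map (\<lambda>m. Suc (snd (?U m))) [0..<m]" using that
      by (simp add: column_word_def take_map min_def)
    then have "count_list (take m ?w) (Suc j) = card {a. a < m \<and> snd (?U a) = j}"
      by (simp add: count_list_map_upt)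
    also have "\<dots> = card {i. (i, j) \<in> ?C \<and> T (i, j) \<le> m}"
    proof (rule bij_betw_same_card)
      show "bij_betw (\<lambda>a. fst (?U a)) {a. a < m \<and> snd (?U a) = j} {i. (i, j) \<in> ?C \<and> T (i, j) \<le> m}"
      proof (rule bij_betw_byWitness[where f' = "\<lambda>i. T (i, j) - 1"])
        show "\<forall>a\<in>{a. a < m \<and> snd (?U a) = j}. T (fst (?U a), j) - 1 = a"
        proof safe
          fix a assume "a < m"
          then show "T (fst (?U a), snd (?U a)) - 1 = a" using U(2)[of a] that by simp
        qed
        show "\<forall>i\<in>{i. (i, j) \<in> ?C \<and> T (i, j) \<le> m}. fst (?U (T (i, j) - 1)) = i"
          using TU(1) by auto
        show "(\<lambda>a. fst (?U a)) ` {a. a < m \<and> snd (?U a) = j} \<subseteq> {i. (i, j) \<in> ?C \<and> T (i, j) \<le> m}"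
        proof safe
          fix a assume a: "a < m"
          then show "(fst (?U a), snd (?U a)) \<in> ?C" "T (fst (?U a), snd (?U a)) \<le> m"
            using U[of a] that by auto
        qed
        show "(\<lambda>i. T (i, j) - 1) ` {i. (i, j) \<in> ?C \<and> T (i, j) \<le> m} \<subseteq> {a. a < m \<and> snd (?U a) = j}"
        proof safe
          fix i assume c: "(i, j) \<in> ?C" "T (i, j) \<le> m"
          show "T (i, j) - 1 < m" using TU(2)[OF c(1)] c(2) by simp
          show "snd (?U (T (i, j) - 1)) = j" using TU(1)[OF c(1)] by simp
        qed
      qed
    qed
    finally show ?thesis .
  qed
  have fin: "finite {i. (i, j) \<in> ?C \<and> P i}" for j P
    by (rule finite_subset[of _ "{..<length ps}"]) (auto simp: young_cells_def)
  have "lattice_word ?w"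
    unfolding lattice_word_def
  proof (intro allI impI)
    fix m d :: nat assume d: "d \<ge> 1"
    define m' where "m' = min m ?L"
    have t: "take m ?w = take m' ?w" "m' \<le> ?L" using w by (auto simp: m'_def min_def)
    obtain j where j: "d = Suc j" using d by (cases d) auto
    have "{i. (i, Suc j) \<in> ?C \<and> T (i, Suc j) \<le> m'} \<subseteq> {i. (i, j) \<in> ?C \<and> T (i, j) \<le> m'}"
    proof safe
      fix i assume c: "(i, Suc j) \<in> ?C" "T (i, Suc j) \<le> m'"
      show "(i, j) \<in> ?C" using young_cells_down[OF s c(1)] by simp
      show "T (i, j) \<le> m'" using T c unfolding standard_tableaux_def by fastforce
    qed
    then show "count_list (take m ?w) (Suc d) \<le> count_list (take m ?w) d"
      unfolding t j cnt[OF t(2)] by (intro card_mono fin)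
  qed
  moreover have "count_list ?w (Suc j) = column_height ps j" for j
  proof -
    have "{i. (i, j) \<in> ?C \<and> T (i, j) \<le> ?L} = {i. (i, j) \<in> ?C}" using TU(3) by auto
    then show ?thesis using cnt[of ?L j] w by (simp add: column_height_def)
  qed
  moreover have "0 \<notin> set ?w" by (auto simp: column_word_def)
  ultimately show "?w \<in> shape_words ps" using w by (simp add: shape_words_def)
  show "occurrence_cell ?w m = ?U m" if m: "m < ?L"
  proof -
    obtain i j where c: "?U m = (i, j)" by fastforce
    have ij: "(i, j) \<in> ?C" "T (i, j) = Suc m" using U[OF m] c by auto
    have "{i'. (i', j) \<in> ?C \<and> T (i', j) \<le> m} = {..<i}"
    proof safe
      fix i' assume c': "(i', j) \<in> ?C" "T (i', j) \<le> m"
      show "i' < i"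
      proof (rule ccontr)
        assume "\<not> i' < i"
        then have "T (i, j) \<le> T (i', j)"
          using standard_tableau_column_less[OF T s c'(1), of i] by (cases "i = i'") auto
        then show False using c' ij by simp
      qed
    next
      fix i' assume "i' < i"
      then show "(i', j) \<in> ?C" "T (i', j) \<le> m"
        using young_cells_down[OF s ij(1), of i' j] standard_tableau_column_less[OF T s ij(1), of i'] ij
        by auto
    qed
    then have "count_list (take m ?w) (Suc j) = i" using cnt[of m j] m by simp
    then show ?thesis using w(2)[OF m] c by (simp add: occurrence_cell_def)
  qed
qed

lemma column_word_bij:
  assumes "ps \<in> partitions_of l"
  shows "bij_betw (column_word ps) (standard_tableaux ps) (shape_words ps)"
proof -
  have s: "sorted_wrt (\<ge>) ps" using assms by (simp add: partitions_of_def)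
  let ?C = "young_cells ps" and ?L = "sum_list ps"
  have "inj_on (column_word ps) (standard_tableaux ps)"
  proof (rule inj_onI)
    fix T T' assume T: "T \<in> standard_tableaux ps" and T': "T' \<in> standard_tableaux ps"
      and eq: "column_word ps T = column_word ps T'"
    have bij: "bij_betw T ?C {1..?L}" "bij_betw T' ?C {1..?L}"
      using T T' by (simp_all add: standard_tableaux_def)
    have "T c = T' c" if c: "c \<in> ?C" for c
    proof -
      have "T c \<in> {1..?L}" using bij(1) c bij_betw_apply by metis
      then obtain m where m: "T c = Suc m" "m < ?L" by (cases "T c") auto
      have "c = inv_into ?C T' (Suc m)"
        using column_word_props(2)[OF T s m(2)] column_word_props(2)[OF T' s m(2)] eq
          bij_betw_inv_into_left[OF bij(1) c] m(1) by simp
      then show ?thesis using bij_betw_inv_into_right[OF bij(2), of "Suc m"] m by simp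
    qed
    moreover have "T \<in> extensional ?C" "T' \<in> extensional ?C" using T T' by (simp_all add: standard_tableaux_def)
    ultimately show "T = T'" using extensionalityI by blast
  qed
  moreover have "column_word ps ` standard_tableaux ps \<subseteq> shape_words ps"
    using column_word_props(1)[OF _ s] by blast
  moreover have "w \<in> column_word ps ` standard_tableaux ps" if w: "w \<in> shape_words ps" for w
  proof -
    have W: "length w = ?L" "0 \<notin> set w" "lattice_word w" "\<And>j. count_list w (Suc j) = column_height ps j"
      using w by (auto simp: shape_words_def)
    have "{(i, j). i < count_list w (Suc j)} = ?C" using W(4) column_height_iff[OF s] by auto
    then have bij: "bij_betw (occurrence_cell w) {..<?L} ?C"
      using occurrence_cell_bij[OF W(2)] W(1) by simp
    define V where "V = inv_into {..<?L} (occurrence_cell w)"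
    have bV: "bij_betw V ?C {..<?L}" unfolding V_def using bij by (rule bij_betw_inv_into)
    have V: "V c < ?L" "occurrence_cell w (V c) = c" if "c \<in> ?C" for c
      using bij_betw_apply[OF bV that] bij_betw_inv_into_right[OF bij that] by (auto simp: V_def)
    have VO: "V (occurrence_cell w m) = m" "occurrence_cell w m \<in> ?C" if "m < ?L" for m
      using bij_betw_inv_into_left[OF bij, of m] bij_betw_apply[OF bij, of m] that by (auto simp: V_def)
    have Vw: "w ! V (i, j) = Suc j" "count_list (take (V (i, j)) w) (Suc j) = i"
      if "(i, j) \<in> ?C" for i j
    proof -
      have "w ! V (i, j) \<noteq> 0" using V(1)[OF that] W(1,2) nth_mem by metis
      then show "w ! V (i, j) = Suc j" using V(2)[OF that] by (auto simp: occurrence_cell_def)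
      then show "count_list (take (V (i, j)) w) (Suc j) = i"
        using V(2)[OF that] by (auto simp: occurrence_cell_def)
    qed
    define T where "T = restrict (\<lambda>c. Suc (V c)) ?C"
    have bT: "bij_betw T ?C {1..?L}"
    proof -
      have "bij_betw Suc {..<?L} {1..?L}"
        by (rule bij_betw_byWitness[where f' = "\<lambda>m. m - 1"]) auto
      from bij_betw_trans[OF bV this] show ?thesis
        by (rule bij_betw_cong[THEN iffD1, rotated]) (simp add: T_def)
    qed
    have "V (i, j) < V (i, j + 1)" if c: "(i, j + 1) \<in> ?C" for i j
    proof (rule ccontr)
      assume *: "\<not> V (i, j) < V (i, j + 1)"
      have c': "(i, j) \<in> ?C" using young_cells_down[OF s c] by simp
      have ne: "V (i, j) \<noteq> V (i, j + 1)" using Vw(1)[OF c] Vw(1)[OF c'] by auto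
      let ?m = "Suc (V (i, j + 1))"
      have "count_list (take ?m w) (Suc (Suc j)) = Suc i"
        using Vw[OF c] V(1)[OF c] W(1) by (simp add: take_Suc_conv_app_nth)
      moreover have "count_list (take ?m w) (Suc (Suc j)) \<le> count_list (take ?m w) (Suc j)"
        using W(3) unfolding lattice_word_def by simp
      moreover have "count_list (take ?m w) (Suc j) \<le> count_list (take (V (i, j)) w) (Suc j)"
        using * ne by (intro count_list_mono_take) simp
      ultimately show False using Vw(2)[OF c'] by simp
    qed
    moreover have "V (i, j) < V (i + 1, j)" if c: "(i + 1, j) \<in> ?C" for i j
    proof (rule ccontr)
      assume *: "\<not> V (i, j) < V (i + 1, j)"
      have c': "(i, j) \<in> ?C" using young_cells_down[OF s c] by simp
      have "count_list (take (V (i + 1, j)) w) (Suc j) \<le> count_list (take (V (i, j)) w) (Suc j)"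
        using * by (intro count_list_mono_take) simp
      then show False using Vw(2)[OF c'] Vw(2)[OF c] by simp
    qed
    ultimately have T: "T \<in> standard_tableaux ps"
      using bT young_cells_down[OF s] unfolding standard_tableaux_def
      by (auto simp: T_def)
    have "inv_into ?C T (Suc m) = occurrence_cell w m" if "m < ?L" for m
      using bij_betw_inv_into_left[OF bT VO(2)[OF that]] VO[OF that] by (simp add: T_def)
    then have *: "column_word ps T ! m = Suc (w ! m - 1)" if "m < ?L" for m
      using that by (simp add: column_word_def occurrence_cell_def)
    have "column_word ps T = w"
    proof (rule nth_equalityI)
      show "length (column_word ps T) = length w" using W(1) by (simp add: column_word_def)
      fix m assume "m < length (column_word ps T)"
      then have m: "m < ?L" by (simp add: column_word_def)
      then have "w ! m \<noteq> 0" using W(1,2) nth_mem by metis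
      then show "column_word ps T ! m = w ! m" using *[OF m] by simp
    qed
    then show ?thesis using T by blast
  qed
  ultimately show ?thesis unfolding bij_betw_def by blast
qed

lemma card_shape_words: "ps \<in> partitions_of l \<Longrightarrow> card (shape_words ps) = num_syt ps"
  unfolding num_syt_def using bij_betw_same_card[OF column_word_bij] by metis

lemma tableau_pairs_nonzero:
  assumes "(P, Q) \<in> tableau_pairs L L"
  shows "0 \<notin> set P"
proof -
  have A: "length P = L" "length Q = L" "0 \<notin> set Q" "\<forall>d\<ge>1. count_list P d = count_list Q d"
    using assms by (auto simp: tableau_pairs_def)
  have "filter_mset (\<lambda>x. x \<noteq> 0) (mset P) = filter_mset (\<lambda>x. x \<noteq> 0) (mset Q)"
    using A(4) by (intro multiset_eqI) (auto simp: count_mset)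
  also have "\<dots> = mset Q" using A(3) by (auto simp: filter_mset_eq_conv intro: gr0I)
  finally have "mset (filter (\<lambda>x. x \<noteq> 0) P) = mset Q" by simp
  then have "length (filter (\<lambda>x. x \<noteq> 0) P) = length P" using A mset_eq_length by metis
  then show ?thesis using length_filter_less[of 0 P "\<lambda>x. x \<noteq> 0"] by auto
qed

lemma card_tableau_pairs:
  "card {pq \<in> tableau_pairs l l. count_list (fst pq) 1 \<le> k}
    = (\<Sum>ps | ps \<in> partitions_of l \<and> length ps \<le> k. (num_syt ps)\<^sup>2)"
proof -
  let ?S = "{ps. ps \<in> partitions_of l \<and> length ps \<le> k}"
  have "{pq \<in> tableau_pairs l l. count_list (fst pq) 1 \<le> k} = (\<Union>ps\<in>?S. shape_words ps \<times> shape_words ps)"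
  proof (intro equalityI subsetI)
    fix pq assume pq: "pq \<in> {pq \<in> tableau_pairs l l. count_list (fst pq) 1 \<le> k}"
    obtain P Q where PQ: "pq = (P, Q)" by fastforce
    have A: "length P = l" "length Q = l" "0 \<notin> set Q" "0 \<notin> set P" "lattice_word P" "lattice_word Q"
      "\<And>d. d \<ge> 1 \<Longrightarrow> count_list P d = count_list Q d" "count_list P 1 \<le> k"
      using pq tableau_pairs_nonzero[of P Q l] by (auto simp: tableau_pairs_def PQ)
    obtain ps where ps: "ps \<in> partitions_of l" "P \<in> shape_words ps"
      using lattice_word_shape[OF A(5,4)] A(1) by blast
    have "length ps \<le> k" using ps A(8) column_height_0[OF ps(1)] by (simp add: shape_words_def)
    moreover have "Q \<in> shape_words ps" using ps A by (auto simp: shape_words_def)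
    ultimately show "pq \<in> (\<Union>ps\<in>?S. shape_words ps \<times> shape_words ps)" using ps PQ by blast
  next
    fix pq assume "pq \<in> (\<Union>ps\<in>?S. shape_words ps \<times> shape_words ps)"
    then obtain ps P Q where A: "pq = (P, Q)" "ps \<in> partitions_of l" "length ps \<le> k"
      "P \<in> shape_words ps" "Q \<in> shape_words ps" by blast
    have "count_list P d = count_list Q d" if "d \<ge> 1" for d
      using A that by (cases d) (auto simp: shape_words_def)
    then show "pq \<in> {pq \<in> tableau_pairs l l. count_list (fst pq) 1 \<le> k}"
      using A column_height_0[OF A(2)]
      by (auto simp: shape_words_def tableau_pairs_def partitions_of_def)
  qed
  moreover have "card (\<Union>ps\<in>?S. shape_words ps \<times> shape_words ps) = (\<Sum>ps\<in>?S. card (shape_words ps \<times> shape_words ps))"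
  proof (rule card_UN_disjoint)
    show "finite ?S" using finite_partitions_of by (rule rev_finite_subset) blast
    have "finite (shape_words ps)" if "ps \<in> ?S" for ps
      using column_word_bij[of ps l] that finite_standard_tableaux bij_betw_finite by blast
    then show "\<forall>ps\<in>?S. finite (shape_words ps \<times> shape_words ps)" by blast
    have eq: "ps = qs" if "ps \<in> ?S" "qs \<in> ?S" "w \<in> shape_words ps" "w \<in> shape_words qs" for ps qs w
      using that by (intro partition_eqI[of ps l qs l]) (auto simp: shape_words_def)
    show "\<forall>ps\<in>?S. \<forall>qs\<in>?S. ps \<noteq> qs \<longrightarrow>
        (shape_words ps \<times> shape_words ps) \<inter> (shape_words qs \<times> shape_words qs) = {}"
    proof (intro ballI impI)
      fix ps qs assume A: "ps \<in> ?S" "qs \<in> ?S" "ps \<noteq> qs"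
      have "shape_words ps \<inter> shape_words qs = {}" using eq[OF A(1,2)] A(3) by blast
      then show "(shape_words ps \<times> shape_words ps) \<inter> (shape_words qs \<times> shape_words qs) = {}" by blast
    qed
  qed
  ultimately show ?thesis
    using card_shape_words[of _ l] by (simp add: card_cartesian_product power2_eq_square)
qed

lemma card_rsk_bounded:
  "card {xs \<in> partial_perms l l. count_list (fst (rsk l xs)) 1 \<le> k}
    = (\<Sum>ps | ps \<in> partitions_of l \<and> length ps \<le> k. (num_syt ps)\<^sup>2)"
proof -
  have "bij_betw (rsk l) {xs \<in> partial_perms l l. count_list (fst (rsk l xs)) 1 \<le> k}
     {pq \<in> tableau_pairs l l. count_list (fst pq) 1 \<le> k}"
    by (rule bij_betw_Collect[OF rsk_bij]) simp
  from bij_betw_same_card[OF this] show ?thesis using card_tableau_pairs by simp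
qed

section \<open>Eigenvectors and spans\<close>

context vector_space
begin

lemma span_image_closed:
  assumes add: "\<And>u w. F (u + w) = F u + F w" and sc: "\<And>c u. F (scale c u) = scale c (F u)"
    and S: "\<And>w. w \<in> S \<Longrightarrow> F w \<in> W" and W: "subspace W" and u: "u \<in> span S"
  shows "F u \<in> W"
proof -
  have "F 0 = 0" using sc[of 0 0] by simp
  then have "subspace {u. F u \<in> W}"
    using W by (auto simp: subspace_def add sc)
  then have "span S \<subseteq> {u. F u \<in> W}" using S by (intro span_minimal) auto
  then show ?thesis using u by blast
qed

text \<open>An eigenvector that is a combination of eigenvectors only involves those with its own eigenvalue. The
spanning family is indexed, as different indices with different eigenvalues may give the same (zero) vector.\<close>

lemma eigenvector_in_span:
  assumes add: "\<And>u w. Z (u + w) = Z u + Z w" and sc: "\<And>c u. Z (scale c u) = scale c (Z u)"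
    and eig: "\<And>i. i \<in> I \<Longrightarrow> Z (f i) = scale (e i) (f i)"
    and u: "u \<in> span (f ` I)" and Zu: "Z u = scale r u"
  shows "u \<in> span (f ` {i \<in> I. e i = r})"
proof -
  \<comment> \<open>\<open>K cs\<close> is the product of the commuting operators \<open>Z - c\<close>; it annihilates sums of eigenvectors with
    eigenvalues in \<open>cs\<close> and is injective on the eigenspace of any \<open>r\<close> outside \<open>cs\<close>.\<close>
  define K where "K = (\<lambda>cs. foldr (\<lambda>c x. Z x - scale c x) cs)"
  have Knil: "K [] = (\<lambda>x. x)" and Kcons: "K (c # cs) x = Z (K cs x) - scale c (K cs x)" for c cs x
    by (auto simp: K_def)
  have Z0: "Z 0 = 0" using sc[of 0 0] by simp
  have Zm: "Z (x - y) = Z x - Z y" for x y using add[of "x - y" y] by (simp add: algebra_simps)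
  have K0: "K cs 0 = 0" for cs by (induction cs) (auto simp: Knil Kcons Z0)
  have Kadd: "K cs (x + y) = K cs x + K cs y" for cs x y
    by (induction cs) (auto simp: Knil Kcons add scale_right_distrib)
  have Ksc: "K cs (scale c x) = scale c (K cs x)" for cs c x
    by (induction cs) (auto simp: Knil Kcons sc scale_right_diff_distrib scale_left_commute)
  have KZ: "K cs (Z x) = Z (K cs x)" for cs x
    by (induction cs) (auto simp: Knil Kcons sc Zm)
  have Kapp: "K (as @ bs) x = K as (K bs x)" for as bs x by (simp add: K_def)
  have Kcomm: "K as (K bs x) = K bs (K as x)" for as bs x
  proof (induction bs)
    case (Cons b bs)
    have "K as (K (b # bs) x) = K as (Z (K bs x)) - K as (scale b (K bs x))"
      using Kadd[of as "Z (K bs x) - scale b (K bs x)" "scale b (K bs x)"] by (simp add: Kcons algebra_simps)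
    then show ?case using Cons by (simp add: Kcons KZ Ksc)
  qed (simp add: Knil)
  let ?S = "span (f ` {i \<in> I. e i = r})"
  let ?Q = "\<lambda>t. \<exists>u0 cs. u0 \<in> ?S \<and> r \<notin> set cs \<and> K cs (t - u0) = 0"
  have "?Q u" using u
  proof (induction rule: span_induct_alt)
    case base
    show ?case by (intro exI[of _ 0] exI[of _ "[]"]) (simp add: span_zero K0)
  next
    case (step c x y)
    then obtain i where i: "i \<in> I" "x = f i" by blast
    obtain u0 cs where y: "u0 \<in> ?S" "r \<notin> set cs" "K cs (y - u0) = 0" using step by blast
    show ?case
    proof (cases "e i = r")
      case True
      then have "x \<in> ?S" using i by (auto intro: span_base)
      then have "scale c x + u0 \<in> ?S" using y by (auto intro: span_add span_scale)
      moreover have "scale c x + y - (scale c x + u0) = y - u0" by simp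
      ultimately show ?thesis using y by metis
    next
      case False
      have "K (cs @ [e i]) (scale c x + y - u0) = K cs (K [e i] (scale c x)) + K cs (K [e i] (y - u0))"
        using Kadd[of "cs @ [e i]" "scale c x" "y - u0"] by (simp add: Kapp add_diff_eq)
      also have "K [e i] (scale c x) = 0" using eig[OF i(1)] i(2) by (simp add: Knil Kcons sc scale_left_commute)
      also have "K cs (K [e i] (y - u0)) = K [e i] (K cs (y - u0))" by (rule Kcomm)
      finally have "K (cs @ [e i]) (scale c x + y - u0) = 0" using y by (simp add: K0)
      moreover have "r \<notin> set (cs @ [e i])" using y False by auto
      ultimately show ?thesis using y(1) by blast
    qed
  qed
  then obtain u0 cs where u0: "u0 \<in> ?S" "r \<notin> set cs" "K cs (u - u0) = 0" by blast
  have "Z u0 = scale r u0"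
  proof -
    have "Z u0 - scale r u0 \<in> {0}"
      by (rule span_image_closed[where F = "\<lambda>x. Z x - scale r x" and S = "f ` {i \<in> I. e i = r}"])
        (use u0 eig in \<open>auto simp: add sc scale_right_distrib scale_right_diff_distrib scale_left_commute subspace_def\<close>)
    then show ?thesis by simp
  qed
  then have Zt: "Z (u - u0) = scale r (u - u0)" using Zu by (simp add: Zm scale_right_diff_distrib)
  have "K cs (u - u0) = 0 \<Longrightarrow> r \<notin> set cs \<Longrightarrow> u - u0 = 0"
  proof (induction cs)
    case (Cons c cs)
    have "K (c # cs) (u - u0) = scale (r - c) (K cs (u - u0))"
      using KZ[of cs "u - u0"] by (simp add: Kcons Zt Ksc scale_left_diff_distrib)
    with Cons show ?case by simp
  qed (simp add: Knil)
  with u0 show ?thesis by simp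
qed

end

section \<open>Irreducible modules generated by a vacuum vector\<close>

type_synonym loop_unit = "nat \<times> nat \<times> int"

text \<open>What is used of the module \<open>V(k \<Lambda>\<^sub>0)\<close>: the operator \<open>X i j a\<close> is the action of
\<open>(E\<^bsub>ij\<^esub> - \<delta>\<^bsub>ij\<^esub> 1/n) \<otimes> t^a\<close>, the operator \<open>D\<close> that of \<open>d\<close>, and \<open>c\<close> acts by \<open>k\<close>.
Removing the trace puts the diagonal units on the same footing as the others; the correction drops out of
the matrix commutators and only survives in the central term.\<close>

locale affine_vacuum = vector_space scale
  for scale :: "complex \<Rightarrow> 'v::ab_group_add \<Rightarrow> 'v" +
  fixes n k :: nat and X :: "nat \<Rightarrow> nat \<Rightarrow> int \<Rightarrow> 'v \<Rightarrow> 'v" and D :: "'v \<Rightarrow> 'v" and v :: 'v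
  assumes X_add: "i < n \<Longrightarrow> j < n \<Longrightarrow> X i j a (u + w) = X i j a u + X i j a w"
    and X_scale: "i < n \<Longrightarrow> j < n \<Longrightarrow> X i j a (scale c u) = scale c (X i j a u)"
    and D_add: "D (u + w) = D u + D w"
    and D_scale: "D (scale c u) = scale c (D u)"
    and X_X: "i < n \<Longrightarrow> j < n \<Longrightarrow> p < n \<Longrightarrow> q < n \<Longrightarrow>
      X i j a (X p q b u) = X p q b (X i j a u)
        + ((if j = p then X i q (a + b) u else 0) - (if q = i then X p j (a + b) u else 0)
        + scale (if a + b = 0 then of_int a * ((if j = p \<and> i = q then 1 else 0)
             - (if i = j \<and> p = q then 1 / of_nat n else 0)) * of_nat k else 0) u)"
    and D_X: "i < n \<Longrightarrow> j < n \<Longrightarrow> D (X i j a u) = X i j a (D u) + scale (of_int a) (X i j a u)"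
    and X_v: "i < n \<Longrightarrow> j < n \<Longrightarrow> a > 0 \<or> a = 0 \<and> i \<le> j \<Longrightarrow> X i j a v = 0"
    and D_v: "D v = 0"
    and v_nonzero: "v \<noteq> 0"
    and irreducible: "subspace W \<Longrightarrow> (\<And>i j a w. i < n \<Longrightarrow> j < n \<Longrightarrow> w \<in> W \<Longrightarrow> X i j a w \<in> W)
      \<Longrightarrow> (\<And>w. w \<in> W \<Longrightarrow> D w \<in> W) \<Longrightarrow> W = {0} \<or> W = UNIV"
begin

definition op :: "loop_unit \<Rightarrow> 'v \<Rightarrow> 'v" where
  "op t = (case t of (i, j, a) \<Rightarrow> X i j a)"

definition valid :: "loop_unit \<Rightarrow> bool" where
  "valid t \<longleftrightarrow> fst t < n \<and> fst (snd t) < n"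

abbreviation monomial :: "loop_unit list \<Rightarrow> 'v \<Rightarrow> 'v" where
  "monomial ts u \<equiv> foldr op ts u"

text \<open>The correction when two units are exchanged. Its degree is the sum of the degrees of the units; the central
part does not break this, since it only occurs when they add up to zero (\<open>commutator_closed\<close>).\<close>

definition commutator :: "loop_unit \<Rightarrow> loop_unit \<Rightarrow> 'v \<Rightarrow> 'v" where
  "commutator t y u = (case t of (i, j, a) \<Rightarrow> case y of (p, q, b) \<Rightarrow>
     (if j = p then X i q (a + b) u else 0) - (if q = i then X p j (a + b) u else 0)
        + scale (if a + b = 0 then of_int a * ((if j = p \<and> i = q then 1 else 0)
             - (if i = j \<and> p = q then 1 / of_nat n else 0)) * of_nat k else 0) u)"

lemma op_add: "valid t \<Longrightarrow> op t (u + w) = op t u + op t w"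
  by (cases t) (simp add: op_def valid_def X_add)

lemma op_scale: "valid t \<Longrightarrow> op t (scale c u) = scale c (op t u)"
  by (cases t) (simp add: op_def valid_def X_scale)

lemma op_0: "valid t \<Longrightarrow> op t 0 = 0"
  using op_scale[of t 0 0] by simp

lemma op_op: "valid t \<Longrightarrow> valid y \<Longrightarrow> op t (op y u) = op y (op t u) + commutator t y u"
proof -
  assume V: "valid t" "valid y"
  obtain i j a where t: "t = (i, j, a)" by (cases t)
  obtain p q b where y: "y = (p, q, b)" by (cases y)
  show ?thesis using V X_X[of i j p q a b u] unfolding t y
    by (simp add: op_def valid_def commutator_def)
qed

lemma D_op: "valid t \<Longrightarrow> D (op t u) = op t (D u) + scale (of_int (snd (snd t))) (op t u)"
  by (cases t) (simp add: op_def valid_def D_X)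

lemma monomial_0: "\<forall>t\<in>set ts. valid t \<Longrightarrow> monomial ts 0 = 0"
  by (induction ts) (auto simp: op_0)

lemma monomial_add: "\<forall>t\<in>set ts. valid t \<Longrightarrow> monomial ts (u + w) = monomial ts u + monomial ts w"
  by (induction ts) (auto simp: op_add)

lemma monomial_scale: "\<forall>t\<in>set ts. valid t \<Longrightarrow> monomial ts (scale c u) = scale c (monomial ts u)"
  by (induction ts) (auto simp: op_scale)

lemma eigen_op:
  assumes "valid t" "\<And>u. Z (op t u) = op t (Z u) + scale d (op t u)" "Z w = scale e w"
  shows "Z (op t w) = scale (e + d) (op t w)"
  using assms by (simp add: op_scale scale_left_distrib)

lemma eigen_monomial:
  assumes "\<forall>t\<in>set ts. valid t" "\<And>t u. valid t \<Longrightarrow> Z (op t u) = op t (Z u) + scale (d t) (op t u)"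
    "Z w = scale e w"
  shows "Z (monomial ts w) = scale (e + (\<Sum>t\<leftarrow>ts. d t)) (monomial ts w)"
  using assms(1)
proof (induction ts)
  case (Cons t ts)
  then have t: "valid t" and "Z (monomial ts w) = scale (e + (\<Sum>t\<leftarrow>ts. d t)) (monomial ts w)" by auto
  from eigen_op[OF t assms(2)[OF t] this(2)] show ?case by (simp add: add_ac)
qed (use assms(3) in simp)

lemma D_monomial:
  assumes "\<forall>t\<in>set ts. valid t" "D w = scale e w"
  shows "D (monomial ts w) = scale (e + of_int (\<Sum>t\<leftarrow>ts. snd (snd t))) (monomial ts w)"
proof -
  have "(\<Sum>t\<leftarrow>ts. of_int (snd (snd t)) :: complex) = of_int (\<Sum>t\<leftarrow>ts. snd (snd t))"
    by (induction ts) auto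
  with eigen_monomial[where Z = D and d = "\<lambda>t. of_int (snd (snd t))", OF assms(1) D_op assms(2)]
  show ?thesis by simp
qed

definition diag_weight :: "nat \<Rightarrow> loop_unit \<Rightarrow> int" where
  "diag_weight i t = (if fst t = i then 1 else 0) - (if fst (snd t) = i then 1 else 0)"

lemma diag_op:
  "i < n \<Longrightarrow> valid t \<Longrightarrow> X i i 0 (op t u) = op t (X i i 0 u) + scale (of_int (diag_weight i t)) (op t u)"
proof -
  assume V: "i < n" "valid t"
  obtain p q b where t: "t = (p, q, b)" by (cases t)
  show ?thesis using V X_X[of i i p q 0 b u] unfolding t
    by (auto simp: op_def valid_def diag_weight_def)
qed

lemma diag_monomial:
  assumes "i < n" "\<forall>t\<in>set ts. valid t" "X i i 0 w = scale e w"
  shows "X i i 0 (monomial ts w) = scale (e + of_int (\<Sum>t\<leftarrow>ts. diag_weight i t)) (monomial ts w)"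
proof -
  have "(\<Sum>t\<leftarrow>ts. of_int (diag_weight i t) :: complex) = of_int (\<Sum>t\<leftarrow>ts. diag_weight i t)"
    by (induction ts) auto
  with eigen_monomial[where Z = "X i i 0" and d = "\<lambda>t. of_int (diag_weight i t)", OF assms(2) diag_op assms(3)]
  show ?thesis using assms(1) by simp
qed

end

text \<open>A grading \<open>N a + s (j - i)\<close> of the units, implemented by an operator \<open>Z\<close>, whose part of nonnegative
degree kills \<open>v\<close>. It is used for the principal grading \<open>(n, 1)\<close>, where this is an assumption on \<open>v\<close>,
and then for the \<open>t\<close>-degree \<open>(1, 0)\<close>, where it needs that \<open>sl(n)\<close> kills \<open>v\<close>.\<close>

locale graded_affine_vacuum = affine_vacuum +
  fixes N s :: int and Z
  assumes Z_add: "Z (u + w) = Z u + Z w"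
    and Z_scale: "Z (scale c u) = scale c (Z u)"
    and Z_v: "Z v = 0"
    and Z_X: "i < n \<Longrightarrow> j < n \<Longrightarrow>
      Z (X i j a u) = X i j a (Z u) + scale (of_int (N * a + s * (int j - int i))) (X i j a u)"
    and X_v_nonneg: "i < n \<Longrightarrow> j < n \<Longrightarrow> N * a + s * (int j - int i) \<ge> 0 \<Longrightarrow> X i j a v = 0"
begin

definition deg :: "loop_unit \<Rightarrow> int" where
  "deg t = (case t of (i, j, a) \<Rightarrow> N * a + s * (int j - int i))"

definition neg_lists :: "loop_unit list set" where
  "neg_lists = {ts. \<forall>t\<in>set ts. valid t \<and> deg t < 0}"

text \<open>A complement of the line through \<open>v\<close>, which serves as the kernel of the projection onto this line.\<close>

definition V_neg where
  "V_neg = span ((\<lambda>ts. monomial ts v) ` (neg_lists - {[]}))"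

lemma op_v: "valid t \<Longrightarrow> deg t \<ge> 0 \<Longrightarrow> op t v = 0"
  by (cases t) (simp add: op_def deg_def valid_def X_v_nonneg)

lemma commutator_closed:
  assumes "valid t" "valid y" "subspace W"
    and "\<And>t'. valid t' \<Longrightarrow> deg t' = deg t + deg y \<Longrightarrow> op t' u \<in> W"
    and "deg t + deg y = 0 \<Longrightarrow> u \<in> W"
  shows "commutator t y u \<in> W"
proof -
  obtain i j a where t: "t = (i, j, a)" by (cases t)
  obtain p q b where y: "y = (p, q, b)" by (cases y)
  have 1: "(if j = p then X i q (a + b) u else 0) \<in> W"
  proof (cases "j = p")
    case True
    have "deg (i, q, a + b) = deg t + deg y"
      unfolding t y deg_def True prod.case by (simp add: algebra_simps)
    then have "op (i, q, a + b) u \<in> W" using assms(1,2) unfolding t y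
      by (intro assms(4)) (simp_all add: valid_def t y)
    then show ?thesis using True by (simp add: op_def)
  qed (simp add: subspace_0[OF assms(3)])
  have 2: "(if q = i then X p j (a + b) u else 0) \<in> W"
  proof (cases "q = i")
    case True
    have "deg (p, j, a + b) = deg t + deg y"
      unfolding t y deg_def True prod.case by (simp add: algebra_simps)
    then have "op (p, j, a + b) u \<in> W" using assms(1,2) unfolding t y
      by (intro assms(4)) (simp_all add: valid_def t y)
    then show ?thesis using True by (simp add: op_def)
  qed (simp add: subspace_0[OF assms(3)])
  define z where "z = (if a + b = 0 then of_int a * ((if j = p \<and> i = q then 1 else 0)
             - (if i = j \<and> p = q then 1 / of_nat n else 0)) * of_nat k else 0 :: complex)"
  have 3: "scale z u \<in> W"
  proof (cases "z = 0")
    case True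
    then show ?thesis using subspace_0[OF assms(3)] by simp
  next
    case False
    then have ab: "a + b = 0" "a \<noteq> 0" "j = p \<and> i = q \<or> i = j \<and> p = q"
      by (auto simp: z_def split: if_splits)
    have "deg t + deg y = N * (a + b) + s * (int j - int i + int q - int p)"
      unfolding t y deg_def prod.case by (simp add: algebra_simps)
    also have "int j - int i + int q - int p = 0" using ab(3) by auto
    finally have "deg t + deg y = 0" using ab(1) by simp
    then show ?thesis using assms(3,5) subspace_scale by blast
  qed
  have "commutator t y u = ((if j = p then X i q (a + b) u else 0)
      - (if q = i then X p j (a + b) u else 0)) + scale z u"
    unfolding commutator_def t y z_def by (simp only: prod.case)
  then show ?thesis
    using subspace_add[OF assms(3) subspace_diff[OF assms(3) 1 2] 3] by (simp only:)
qed

lemma op_closed: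
  assumes "valid t" "subspace W" "\<And>w. w \<in> S \<Longrightarrow> op t w \<in> W" "u \<in> span S"
  shows "op t u \<in> W"
  by (rule span_image_closed[where F = "op t", OF _ _ assms(3,2,4)])
    (use assms(1) in \<open>simp_all add: op_add op_scale\<close>)

text \<open>The usual ordering argument: a factor of nonnegative degree is commuted to the right until it kills \<open>v\<close>.\<close>

lemma op_monomial_in_span:
  assumes "ts \<in> neg_lists" "valid t"
  shows "op t (monomial ts v) \<in> span ((\<lambda>ts. monomial ts v) ` neg_lists)"
  using assms
proof (induction ts arbitrary: t)
  case Nil
  show ?case
  proof (cases "deg t \<ge> 0")
    case True
    then show ?thesis using op_v Nil by (simp add: span_zero)
  next
    case False
    then have "[t] \<in> neg_lists" using Nil by (simp add: neg_lists_def)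
    then have "monomial [t] v \<in> (\<lambda>ts. monomial ts v) ` neg_lists" by (rule imageI)
    then show ?thesis using span_base by fastforce
  qed
next
  case (Cons y ys)
  let ?S = "span ((\<lambda>ts. monomial ts v) ` neg_lists)"
  have y: "valid y" "deg y < 0" "ys \<in> neg_lists" using Cons.prems by (auto simp: neg_lists_def)
  have neg: "op x u \<in> ?S" if "valid x" "deg x < 0" "u \<in> ?S" for x u
  proof (rule op_closed[OF that(1) subspace_span _ that(3)])
    fix w assume "w \<in> (\<lambda>ts. monomial ts v) ` neg_lists"
    then obtain ts where "w = monomial ts v" "ts \<in> neg_lists" by blast
    then have "op x w = monomial (x # ts) v" "x # ts \<in> neg_lists"
      using that by (auto simp: neg_lists_def)
    then show "op x w \<in> ?S" by (simp only: span_base image_eqI)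
  qed
  have w: "monomial ys v \<in> ?S" using y(3) by (auto intro: span_base)
  have "op t (monomial (y # ys) v) = op y (op t (monomial ys v)) + commutator t y (monomial ys v)"
    using op_op[OF Cons.prems(2) y(1)] by simp
  moreover have "op y (op t (monomial ys v)) \<in> ?S"
    using neg y Cons by blast
  moreover have "commutator t y (monomial ys v) \<in> ?S"
    using Cons.IH[OF y(3)] w y Cons.prems by (intro commutator_closed) auto
  ultimately show ?case by (metis span_add)
qed

lemma span_neg_lists: "span ((\<lambda>ts. monomial ts v) ` neg_lists) = UNIV"
proof -
  let ?B = "(\<lambda>ts. monomial ts v) ` neg_lists"
  have "[] \<in> neg_lists" by (simp add: neg_lists_def)
  then have "monomial [] v \<in> ?B" by (rule imageI)
  then have v: "v \<in> span ?B" by (simp add: span_base)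
  have "span ?B = {0} \<or> span ?B = UNIV"
  proof (rule irreducible)
    fix i j a w assume ij: "i < n" "j < n" and w: "w \<in> span ?B"
    have V: "valid (i, j, a)" using ij by (simp add: valid_def)
    have "op (i, j, a) w \<in> span ?B"
      by (rule op_closed[OF V subspace_span _ w]) (use op_monomial_in_span V in blast)
    then show "X i j a w \<in> span ?B" by (simp add: op_def)
  next
    fix w assume w: "w \<in> span ?B"
    show "D w \<in> span ?B"
    proof (rule span_image_closed[OF D_add D_scale _ subspace_span w])
      fix w assume "w \<in> ?B"
      then obtain ts where ts: "w = monomial ts v" "ts \<in> neg_lists" by blast
      have "D w = scale (0 + of_int (\<Sum>t\<leftarrow>ts. snd (snd t))) w"
        unfolding ts(1) by (rule D_monomial) (use ts D_v in \<open>auto simp: neg_lists_def\<close>)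
      then show "D w \<in> span ?B" using \<open>w \<in> ?B\<close> by (auto intro: span_scale span_base)
    qed
  qed simp
  then show ?thesis using v v_nonzero by auto
qed

lemma op_neg_in_V_neg:
  assumes "valid t" "deg t < 0"
  shows "op t u \<in> V_neg"
proof (rule op_closed[OF assms(1)])
  show "u \<in> span ((\<lambda>ts. monomial ts v) ` neg_lists)" using span_neg_lists by blast
  fix w assume "w \<in> (\<lambda>ts. monomial ts v) ` neg_lists"
  then obtain ts where ts: "w = monomial ts v" "ts \<in> neg_lists" by blast
  have "t # ts \<in> neg_lists - {[]}" using assms ts by (auto simp: neg_lists_def)
  then have "monomial (t # ts) v \<in> V_neg" unfolding V_neg_def by (intro span_base imageI)
  then show "op t w \<in> V_neg" using ts by simp
qed (simp add: V_neg_def)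

lemma subspace_V_neg: "subspace V_neg"
  by (simp add: V_neg_def)

lemma op_zero_V_neg:
  assumes "valid t" "deg t = 0" "u \<in> V_neg"
  shows "op t u \<in> V_neg"
proof (rule op_closed[OF assms(1) subspace_V_neg _ assms(3)[unfolded V_neg_def]])
  fix w assume "w \<in> (\<lambda>ts. monomial ts v) ` (neg_lists - {[]})"
  then obtain ts where "w = monomial ts v" "ts \<in> neg_lists" "ts \<noteq> []" by blast
  then obtain y ys where w: "w = op y (monomial ys v)" and y: "valid y" "deg y < 0"
    by (cases ts) (auto simp: neg_lists_def)
  have "op y (op t (monomial ys v)) \<in> V_neg" using op_neg_in_V_neg y by blast
  moreover have "commutator t y (monomial ys v) \<in> V_neg"
    using op_neg_in_V_neg y assms by (intro commutator_closed subspace_V_neg) auto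
  ultimately show "op t w \<in> V_neg"
    unfolding w op_op[OF assms(1) y(1)] using subspace_add[OF subspace_V_neg] by blast
qed

lemma D_V_neg:
  assumes "u \<in> V_neg"
  shows "D u \<in> V_neg"
proof (rule span_image_closed[OF D_add D_scale _ subspace_V_neg assms[unfolded V_neg_def]])
  fix w assume w: "w \<in> (\<lambda>ts. monomial ts v) ` (neg_lists - {[]})"
  then obtain ts where ts: "w = monomial ts v" "ts \<in> neg_lists" by blast
  have "D w = scale (0 + of_int (\<Sum>t\<leftarrow>ts. snd (snd t))) w"
    unfolding ts(1) by (rule D_monomial) (use ts D_v in \<open>auto simp: neg_lists_def\<close>)
  then show "D w \<in> V_neg" using w unfolding V_neg_def by (auto intro: span_scale span_base)
qed

lemma v_notin_V_neg: "v \<notin> V_neg"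
proof
  assume "v \<in> V_neg"
  have Zop: "Z (op t u) = op t (Z u) + scale (of_int (deg t)) (op t u)" if "valid t" for t u
    using that by (cases t) (simp add: op_def deg_def valid_def Z_X)
  have eig: "Z (monomial ts v) = scale (\<Sum>t\<leftarrow>ts. of_int (deg t)) (monomial ts v)"
    if "ts \<in> neg_lists - {[]}" for ts
    using eigen_monomial[where Z = Z and d = "\<lambda>t. of_int (deg t)" and e = 0 and w = v and ts = ts] Zop Z_v that
    by (simp add: neg_lists_def)
  have neg: "(\<Sum>t\<leftarrow>ts. deg t) < 0" if "ts \<in> neg_lists - {[]}" for ts
  proof -
    have "ts \<noteq> [] \<Longrightarrow> \<forall>t\<in>set ts. deg t < 0 \<Longrightarrow> (\<Sum>t\<leftarrow>ts. deg t) < 0"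
    proof (induction ts)
      case (Cons t ts)
      then show ?case by (cases "ts = []") (auto intro: add_neg_neg)
    qed simp
    then show ?thesis using that by (auto simp: neg_lists_def)
  qed
  have "(\<Sum>t\<leftarrow>ts. of_int (deg t)) = (of_int (\<Sum>t\<leftarrow>ts. deg t) :: complex)" for ts
    by (induction ts) auto
  then have none: "{ts \<in> neg_lists - {[]}. (\<Sum>t\<leftarrow>ts. of_int (deg t)) = (0::complex)} = {}"
    using neg by fastforce
  have "v \<in> span ((\<lambda>ts. monomial ts v) ` {ts \<in> neg_lists - {[]}. (\<Sum>t\<leftarrow>ts. of_int (deg t)) = (0::complex)})"
    by (rule eigenvector_in_span[where Z = Z, OF Z_add Z_scale eig])
      (use \<open>v \<in> V_neg\<close> Z_v in \<open>auto simp: V_neg_def\<close>)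
  then show False using v_nonzero unfolding none by simp
qed

lemma V_neg_decomp: "\<exists>c z. u = scale c v + z \<and> z \<in> V_neg"
proof -
  have "u \<in> span ((\<lambda>ts. monomial ts v) ` neg_lists)" using span_neg_lists by blast
  then show ?thesis
  proof (induction rule: span_induct_alt)
    case base
    show ?case by (intro exI[of _ 0]) (simp add: subspace_0[OF subspace_V_neg])
  next
    case (step c x y)
    then obtain d z where y: "y = scale d v + z" "z \<in> V_neg" by blast
    obtain ts where ts: "x = monomial ts v" "ts \<in> neg_lists" using step by blast
    show ?case
    proof (cases "ts = []")
      case True
      then have "scale c x + y = scale (c + d) v + z" using ts y by (simp add: scale_left_distrib)
      then show ?thesis using y by blast
    next
      case False
      then have "x \<in> V_neg" using ts unfolding V_neg_def by (auto intro: span_base)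
      then have "scale c x + z \<in> V_neg" using y subspace_add[OF subspace_V_neg] subspace_scale[OF subspace_V_neg] by blast
      moreover have "scale c x + y = scale d v + (scale c x + z)" using y by simp
      ultimately show ?thesis by blast
    qed
  qed
qed

text \<open>Irreducibility in the form in which it is used: a nonzero vector can be moved out of \<open>V_neg\<close> by factors of
positive degree.\<close>

lemma vacuum_nondegenerate:
  assumes "\<And>ys. \<forall>y\<in>set ys. valid y \<and> deg y > 0 \<Longrightarrow> monomial ys u \<in> V_neg"
  shows "u = 0"
proof -
  \<comment> \<open>\<open>R\<close> is a submodule: a factor acting on \<open>u\<close> is commuted to the left through the positive factors, and
    there a factor of degree at most 0 preserves \<open>V_neg\<close>. It misses \<open>v\<close>, so it is zero.\<close>
  define R where "R = {u. \<forall>ys. (\<forall>y\<in>set ys. valid y \<and> deg y > 0) \<longrightarrow> monomial ys u \<in> V_neg}"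
  have Rop: "op t w \<in> R" if "valid t" "w \<in> R" for t w
  proof -
    have "monomial ys (op t w) \<in> V_neg" if "\<forall>y\<in>set ys. valid y \<and> deg y > 0" "valid t" "w \<in> R" for ys t w
      using that
    proof (induction ys arbitrary: t w rule: rev_induct)
      case Nil
      have w: "monomial ys w \<in> V_neg" if "\<forall>y\<in>set ys. valid y \<and> deg y > 0" for ys
        using Nil(3) that unfolding R_def by blast
      consider "deg t < 0" | "deg t = 0" | "deg t > 0" by linarith
      then have "op t w \<in> V_neg"
      proof cases
        case 1
        then show ?thesis using op_neg_in_V_neg Nil(2) by blast
      next
        case 2
        then show ?thesis using op_zero_V_neg[OF Nil(2)] w[of "[]"] by simp
      next
        case 3
        then show ?thesis using w[of "[t]"] Nil(2) by simp
      qed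
      then show ?case by simp
    next
      case (snoc y ys)
      have y: "valid y" "deg y > 0" "\<forall>y\<in>set ys. valid y \<and> deg y > 0" using snoc.prems by auto
      have yw: "op y w \<in> R"
        unfolding R_def
      proof (intro CollectI allI impI)
        fix zs assume "\<forall>y\<in>set zs. valid y \<and> deg y > 0"
        then have "\<forall>x\<in>set (zs @ [y]). valid x \<and> deg x > 0" using y by auto
        then have "monomial (zs @ [y]) w \<in> V_neg" using snoc.prems(3) unfolding R_def by blast
        then show "monomial zs (op y w) \<in> V_neg" by simp
      qed
      have "op t (op y w) = op y (op t w) + commutator t y w" using op_op snoc.prems y by blast
      then have "op y (op t w) = op t (op y w) - commutator t y w" by simp
      moreover have "monomial ys (op t (op y w)) \<in> V_neg" using snoc.IH[OF y(3) snoc.prems(2) yw] .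
      moreover have "monomial ys (commutator t y w) \<in> V_neg"
      proof -
        have sub: "subspace {x. monomial ys x \<in> V_neg}"
          using y(3) subspace_V_neg by (auto simp: subspace_def monomial_add monomial_scale monomial_0)
        have yw': "monomial ys w \<in> V_neg" using snoc.prems(3) y(3) unfolding R_def by blast
        have "commutator t y w \<in> {x. monomial ys x \<in> V_neg}"
          by (rule commutator_closed[OF snoc.prems(2) y(1) sub])
            (use snoc.IH[OF y(3) _ snoc.prems(3)] yw' in simp_all)
        then show ?thesis by simp
      qed
      moreover have "monomial ys (x - x') = monomial ys x - monomial ys x'" for x x'
        using monomial_add[of ys "x - x'" x'] y(3) by (simp add: algebra_simps)
      ultimately have "monomial ys (op y (op t w)) \<in> V_neg" using subspace_diff[OF subspace_V_neg] by simp
      then show ?case by simp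
    qed
    then show ?thesis using that unfolding R_def by blast
  qed
  have subR: "subspace R"
    unfolding R_def using subspace_V_neg by (auto simp: subspace_def monomial_add monomial_scale monomial_0)
  have "R = {0} \<or> R = UNIV"
  proof (rule irreducible[OF subR])
    show "X i j a w \<in> R" if "i < n" "j < n" "w \<in> R" for i j a w
      using Rop[of "(i, j, a)" w] that by (simp add: valid_def op_def)
    show "D w \<in> R" if w: "w \<in> R" for w
      unfolding R_def
    proof (intro CollectI allI impI)
      fix ys assume ys: "\<forall>y\<in>set ys. valid y \<and> deg y > 0"
      have "D (monomial ys w) = monomial ys (D w) + scale (of_int (\<Sum>t\<leftarrow>ys. snd (snd t))) (monomial ys w)"
        using ys
      proof (induction ys)
        case (Cons y ys)
        then show ?case by (simp add: D_op op_add op_scale scale_left_distrib)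
      qed simp
      then have "monomial ys (D w) = D (monomial ys w) - scale (of_int (\<Sum>t\<leftarrow>ys. snd (snd t))) (monomial ys w)"
        by simp
      moreover have "monomial ys w \<in> V_neg" using w ys unfolding R_def by blast
      ultimately show "monomial ys (D w) \<in> V_neg"
        using D_V_neg subspace_diff[OF subspace_V_neg] subspace_scale[OF subspace_V_neg] by metis
    qed
  qed
  moreover have "v \<notin> R"
  proof
    assume "v \<in> R"
    then have "\<forall>ys. (\<forall>y\<in>set ys. valid y \<and> deg y > 0) \<longrightarrow> monomial ys v \<in> V_neg"
      unfolding R_def by blast
    from this[rule_format, of "[]"] have "monomial [] v \<in> V_neg" by simp
    then show False using v_notin_V_neg by simp
  qed
  moreover have "u \<in> R" using assms unfolding R_def by blast
  ultimately show ?thesis by blast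
qed

end

context affine_vacuum
begin

lemma X_0: "i < n \<Longrightarrow> j < n \<Longrightarrow> X i j a 0 = 0"
  using X_scale[of i j a 0 0] by simp

lemma graded_principal:
  "graded_affine_vacuum scale n k X D v (int n) 1
     (\<lambda>u. scale (of_nat n) (D u) - (\<Sum>i<n. scale (of_nat i) (X i i 0 u)))"
proof
  fix u w c
  show "scale (of_nat n) (D (u + w)) - (\<Sum>i<n. scale (of_nat i) (X i i 0 (u + w))) =
       scale (of_nat n) (D u) - (\<Sum>i<n. scale (of_nat i) (X i i 0 u)) +
       (scale (of_nat n) (D w) - (\<Sum>i<n. scale (of_nat i) (X i i 0 w)))"
    by (simp add: D_add X_add scale_right_distrib sum.distrib)
  show "scale (of_nat n) (D (scale c u)) - (\<Sum>i<n. scale (of_nat i) (X i i 0 (scale c u))) =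
       scale c (scale (of_nat n) (D u) - (\<Sum>i<n. scale (of_nat i) (X i i 0 u)))"
    by (simp add: D_scale X_scale scale_right_diff_distrib scale_sum_right mult.commute)
  show "scale (of_nat n) (D v) - (\<Sum>i<n. scale (of_nat i) (X i i 0 v)) = 0"
    by (simp add: D_v X_v)
next
  fix p q a u assume pq: "p < n" "q < n"
  have sub: "X p q a (x - y) = X p q a x - X p q a y" for x y
    using X_add[OF pq, of a "x - y" y] by (simp add: algebra_simps)
  have sums: "X p q a (sum f A) = (\<Sum>i\<in>A. X p q a (f i))" if "finite A" for f and A :: "nat set"
    using that by (induction A rule: finite_induct) (auto simp: X_add pq X_0)
  have "X i i 0 (X p q a u) = X p q a (X i i 0 u)
     + scale ((if i = p then 1 else 0) - (if i = q then 1 else 0)) (X p q a u)" if "i < n" for i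
    using X_X[OF that that pq, of 0 a u] by (auto)
  then have "(\<Sum>i<n. scale (of_nat i) (X i i 0 (X p q a u)))
     = (\<Sum>i<n. scale (of_nat i) (X p q a (X i i 0 u))
         + scale (of_nat i * ((if i = p then 1 else 0) - (if i = q then 1 else 0))) (X p q a u))"
    by (intro sum.cong) (auto simp: scale_right_distrib)
  also have "\<dots> = X p q a (\<Sum>i<n. scale (of_nat i) (X i i 0 u))
      + scale (\<Sum>i<n. of_nat i * ((if i = p then 1 else 0) - (if i = q then 1 else 0))) (X p q a u)"
    by (simp add: sum.distrib sums X_scale pq scale_sum_left)
  also have "(\<Sum>i<n. of_nat i * ((if i = p then 1 else 0) - (if i = q then 1 else 0))) = (of_nat p - of_nat q :: complex)"
  proof -
    have "(\<Sum>i<n. of_nat i * ((if i = p then 1 else 0) - (if i = q then 1 else 0)))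
        = (\<Sum>i<n. (if i = p then of_nat i else 0) - (if i = q then of_nat i else (0::complex)))"
      by (intro sum.cong) auto
    then show ?thesis using pq by (simp add: sum_subtractf)
  qed
  finally have "(\<Sum>i<n. scale (of_nat i) (X i i 0 (X p q a u)))
     = X p q a (\<Sum>i<n. scale (of_nat i) (X i i 0 u)) + scale (of_nat p - of_nat q) (X p q a u)" .
  then show "scale (of_nat n) (D (X p q a u)) - (\<Sum>i<n. scale (of_nat i) (X i i 0 (X p q a u))) =
       X p q a (scale (of_nat n) (D u) - (\<Sum>i<n. scale (of_nat i) (X i i 0 u))) +
       scale (of_int (int n * a + 1 * (int q - int p))) (X p q a u)"
    by (simp add: D_X pq sub X_scale scale_right_distrib scale_left_distrib scale_left_diff_distrib algebra_simps)
next
  fix i j a assume ij: "i < n" "j < n" and d: "int n * a + 1 * (int j - int i) \<ge> 0"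
  have "a \<ge> 0"
  proof (rule ccontr)
    assume "\<not> a \<ge> 0"
    then have "int n * a \<le> int n * (-1)" by (intro mult_left_mono) auto
    then show False using d ij by simp
  qed
  then show "X i j a v = 0" using d ij X_v[OF ij, of a] by (cases "a = 0") auto
qed

text \<open>Since all coroots of \<open>sl(n)\<close> vanish on \<open>k \<Lambda>\<^sub>0\<close>, the vector \<open>X i j 0 v\<close> with \<open>j < i\<close> would be a
singular vector below \<open>v\<close>.\<close>

lemma X_v_zero_mode:
  assumes "i < n" "j < n"
  shows "X i j 0 v = 0"
  using assms
proof (induction "i - j" arbitrary: i j rule: less_induct)
  case less
  interpret P: graded_affine_vacuum scale n k X D v "int n" 1
    "\<lambda>u. scale (of_nat n) (D u) - (\<Sum>i<n. scale (of_nat i) (X i i 0 u))"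
    by (rule graded_principal)
  show ?case
  proof (cases "i \<le> j")
    case True
    then show ?thesis using X_v less by simp
  next
    case False
    \<comment> \<open>A positive mode applied to \<open>X i j 0 v\<close> gives the commutator on \<open>v\<close>: a positive mode, or a zero mode
      \<open>X p j 0\<close> or \<open>X i q 0\<close> with smaller difference of indices.\<close>
    have kill: "X p q b (X i j 0 v) = 0" if pq: "p < n" "q < n" and d: "P.deg (p, q, b) > 0" for p q b
    proof -
      have b: "b > 0 \<or> b = 0 \<and> p < q"
      proof (rule ccontr)
        assume "\<not> (b > 0 \<or> b = 0 \<and> p < q)"
        then consider "b \<le> -1" | "b = 0" "q \<le> p" by linarith
        then show False
        proof cases
          case 1
          then have "int n * b \<le> int n * (-1)" by (intro mult_left_mono) auto
          then show False using d pq by (simp add: P.deg_def)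
        qed (use d in \<open>simp add: P.deg_def\<close>)
      qed
      have "X p j b v = 0" if "q = i"
      proof (cases "b = 0 \<and> j < p")
        case True
        then show ?thesis using less.hyps[of p j] b pq less.prems that by auto
      next
        case False
        then show ?thesis using X_v[of p j b] b pq less.prems by auto
      qed
      moreover have "X i q b v = 0" if "j = p"
      proof (cases "b = 0 \<and> q < i")
        case True
        then show ?thesis using less.hyps[of i q] b pq less.prems that by auto
      next
        case False
        then show ?thesis using X_v[of i q b] b pq less.prems by auto
      qed
      moreover have "X p q b v = 0" using X_v[of p q b] b pq by auto
      ultimately show ?thesis
        using X_X[of p q i j b 0 v] pq less.prems X_0 by auto
    qed
    have "P.deg (i, j, 0) < 0" using False by (simp add: P.deg_def)
    then have u: "X i j 0 v \<in> P.V_neg"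
      using P.op_neg_in_V_neg[of "(i, j, 0)" v] less.prems by (simp add: valid_def op_def)
    show ?thesis
    proof (rule P.vacuum_nondegenerate)
      fix ys assume ys: "\<forall>y\<in>set ys. valid y \<and> P.deg y > 0"
      show "monomial ys (X i j 0 v) \<in> P.V_neg"
      proof (cases ys rule: rev_cases)
        case Nil
        then show ?thesis using u by simp
      next
        case (snoc zs y)
        obtain p q b where y: "y = (p, q, b)" by (cases y)
        have "op y (X i j 0 v) = 0" using kill[of p q b] ys snoc y by (simp add: valid_def op_def)
        then have "monomial ys (X i j 0 v) = monomial zs 0" using snoc by simp
        also have "\<dots> = 0" using ys snoc by (intro monomial_0) auto
        finally show ?thesis using subspace_0[OF P.subspace_V_neg] by simp
      qed
    qed
  qed
qed

end

section \<open>Vacuum expectation values\<close>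

definition invariant_maps :: "nat \<Rightarrow> nat \<Rightarrow> (nat \<Rightarrow> nat) \<Rightarrow> (nat \<Rightarrow> nat) set" where
  "invariant_maps k m p = {d \<in> {..<m} \<rightarrow>\<^sub>E {..<k}. \<forall>i<m. d (p i) = d i}"

lemma permutes_restrict_Suc:
  assumes "p permutes {..<Suc m}"
  shows "(transpose m (p m) \<circ> p) permutes {..<m}"
proof -
  have "p m \<in> {..<Suc m}" using permutes_in_image[OF assms, of m] by blast
  then have "transpose m (p m) permutes {..<Suc m}" by (intro permutes_swap_id) auto
  then have q: "(transpose m (p m) \<circ> p) permutes {..<Suc m}" using permutes_compose[OF assms] by blast
  have "(transpose m (p m) \<circ> p) m = m" by simp
  then show ?thesis using q unfolding permutes_def by (metis lessThan_iff less_Suc_eq)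
qed

text \<open>Removing the point \<open>m\<close> from its cycle: a fixed point can be coloured freely, otherwise the colour of \<open>m\<close> is
that of its image.\<close>

lemma card_invariant_maps_Suc:
  assumes p: "p permutes {..<Suc m}"
  shows "card (invariant_maps k (Suc m) p)
    = (if p m = m then k else 1) * card (invariant_maps k m (transpose m (p m) \<circ> p))"
proof (cases "p m = m")
  case True
  have lt: "p i < m" if "i < m" for i
  proof -
    have "p i \<in> {..<Suc m}" using permutes_in_image[OF p, of i] that by simp
    moreover have "p i \<noteq> m" using permutes_inj[OF p] True that by (metis injD less_irrefl)
    ultimately show ?thesis by simp
  qed
  have "bij_betw (\<lambda>d. (d m, restrict d {..<m})) (invariant_maps k (Suc m) p) ({..<k} \<times> invariant_maps k m p)"
  proof (rule bij_betw_byWitness[where f' = "\<lambda>(c, d). d(m := c)"])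
    show "\<forall>d\<in>invariant_maps k (Suc m) p. (case (d m, restrict d {..<m}) of (c, d) \<Rightarrow> d(m := c)) = d"
      by (auto simp: invariant_maps_def PiE_iff extensional_def fun_eq_iff less_Suc_eq)
    show "\<forall>cd\<in>{..<k} \<times> invariant_maps k m p.
        ((case cd of (c, d) \<Rightarrow> d(m := c)) m, restrict (case cd of (c, d) \<Rightarrow> d(m := c)) {..<m}) = cd"
      by (auto simp: invariant_maps_def PiE_iff extensional_def fun_eq_iff)
    show "(\<lambda>d. (d m, restrict d {..<m})) ` invariant_maps k (Suc m) p \<subseteq> {..<k} \<times> invariant_maps k m p"
      using lt by (auto simp: invariant_maps_def PiE_iff less_Suc_eq)
    show "(\<lambda>(c, d). d(m := c)) ` ({..<k} \<times> invariant_maps k m p) \<subseteq> invariant_maps k (Suc m) p"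
    proof (rule image_subsetI)
      fix cd assume "cd \<in> {..<k} \<times> invariant_maps k m p"
      then obtain c d where cd: "cd = (c, d)" and c: "c \<in> {..<k}" and d: "d \<in> invariant_maps k m p"
        by blast
      have "(d(m := c)) (p i) = (d(m := c)) i" if "i < Suc m" for i
      proof (cases "i = m")
        case False
        then have "i < m" using that by simp
        then show ?thesis using lt[of i] d by (auto simp: invariant_maps_def)
      qed (use True in simp)
      moreover have "d(m := c) \<in> {..<Suc m} \<rightarrow>\<^sub>E {..<k}"
        using c d by (auto simp: invariant_maps_def PiE_iff less_Suc_eq extensional_def)
      ultimately have "d(m := c) \<in> invariant_maps k (Suc m) p" unfolding invariant_maps_def by blast
      then show "(case cd of (c, d) \<Rightarrow> d(m := c)) \<in> invariant_maps k (Suc m) p" by (simp add: cd)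
    qed
  qed
  from bij_betw_same_card[OF this] True show ?thesis by (simp add: card_cartesian_product)
next
  case False
  define q where "q = p m"
  define r where "r = inv_into UNIV p m"
  have inj: "inj p" using permutes_inj[OF p] .
  have pr: "p r = m" unfolding r_def by (rule permutes_inverses(1)[OF p])
  have q: "q < m" using permutes_in_image[OF p, of m] False by (simp add: q_def)
  have r: "r < m"
  proof -
    have "r \<in> {..<Suc m}" using permutes_in_image[OF p, of r] pr by simp
    moreover have "r \<noteq> m" using pr False by auto
    ultimately show ?thesis by simp
  qed
  let ?p' = "transpose m q \<circ> p"
  have p': "?p' i = (if i = r then q else p i)" if "i < m" for i
  proof (cases "i = r")
    case False
    then have "p i \<noteq> m" "p i \<noteq> q" using inj pr q_def that by (metis injD less_irrefl)+
    then show ?thesis using False by simp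
  qed (use pr in simp)
  have lt: "p i < m" if "i < m" "i \<noteq> r" for i
  proof -
    have "p i \<in> {..<Suc m}" using permutes_in_image[OF p, of i] that by simp
    moreover have "p i \<noteq> m" using inj pr that by (metis injD)
    ultimately show ?thesis by simp
  qed
  have "bij_betw (\<lambda>d. restrict d {..<m}) (invariant_maps k (Suc m) p) (invariant_maps k m ?p')"
  proof (rule bij_betw_byWitness[where f' = "\<lambda>d. d(m := d q)"])
    show "\<forall>d\<in>invariant_maps k (Suc m) p. (restrict d {..<m})(m := restrict d {..<m} q) = d"
      using q by (auto simp: invariant_maps_def PiE_iff extensional_def fun_eq_iff less_Suc_eq q_def)
    show "\<forall>d\<in>invariant_maps k m ?p'. restrict (d(m := d q)) {..<m} = d"
      by (auto simp: invariant_maps_def PiE_iff extensional_def fun_eq_iff)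
    show "(\<lambda>d. restrict d {..<m}) ` invariant_maps k (Suc m) p \<subseteq> invariant_maps k m ?p'"
    proof (rule image_subsetI)
      fix d assume d: "d \<in> invariant_maps k (Suc m) p"
      then have D: "\<And>i. i < Suc m \<Longrightarrow> d (p i) = d i" "d \<in> {..<Suc m} \<rightarrow>\<^sub>E {..<k}"
        by (auto simp: invariant_maps_def)
      have "restrict d {..<m} (?p' i) = restrict d {..<m} i" if i: "i < m" for i
      proof (cases "i = r")
        case True
        have "d q = d m" using D(1)[of m] by (simp add: q_def)
        also have "d m = d r" using D(1)[of r] pr r by simp
        finally show ?thesis using True q r p'[OF i] by simp
      next
        case False
        then show ?thesis using D(1)[of i] i lt p'[OF i] by simp
      qed
      moreover have "restrict d {..<m} \<in> {..<m} \<rightarrow>\<^sub>E {..<k}" using D(2) by (auto simp: PiE_iff)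
      ultimately show "restrict d {..<m} \<in> invariant_maps k m ?p'" unfolding invariant_maps_def by blast
    qed
    show "(\<lambda>d. d(m := d q)) ` invariant_maps k m ?p' \<subseteq> invariant_maps k (Suc m) p"
    proof (rule image_subsetI)
      fix d assume d: "d \<in> invariant_maps k m ?p'"
      then have D: "\<And>i. i < m \<Longrightarrow> d (?p' i) = d i" "d \<in> {..<m} \<rightarrow>\<^sub>E {..<k}"
        unfolding invariant_maps_def by blast+
      let ?d = "d(m := d q)"
      have "?d (p i) = ?d i" if i: "i < Suc m" for i
      proof -
        consider "i = m" | "i = r" | "i < m" "i \<noteq> r" using i by linarith
        then show ?thesis
        proof cases
          case 1
          then show ?thesis using q by (simp add: q_def[symmetric])
        next
          case 2
          then show ?thesis using D(1)[OF r] p'[OF r] pr r by simp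
        next
          case 3
          then show ?thesis using D(1)[of i] p'[of i] lt[of i] by auto
        qed
      qed
      moreover have "?d \<in> {..<Suc m} \<rightarrow>\<^sub>E {..<k}"
        using D(2) q by (auto simp: PiE_iff extensional_def less_Suc_eq)
      ultimately show "?d \<in> invariant_maps k (Suc m) p" unfolding invariant_maps_def by blast
    qed
  qed
  from bij_betw_same_card[OF this] False show ?thesis by (simp add: q_def)
qed


text \<open>This is \<open>sgn p\<close> times \<open>k\<close> to the power of the number of cycles of \<open>p\<close>. Counting invariant maps instead of
cycles makes the Gram matrix a sum of squares in \<open>gram_kernel\<close>.\<close>

definition signed_colourings :: "nat \<Rightarrow> nat \<Rightarrow> (nat \<Rightarrow> nat) \<Rightarrow> complex" where
  "signed_colourings k m p = of_int (sign p) * of_nat (card (invariant_maps k m p))"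

lemma signed_colourings_Suc:
  assumes p: "p permutes {..<Suc m}"
  shows "signed_colourings k (Suc m) p
    = (if p m = m then of_nat k else -1) * signed_colourings k m (transpose m (p m) \<circ> p)"
proof -
  have P: "permutation p" using p by (auto intro: permutation_permutes[THEN iffD2])
  have "permutation (transpose m (p m))" by (rule permutation_swap_id)
  then have "sign (transpose m (p m) \<circ> p) = (if p m = m then 1 else -1) * sign p"
    using sign_compose[OF _ P] by (auto simp: sign_swap_id)
  then show ?thesis unfolding signed_colourings_def card_invariant_maps_Suc[OF p] by simp
qed

lemma mset_map_upt_remove:
  assumes "p < m"
  shows "mset (map f [0..<m]) = add_mset (f p) (mset (map f (remove1 p [0..<m])))"
proof -
  have "mset [0..<m] = add_mset p (mset (remove1 p [0..<m]))" using assms by simp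
  then show ?thesis by (metis image_mset_add_mset mset_map)
qed

context affine_vacuum
begin

lemma monomial_commute:
  assumes "\<And>t u. t \<in> set ts \<Longrightarrow> op y (op t u) = op t (op y u)"
  shows "op y (monomial ts u) = monomial ts (op y u)"
  using assms by (induction ts) auto

lemma monomial_cong_mset:
  assumes "mset ts = mset ts'"
    and "\<And>t t' u. t \<in> set ts \<Longrightarrow> t' \<in> set ts \<Longrightarrow> op t (op t' u) = op t' (op t u)"
  shows "monomial ts u = monomial ts' u"
proof -
  have "fold op (rev ts) = fold op (rev ts')"
    by (rule fold_multiset_equiv) (use assms in \<open>auto simp: fun_eq_iff\<close>)
  then show ?thesis by (simp add: foldr_conv_fold)
qed

lemma op_commute:
  assumes "i < n" "j < n" "p < n" "q < n" "j \<noteq> p" "q \<noteq> i" "a + b = 0 \<longrightarrow> i \<noteq> j \<or> p \<noteq> q"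
  shows "op (i, j, a) (op (p, q, b) u) = op (p, q, b) (op (i, j, a) u)"
  using assms X_X[OF assms(1-4), of a b u] unfolding op_def by auto

text \<open>The vacuum expectation value, by induction on the number of pairs. The raising factor for the pair
\<open>(g m, f m)\<close> meets only the two lowering factors with row \<open>f m\<close> or column \<open>g m\<close>. If these are the same
factor, it is contracted to the scalar \<open>k\<close>; otherwise both are replaced, up to sign, by the factor with
the remaining row and column. In both cases \<open>m\<close> is removed from its cycle in \<open>p\<close>.\<close>

lemma gram:
  assumes "\<And>i. i < m \<Longrightarrow> f i < n" "\<And>i. i < m \<Longrightarrow> g i < n"
    and "inj_on f {..<m}" "inj_on g {..<m}" "\<And>i j. i < m \<Longrightarrow> j < m \<Longrightarrow> f i \<noteq> g j"
    and "p permutes {..<m}"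
  shows "monomial (map (\<lambda>i. (g i, f i, 1)) [0..<m]) (monomial (map (\<lambda>i. (f i, g (p i), -1)) [0..<m]) v)
    = scale (signed_colourings k m p) v"
  using assms
proof (induction m arbitrary: p)
  case 0
  then have "sign p = 1" by simp
  moreover have "card (invariant_maps k 0 p) = 1" by (simp add: invariant_maps_def)
  ultimately have "signed_colourings k 0 p = 1" by (simp add: signed_colourings_def sign_id)
  then show ?case by simp
next
  case (Suc m)
  note p = Suc.prems(6)
  note f = Suc.prems(1) and g = Suc.prems(2) and fg = Suc.prems(5)
  have finj: "f i = f j \<longleftrightarrow> i = j" if "i < Suc m" "j < Suc m" for i j
    using inj_on_eq_iff[OF Suc.prems(3)] that by simp
  have ginj: "g i = g j \<longleftrightarrow> i = j" if "i < Suc m" "j < Suc m" for i j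
    using inj_on_eq_iff[OF Suc.prems(4)] that by simp
  have gf: "g i \<noteq> f j" if "i < Suc m" "j < Suc m" for i j using fg[OF that(2,1)] by simp
  have plt: "p i < Suc m" if "i < Suc m" for i using permutes_in_image[OF p, of i] that by simp
  have pinj: "p i = p j \<longleftrightarrow> i = j" for i j using permutes_inj[OF p] by (simp add: inj_eq)
  let ?p' = "transpose m (p m) \<circ> p"
  have p': "?p' permutes {..<m}" by (rule permutes_restrict_Suc[OF p])
  let ?low = "\<lambda>i. (f i, g (p i), -1 :: int)"
  let ?y = "(g m, f m, 1 :: int)"
  have IH: "monomial (map (\<lambda>i. (g i, f i, 1)) [0..<m]) (monomial (map (\<lambda>i. (f i, g (?p' i), -1)) [0..<m]) v)
    = scale (signed_colourings k m ?p') v"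
    using Suc.prems(1,2,5) inj_on_subset[OF Suc.prems(3)] inj_on_subset[OF Suc.prems(4)]
    by (intro Suc.IH p') auto
  have comm: "op ?y (op (?low i) u) = op (?low i) (op ?y u)" if "i < m" "p i \<noteq> m" for i u
    by (rule op_commute) (use that f g plt finj[of m i] ginj[of "p i" m] gf[of m m] in auto)
  have comms: "op ?y (monomial (map ?low js) u) = monomial (map ?low js) (op ?y u)"
    if "\<And>i. i \<in> set js \<Longrightarrow> i < m \<and> p i \<noteq> m" for js u
  proof (rule monomial_commute)
    fix t u assume "t \<in> set (map ?low js)"
    then obtain i where "i \<in> set js" "t = ?low i" by auto
    then show "op ?y (op t u) = op t (op ?y u)" using comm that by simp
  qed
  have yv: "op ?y v = 0" using X_v[of "g m" "f m" 1] f g by (simp add: op_def)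
  have up: "map (\<lambda>i. (g i, f i, 1)) [0..<Suc m] = map (\<lambda>i. (g i, f i, 1)) [0..<m] @ [?y]" by simp
  have step: "op ?y (monomial (map ?low [0..<Suc m]) v)
     = scale (if p m = m then of_nat k else -1) (monomial (map (\<lambda>i. (f i, g (?p' i), -1)) [0..<m]) v)"
  proof (cases "p m = m")
    case True
    have ne: "p i \<noteq> m" if "i < m" for i using pinj[of i m] True that by auto
    have "op ?y (monomial (map ?low [0..<m]) (op (?low m) v))
        = monomial (map ?low [0..<m]) (op ?y (op (?low m) v))"
      by (rule comms) (simp add: ne)
    also have "op ?y (op (?low m) v) = scale (of_nat k) v"
      using X_X[of "g m" "f m" "f m" "g m" 1 "-1" v] yv X_0[of "f m" "g m" "-1"] f[of m] g[of m]
        gf[of m m] X_v_zero_mode[of "g m" "g m"] X_v_zero_mode[of "f m" "f m"] True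
      by (simp add: op_def)
    also have "monomial (map ?low [0..<m]) (scale (of_nat k) v) = scale (of_nat k) (monomial (map ?low [0..<m]) v)"
      by (intro monomial_scale) (use f g plt in \<open>auto simp: valid_def\<close>)
    finally show ?thesis using True by simp
  next
    case False
    define q where "q = p m"
    define r where "r = inv_into UNIV p m"
    have pr: "p r = m" unfolding r_def by (rule permutes_inverses(1)[OF p])
    have q: "q < m" using plt[of m] False by (simp add: q_def)
    have r: "r < m"
    proof -
      have "r \<in> {..<Suc m}" using permutes_in_image[OF p, of r] pr by simp
      moreover have "r \<noteq> m" using pr False by auto
      ultimately show ?thesis by simp
    qed
    let ?Q = "map ?low (remove1 r [0..<m])"
    have setQ: "set (remove1 r [0..<m]) = {..<m} - {r}" by (auto simp: set_remove1_eq)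
    have commlow: "op (?low i) (op (?low j) u) = op (?low j) (op (?low i) u)"
      if "i < Suc m" "j < Suc m" for i j u
      by (rule op_commute) (use that f g plt gf in \<open>auto\<close>)
    have "mset (map ?low [0..<Suc m]) = mset (?Q @ [?low m, ?low r])"
      using mset_map_upt_remove[OF r, of ?low] by simp
    then have "monomial (map ?low [0..<Suc m]) v = monomial (?Q @ [?low m, ?low r]) v"
      by (rule monomial_cong_mset) (use commlow in auto)
    then have "op ?y (monomial (map ?low [0..<Suc m]) v) = op ?y (monomial ?Q (op (?low m) (op (?low r) v)))"
      by simp
    also have "\<dots> = monomial ?Q (op ?y (op (?low m) (op (?low r) v)))"
      by (rule comms) (use setQ pinj[of _ r] pr in auto)
    also have "op ?y (op (?low m) (op (?low r) v)) = - op (f r, g q, -1) v"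
    proof -
      have yr: "X (g m) (f m) 1 (X (f r) (g m) (-1) v) = 0"
        using X_X[of "g m" "f m" "f r" "g m" 1 "-1" v] yv X_0[of "f r" "g m" "-1"] f[of m] g[of m] f[of r] r
          gf[of m r] gf[of m m] finj[of m r] X_v_zero_mode[of "f r" "f m"]
        by (simp add: op_def)
      \<comment> \<open>Here \<open>X (g m) (f m) 1\<close> is contracted with \<open>X (f m) (g q) (-1)\<close> to the zero mode \<open>X (g m) (g q) 0\<close>,
        which then meets \<open>X (f r) (g m) (-1)\<close> and joins the two broken pairs to \<open>(f r, g q)\<close>.\<close>
      have zr: "X (g m) (g q) 0 (X (f r) (g m) (-1) v) = - X (f r) (g q) (-1) v"
        using X_X[of "g m" "g q" "f r" "g m" 0 "-1" v] X_0[of "f r" "g m" "-1"] f[of r] g[of m] g[of q] r q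
          gf[of q r] X_v_zero_mode[of "g m" "g q"]
        by simp
      show ?thesis
        using X_X[of "g m" "f m" "f m" "g q" 1 "-1" "X (f r) (g m) (-1) v"] yr zr f[of m] g[of m] g[of q] q
          X_0[of "f m" "g q" "-1"] gf[of m m] ginj[of q m] pr
        by (simp add: op_def q_def[symmetric])
    qed
    also have "monomial ?Q (- op (f r, g q, -1) v) = scale (-1) (monomial ?Q (op (f r, g q, -1) v))"
    proof -
      have "monomial ?Q (scale (-1) (op (f r, g q, -1) v)) = scale (-1) (monomial ?Q (op (f r, g q, -1) v))"
        by (rule monomial_scale) (use f g plt setQ in \<open>auto simp: valid_def\<close>)
      then show ?thesis by simp
    qed
    also have "monomial ?Q (op (f r, g q, -1) v) = monomial (?Q @ [(f r, g q, -1)]) v" by simp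
    also have "\<dots> = monomial (map (\<lambda>i. (f i, g (?p' i), -1)) [0..<m]) v"
    proof (rule monomial_cong_mset)
      have p'r: "?p' r = q" using pr by (simp add: q_def)
      have "?p' i = p i" if "i < m" "i \<noteq> r" for i
      proof -
        have "p i \<noteq> m" "p i \<noteq> p m" using pinj[of i r] pinj[of i m] pr that by auto
        then show ?thesis by simp
      qed
      then have Q: "?Q = map (\<lambda>i. (f i, g (?p' i), -1)) (remove1 r [0..<m])"
        using setQ by (intro map_cong) auto
      show "mset (?Q @ [(f r, g q, -1)]) = mset (map (\<lambda>i. (f i, g (?p' i), -1)) [0..<m])"
        unfolding mset_map_upt_remove[OF r, of "\<lambda>i. (f i, g (?p' i), -1)"] Q p'r by simp
      have form: "\<exists>i j. t = (f i, g j, -1) \<and> i < Suc m \<and> j < Suc m"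
        if tQ: "t \<in> set (?Q @ [(f r, g q, -1)])" for t
      proof -
        consider "t = (f r, g q, -1)" | i where "i < m" "t = ?low i" using tQ setQ by auto
        then show ?thesis
        proof cases
          case 1
          then show ?thesis using r q less_SucI by blast
        next
          case (2 i)
          then show ?thesis using plt[of i] less_SucI by blast
        qed
      qed
      fix t t' u assume t: "t \<in> set (?Q @ [(f r, g q, -1)])" and t': "t' \<in> set (?Q @ [(f r, g q, -1)])"
      obtain i j where 1: "t = (f i, g j, -1)" "i < Suc m" "j < Suc m" using form[OF t] by blast
      obtain i' j' where 2: "t' = (f i', g j', -1)" "i' < Suc m" "j' < Suc m" using form[OF t'] by blast
      show "op t (op t' u) = op t' (op t u)"
        unfolding 1(1) 2(1) using f[OF 1(2)] f[OF 2(2)] g[OF 1(3)] g[OF 2(3)] gf[OF 1(3) 2(2)] gf[OF 2(3) 1(2)]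
        by (intro op_commute) auto
    qed
    finally show ?thesis using False by simp
  qed
  have "monomial (map (\<lambda>i. (g i, f i, 1)) [0..<Suc m]) (monomial (map ?low [0..<Suc m]) v)
     = monomial (map (\<lambda>i. (g i, f i, 1)) [0..<m]) (op ?y (monomial (map ?low [0..<Suc m]) v))"
    unfolding up by simp
  also have "\<dots> = scale (if p m = m then of_nat k else -1) (scale (signed_colourings k m ?p') v)"
    unfolding step IH[symmetric] by (intro monomial_scale) (use f g in \<open>auto simp: valid_def\<close>)
  also have "\<dots> = scale (signed_colourings k (Suc m) p) v"
    by (simp add: signed_colourings_Suc[OF p])
  finally show ?case .
qed

end

section \<open>The weight space and its lowering monomials\<close>

lemma sum_sum_list_swap: "(\<Sum>q\<in>A. \<Sum>t\<leftarrow>ts. f q t) = (\<Sum>t\<leftarrow>ts. \<Sum>q\<in>A. f q t)"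
  for f :: "'a \<Rightarrow> 'b \<Rightarrow> 'c::comm_monoid_add"
  by (induction ts) (auto simp: sum.distrib)

lemma sum_list_indicator: "(\<Sum>t\<leftarrow>ts. if h t = q then 1 else 0) = int (count_list (map h ts) q)"
  by (induction ts) auto

text \<open>The finite part \<open>\<epsilon>\<^sub>0 + \<dots> + \<epsilon>\<^bsub>l-1\<^esub> - \<epsilon>\<^bsub>n-l\<^esub> - \<dots> - \<epsilon>\<^bsub>n-1\<^esub>\<close> of the weight
\<open>- \<gamma>\<^sub>l\<close>.\<close>

definition corner_weight :: "nat \<Rightarrow> nat \<Rightarrow> nat \<Rightarrow> int" where
  "corner_weight n l q = (if q < l then 1 else 0) - (if n - l \<le> q then 1 else 0)"

context affine_vacuum
begin

definition lower :: "nat \<Rightarrow> (nat \<Rightarrow> nat) \<Rightarrow> loop_unit list" where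
  "lower l p = map (\<lambda>i. (i, n - l + p i, -1)) [0..<l]"

definition raise :: "nat \<Rightarrow> (nat \<Rightarrow> nat) \<Rightarrow> loop_unit list" where
  "raise l p = map (\<lambda>i. (n - l + p i, i, 1)) [0..<l]"

text \<open>A factor of \<open>t\<close>-degree at most -1 can supply at most one of the \<open>l\<close> required rows and one of the \<open>l\<close>
required columns. With total degree \<open>-l\<close> there is no room for anything else, so the factors match rows with
columns, each once and in degree -1. This is where \<open>2 l \<le> n\<close> enters: rows and columns are disjoint.\<close>

lemma corner_weight_monomials:
  fixes ts :: "loop_unit list"
  assumes l: "2 * l \<le> n"
    and neg: "\<And>t. t \<in> set ts \<Longrightarrow> fst t < n \<and> fst (snd t) < n \<and> snd (snd t) \<le> -1"
    and deg: "(\<Sum>t\<leftarrow>ts. snd (snd t)) = - int l"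
    and wt: "\<And>q. q < n \<Longrightarrow> (\<Sum>t\<leftarrow>ts. diag_weight q t) = corner_weight n l q"
  shows "\<exists>p. p permutes {..<l} \<and> mset ts = mset (lower l p)"
proof -
  \<comment> \<open>Weigh each factor \<open>E\<^bsub>ij\<^esub> t^a\<close> by \<open>-a\<close> minus its contribution to the rows below \<open>l\<close>. This is never
    negative since a factor contributes at most 1, and the total is \<open>l - l = 0\<close>; so every factor has
    \<open>a = -1\<close> and a row below \<open>l\<close>. The columns at least \<open>n - l\<close> are treated in the same way.\<close>
  define rc where "rc = (\<lambda>t::loop_unit. (if fst t < l then 1 else 0) - (if fst (snd t) < l then 1 else 0) :: int)"
  define cc where "cc = (\<lambda>t::loop_unit. (if fst (snd t) \<ge> n - l then 1 else 0) - (if fst t \<ge> n - l then 1 else 0) :: int)"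
  have neg_sum: "(\<Sum>t\<leftarrow>ts. - snd (snd t)) = - (\<Sum>t\<leftarrow>ts. snd (snd t))"
    by (induction ts) auto
  have "(\<Sum>t\<leftarrow>ts. rc t) = int l"
  proof -
    have "(\<Sum>q<l. corner_weight n l q) = (\<Sum>q<l. 1)"
      using l by (intro sum.cong) (auto simp: corner_weight_def)
    then have "int l = (\<Sum>q<l. corner_weight n l q)" by simp
    also have "\<dots> = (\<Sum>q<l. \<Sum>t\<leftarrow>ts. diag_weight q t)" using wt l by (intro sum.cong) auto
    also have "\<dots> = (\<Sum>t\<leftarrow>ts. \<Sum>q<l. diag_weight q t)" by (rule sum_sum_list_swap)
    also have "(\<lambda>t. \<Sum>q<l. diag_weight q t) = rc"
      by (auto simp: diag_weight_def rc_def fun_eq_iff sum_subtractf)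
    finally show ?thesis by simp
  qed
  then have r0: "(\<Sum>t\<leftarrow>ts. - snd (snd t) - rc t) = 0"
    using deg neg_sum by (simp add: sum_list_subtractf)
  have rr: "- snd (snd t) - rc t = 0" if "t \<in> set ts" for t
  proof -
    have "\<forall>x\<in>set (map (\<lambda>t. - snd (snd t) - rc t) ts). x \<ge> 0"
      using neg by (fastforce simp: rc_def)
    then have "\<forall>x\<in>set (map (\<lambda>t. - snd (snd t) - rc t) ts). x = 0"
      using r0 sum_list_nonneg_eq_0_iff by blast
    then show ?thesis using that by simp
  qed
  have "(\<Sum>t\<leftarrow>ts. cc t) = int l"
  proof -
    have "(\<Sum>q\<in>{n-l..<n}. corner_weight n l q) = (\<Sum>q\<in>{n-l..<n}. -1)"
      using l by (intro sum.cong) (auto simp: corner_weight_def)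
    then have "- int l = (\<Sum>q\<in>{n-l..<n}. corner_weight n l q)" using l by simp
    also have "\<dots> = (\<Sum>q\<in>{n-l..<n}. \<Sum>t\<leftarrow>ts. diag_weight q t)" using wt l by (intro sum.cong) auto
    also have "\<dots> = (\<Sum>t\<leftarrow>ts. \<Sum>q\<in>{n-l..<n}. diag_weight q t)" by (rule sum_sum_list_swap)
    also have "\<dots> = (\<Sum>t\<leftarrow>ts. - cc t)"
      using neg by (intro arg_cong[where f = sum_list] map_cong refl)
        (auto simp: diag_weight_def cc_def sum_subtractf)
    finally have "- int l = (\<Sum>t\<leftarrow>ts. - cc t)" .
    moreover have "(\<Sum>t\<leftarrow>ts. - cc t) = - (\<Sum>t\<leftarrow>ts. cc t)" by (induction ts) auto
    ultimately show ?thesis by simp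
  qed
  then have c0: "(\<Sum>t\<leftarrow>ts. - snd (snd t) - cc t) = 0"
    using deg neg_sum by (simp add: sum_list_subtractf)
  have cc: "- snd (snd t) - cc t = 0" if "t \<in> set ts" for t
  proof -
    have "\<forall>x\<in>set (map (\<lambda>t. - snd (snd t) - cc t) ts). x \<ge> 0"
      using neg by (fastforce simp: cc_def)
    then have "\<forall>x\<in>set (map (\<lambda>t. - snd (snd t) - cc t) ts). x = 0"
      using c0 sum_list_nonneg_eq_0_iff by blast
    then show ?thesis using that by simp
  qed
  have shape: "fst t < l" "n - l \<le> fst (snd t)" "fst (snd t) < n" "snd (snd t) = -1"
    if "t \<in> set ts" for t
    using rr[OF that] cc[OF that] neg[OF that] unfolding rc_def cc_def by (auto split: if_splits)
  have rows: "count_list (map fst ts) q = 1" if "q < l" for q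
  proof -
    have "(\<Sum>t\<leftarrow>ts. diag_weight q t) = (\<Sum>t\<leftarrow>ts. if fst t = q then 1 else 0)"
    proof (intro arg_cong[where f = sum_list] map_cong refl)
      fix t assume "t \<in> set ts"
      then show "diag_weight q t = (if fst t = q then 1 else 0)"
        using shape[of t] that l by (auto simp: diag_weight_def)
    qed
    moreover have "\<not> n - l \<le> q" using that l by linarith
    ultimately have "int (count_list (map fst ts) q) = 1"
      using wt[of q] that l sum_list_indicator[of fst q ts] by (simp add: corner_weight_def)
    then show ?thesis by simp
  qed
  have cols: "count_list (map (fst \<circ> snd) ts) q = 1" if "n - l \<le> q" "q < n" for q
  proof -
    have "(\<Sum>t\<leftarrow>ts. diag_weight q t) = (\<Sum>t\<leftarrow>ts. - (if (fst \<circ> snd) t = q then 1 else 0))"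
    proof (intro arg_cong[where f = sum_list] map_cong refl)
      fix t assume "t \<in> set ts"
      then show "diag_weight q t = - (if (fst \<circ> snd) t = q then 1 else 0)"
        using shape[of t] that l by (auto simp: diag_weight_def)
    qed
    also have "\<dots> = - (\<Sum>t\<leftarrow>ts. (if (fst \<circ> snd) t = q then 1 else 0))"
      by (induction ts) auto
    finally have "(\<Sum>t\<leftarrow>ts. diag_weight q t) = - (\<Sum>t\<leftarrow>ts. (if (fst \<circ> snd) t = q then 1 else 0))" .
    moreover have "\<not> q < l" using that l by linarith
    ultimately have "int (count_list (map (fst \<circ> snd) ts) q) = 1"
      using wt[of q] that l sum_list_indicator[of "fst \<circ> snd" q ts] by (simp add: corner_weight_def)
    then show ?thesis by simp
  qed
  have upt1: "count (mset [a..<b]) q = 1" if "a \<le> q" "q < b" for a b q :: nat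
    using distinct_count_atmost_1[THEN iffD1, of "[a..<b]"] that
    by (simp del: mset_upt)
  have mr: "mset (map fst ts) = mset [0..<l]"
  proof (rule multiset_eqI)
    fix q
    show "count (mset (map fst ts)) q = count (mset [0..<l]) q"
    proof (cases "q < l")
      case True
      then have "count (mset (map fst ts)) q = 1" using rows by (simp only: count_mset)
      then show ?thesis using upt1[of q 0 l] True by simp
    next
      case False
      then have "q \<notin> set (map fst ts)" "q \<notin> set [0..<l]" using shape(1) by auto
      then show ?thesis by (metis count_mset_0_iff)
    qed
  qed
  have mc: "mset (map (fst \<circ> snd) ts) = mset [n-l..<n]"
  proof (rule multiset_eqI)
    fix q
    show "count (mset (map (fst \<circ> snd) ts)) q = count (mset [n-l..<n]) q"
    proof (cases "n - l \<le> q \<and> q < n")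
      case True
      then have "count (mset (map (fst \<circ> snd) ts)) q = 1" using cols by (simp only: count_mset)
      then show ?thesis using upt1[of q "n - l" n] True by simp
    next
      case False
      then have "q \<notin> set (map (fst \<circ> snd) ts)" "q \<notin> set [n-l..<n]" using shape(2,3) by auto
      then show ?thesis by (metis count_mset_0_iff)
    qed
  qed
  define ts' where "ts' = sort_key fst ts"
  have mts': "mset ts' = mset ts" by (simp add: ts'_def)
  have "sorted (map fst ts')" by (simp add: ts'_def)
  moreover have "mset (map fst ts') = mset [0..<l]" using mr mts' by (metis mset_map)
  ultimately have fts': "map fst ts' = [0..<l]"
    by (metis properties_for_sort sorted_upt)
  have len: "length ts' = l" using arg_cong[OF fts', of length] by simp
  have mcts': "mset (map (fst \<circ> snd) ts') = mset [n-l..<n]" using mc mts' by (metis mset_map)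
  then have dist: "distinct (map (fst \<circ> snd) ts')" and cset: "set (map (fst \<circ> snd) ts') = {n-l..<n}"
    using mset_eq_imp_distinct_iff[OF mcts'] mset_eq_setD[OF mcts'] by simp_all
  \<comment> \<open>Sorted by rows, the rows are \<open>0, \<dots>, l - 1\<close> and the columns form a permutation.\<close>
  define p where "p = (\<lambda>i. if i < l then fst (snd (ts' ! i)) - (n - l) else i)"
  have nth: "ts' ! i = (i, n - l + p i, -1)" "n - l + p i = map (fst \<circ> snd) ts' ! i" if "i < l" for i
  proof -
    have "ts' ! i \<in> set ts" using that len mts' by (metis nth_mem set_mset_mset)
    then have "n - l \<le> fst (snd (ts' ! i))" "snd (snd (ts' ! i)) = -1" using shape by blast+
    moreover have "fst (ts' ! i) = i" using arg_cong[OF fts', of "\<lambda>xs. xs ! i"] that len by simp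
    ultimately show "ts' ! i = (i, n - l + p i, -1)" using that by (simp add: p_def prod_eq_iff)
    then show "n - l + p i = map (fst \<circ> snd) ts' ! i" using that len by simp
  qed
  have "inj_on p {..<l}"
  proof (rule inj_onI)
    fix i j assume "i \<in> {..<l}" "j \<in> {..<l}" "p i = p j"
    then have "map (fst \<circ> snd) ts' ! i = map (fst \<circ> snd) ts' ! j"
      using nth(2)[of i] nth(2)[of j] by (metis lessThan_iff)
    then show "i = j"
      using nth_eq_iff_index_eq[OF dist, of i j] len \<open>i \<in> {..<l}\<close> \<open>j \<in> {..<l}\<close> by simp
  qed
  moreover have "p ` {..<l} \<subseteq> {..<l}"
  proof (rule image_subsetI)
    fix i assume i: "i \<in> {..<l}"
    then have "n - l + p i \<in> {n-l..<n}" using nth(2)[of i] len cset by (metis length_map lessThan_iff nth_mem)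
    then show "p i \<in> {..<l}" using l by auto
  qed
  ultimately have "bij_betw p {..<l} {..<l}"
    by (simp add: bij_betw_def endo_inj_surj)
  then have "p permutes {..<l}" by (rule bij_imp_permutes) (simp add: p_def)
  moreover have "ts' = lower l p" using len nth(1) by (intro nth_equalityI) (auto simp: lower_def)
  ultimately show ?thesis using mts' by metis
qed

definition corner_space :: "nat \<Rightarrow> 'v set" where
  "corner_space l = {u. D u = scale (- of_nat l) u
     \<and> (\<forall>i<n. X i i 0 u = scale (of_int (corner_weight n l i)) u)}"

lemma subspace_corner_space: "subspace (corner_space l)"
  unfolding corner_space_def
  by (auto simp: subspace_def D_add D_scale X_add X_scale scale_right_distrib mult.commute
      scale_left_commute X_0 D_scale[of 0 0, simplified])

lemma lower_valid: "p permutes {..<l} \<Longrightarrow> 2 * l \<le> n \<Longrightarrow> t \<in> set (lower l p) \<Longrightarrow> valid t"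
proof -
  assume A: "p permutes {..<l}" "2 * l \<le> n" "t \<in> set (lower l p)"
  then obtain i where i: "i < l" "t = (i, n - l + p i, -1)" by (auto simp: lower_def)
  moreover have "p i < l" using permutes_in_image[OF A(1), of i] i by simp
  ultimately show "valid t" using A(2) by (simp add: valid_def)
qed

lemma raise_valid: "p permutes {..<l} \<Longrightarrow> 2 * l \<le> n \<Longrightarrow> t \<in> set (raise l p) \<Longrightarrow> valid t"
proof -
  assume A: "p permutes {..<l}" "2 * l \<le> n" "t \<in> set (raise l p)"
  then obtain i where i: "i < l" "t = (n - l + p i, i, 1)" by (auto simp: raise_def)
  moreover have "p i < l" using permutes_in_image[OF A(1), of i] i by simp
  ultimately show "valid t" using A(2) by (simp add: valid_def)
qed

lemma lower_in_corner_space: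
  assumes p: "p permutes {..<l}" and l: "2 * l \<le> n"
  shows "monomial (lower l p) v \<in> corner_space l"
proof -
  have V: "\<forall>t\<in>set (lower l p). valid t" using lower_valid[OF p l] by blast
  have "(\<Sum>t\<leftarrow>lower l p. snd (snd t)) = - int l"
    by (simp add: lower_def o_def sum_list_triv)
  then have "D (monomial (lower l p) v) = scale (- of_nat l) (monomial (lower l p) v)"
    using D_monomial[OF V, of v 0] D_v by simp
  moreover have "X q q 0 (monomial (lower l p) v) = scale (of_int (corner_weight n l q)) (monomial (lower l p) v)"
    if q: "q < n" for q
  proof -
    have "(\<Sum>t\<leftarrow>lower l p. diag_weight q t)
       = (\<Sum>i<l. (if i = q then 1 else 0) - (if n - l + p i = q then 1 else 0))"
      by (simp add: lower_def o_def diag_weight_def sum_list_sum_nth atLeast0LessThan interv_sum_list_conv_sum_set_nat)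
    also have "\<dots> = (\<Sum>i<l. if i = q then 1 else 0) - (\<Sum>i<l. if n - l + p i = q then 1 else 0)"
      by (rule sum_subtractf)
    also have "(\<Sum>i<l. if n - l + p i = q then 1 else 0 :: int) = (\<Sum>i<l. if n - l + i = q then 1 else 0)"
      using sum.permute[OF p, of "\<lambda>i. if n - l + i = q then 1 else 0 :: int"] by (simp add: o_def)
    also have "\<dots> = (\<Sum>i<l. if i = q - (n - l) then (if n - l \<le> q then 1 else 0) else 0)"
      by (intro sum.cong) auto
    also have "\<dots> = (if n - l \<le> q then 1 else 0)" using q l by auto
    also have "(\<Sum>i<l. if i = q then 1 else 0) = (if q < l then 1 else 0 :: int)" by simp
    finally have "(\<Sum>t\<leftarrow>lower l p. diag_weight q t) = corner_weight n l q"
      by (simp add: corner_weight_def)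
    then show ?thesis
      using diag_monomial[OF q V, of v 0] X_v[of q q 0] q by simp
  qed
  ultimately show ?thesis by (simp add: corner_space_def)
qed

lemma graded_degree: "graded_affine_vacuum scale n k X D v 1 0 D"
proof
  show "D (u + w) = D u + D w" "D (scale c u) = scale c (D u)" "D v = 0" for u w c
    by (rule D_add D_scale D_v)+
  show "D (X i j a u) = X i j a (D u) + scale (of_int (1 * a + 0 * (int j - int i))) (X i j a u)"
    if "i < n" "j < n" for i j a u using D_X[OF that] by simp
  show "X i j a v = 0" if "i < n" "j < n" "0 \<le> 1 * a + 0 * (int j - int i)" for i j a
    using that X_v[OF that(1,2), of a] X_v_zero_mode[OF that(1,2)] by (cases "a = 0") auto
qed

lemma lower_commute:
  assumes "p permutes {..<l}" "2 * l \<le> n" "t \<in> set (lower l p)" "t' \<in> set (lower l p)"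
  shows "op t (op t' u) = op t' (op t u)"
proof -
  have lt: "p i < l" if "i < l" for i using permutes_in_image[OF assms(1), of i] that by simp
  obtain i where i: "i < l" "t = (i, n - l + p i, -1)" using assms(3) by (auto simp: lower_def)
  obtain j where j: "j < l" "t' = (j, n - l + p j, -1)" using assms(4) by (auto simp: lower_def)
  show ?thesis unfolding i(2) j(2) using i(1) j(1) lt[OF i(1)] lt[OF j(1)] assms(2)
    by (intro op_commute) auto
qed

lemma raise_commute:
  assumes "p permutes {..<l}" "2 * l \<le> n" "t \<in> set (raise l p)" "t' \<in> set (raise l p)"
  shows "op t (op t' u) = op t' (op t u)"
proof -
  have lt: "p i < l" if "i < l" for i using permutes_in_image[OF assms(1), of i] that by simp
  obtain i where i: "i < l" "t = (n - l + p i, i, 1)" using assms(3) by (auto simp: raise_def)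
  obtain j where j: "j < l" "t' = (n - l + p j, j, 1)" using assms(4) by (auto simp: raise_def)
  show ?thesis unfolding i(2) j(2) using i(1) j(1) lt[OF i(1)] lt[OF j(1)] assms(2)
    by (intro op_commute) auto
qed

lemma corner_space_spanned:
  assumes l: "2 * l \<le> n" and u: "u \<in> corner_space l"
  shows "u \<in> span ((\<lambda>p. monomial (lower l p) v) ` {p. p permutes {..<l}})"
proof -
  interpret G: graded_affine_vacuum scale n k X D v 1 0 D by (rule graded_degree)
  \<comment> \<open>Impose the eigenvalue of \<open>D\<close> and then of one diagonal operator after the other.\<close>
  define J where "J m = {ts \<in> G.neg_lists. (\<Sum>t\<leftarrow>ts. snd (snd t)) = - int l
      \<and> (\<forall>q<m. (\<Sum>t\<leftarrow>ts. diag_weight q t) = corner_weight n l q)}" for m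
  have V: "\<forall>t\<in>set ts. valid t" if "ts \<in> G.neg_lists" for ts using that by (auto simp: G.neg_lists_def)
  have "m \<le> n \<Longrightarrow> u \<in> span ((\<lambda>ts. monomial ts v) ` J m)" for m
  proof (induction m)
    case 0
    have "u \<in> span ((\<lambda>ts. monomial ts v) ` {ts \<in> G.neg_lists. of_int (\<Sum>t\<leftarrow>ts. snd (snd t)) = (- of_nat l :: complex)})"
    proof (rule eigenvector_in_span[where Z = D, OF D_add D_scale])
      show "u \<in> span ((\<lambda>ts. monomial ts v) ` G.neg_lists)" using G.span_neg_lists by blast
      show "D u = scale (- of_nat l) u" using u by (simp add: corner_space_def)
      show "D (monomial ts v) = scale (of_int (\<Sum>t\<leftarrow>ts. snd (snd t))) (monomial ts v)" if "ts \<in> G.neg_lists" for ts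
        using D_monomial[OF V[OF that], of v 0] D_v by simp
    qed
    moreover have "{ts \<in> G.neg_lists. of_int (\<Sum>t\<leftarrow>ts. snd (snd t)) = (- of_nat l :: complex)} = J 0"
    proof -
      have "of_int x = (- of_nat l :: complex) \<longleftrightarrow> x = - int l" for x
        by (metis of_int_eq_iff of_int_minus of_int_of_nat_eq)
      then show ?thesis unfolding J_def by simp
    qed
    ultimately show ?case by simp
  next
    case (Suc m)
    have m: "m < n" using Suc.prems by simp
    have "u \<in> span ((\<lambda>ts. monomial ts v) ` {ts \<in> J m. of_int (\<Sum>t\<leftarrow>ts. diag_weight m t) = (of_int (corner_weight n l m) :: complex)})"
    proof (rule eigenvector_in_span[where Z = "X m m 0", OF X_add X_scale])
      show "u \<in> span ((\<lambda>ts. monomial ts v) ` J m)" using Suc by simp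
      show "X m m 0 u = scale (of_int (corner_weight n l m)) u" using u m by (simp add: corner_space_def)
      show "X m m 0 (monomial ts v) = scale (of_int (\<Sum>t\<leftarrow>ts. diag_weight m t)) (monomial ts v)" if "ts \<in> J m" for ts
        using diag_monomial[OF m V, of ts v 0] X_v[of m m 0] m that by (simp add: J_def)
    qed (use m in simp_all)
    moreover have "{ts \<in> J m. of_int (\<Sum>t\<leftarrow>ts. diag_weight m t) = (of_int (corner_weight n l m) :: complex)} = J (Suc m)"
      unfolding of_int_eq_iff J_def by (auto simp: less_Suc_eq)
    ultimately show ?case by simp
  qed
  then have "u \<in> span ((\<lambda>ts. monomial ts v) ` J n)" by simp
  moreover have "(\<lambda>ts. monomial ts v) ` J n \<subseteq> (\<lambda>p. monomial (lower l p) v) ` {p. p permutes {..<l}}"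
  proof (rule image_subsetI)
    fix ts assume ts: "ts \<in> J n"
    have "\<exists>p. p permutes {..<l} \<and> mset ts = mset (lower l p)"
    proof (rule corner_weight_monomials[OF l])
      fix t assume "t \<in> set ts"
      then have "valid t" "G.deg t < 0" using ts by (auto simp: J_def G.neg_lists_def)
      then show "fst t < n \<and> fst (snd t) < n \<and> snd (snd t) \<le> -1"
        by (cases t) (simp add: valid_def G.deg_def)
    qed (use ts in \<open>auto simp: J_def\<close>)
    then obtain p where p: "p permutes {..<l}" "mset (lower l p) = mset ts" by auto
    have "monomial (lower l p) v = monomial ts v"
      by (rule monomial_cong_mset[OF p(2)]) (rule lower_commute[OF p(1) l])
    then show "monomial ts v \<in> (\<lambda>p. monomial (lower l p) v) ` {p. p permutes {..<l}}"
      using p(1) by (metis (mono_tags) imageI mem_Collect_eq)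
  qed
  ultimately show ?thesis using span_mono by blast
qed

text \<open>By weight considerations the raising monomials dual to the lowering ones are the only ones that can lead
from this weight space out of \<open>V_neg\<close>.\<close>

lemma corner_space_nondegenerate:
  assumes l: "2 * l \<le> n" and u: "u \<in> corner_space l"
    and zero: "\<And>p. p permutes {..<l} \<Longrightarrow> monomial (raise l p) u = 0"
  shows "u = 0"
proof -
  interpret G: graded_affine_vacuum scale n k X D v 1 0 D by (rule graded_degree)
  have eig0: "e = 0" if x: "x \<notin> G.V_neg" "Z x = scale e x"
    and Z: "\<And>u w. Z (u + w) = Z u + Z w" "\<And>c u. Z (scale c u) = scale c (Z u)" "Z v = 0"
      "\<And>u. u \<in> G.V_neg \<Longrightarrow> Z u \<in> G.V_neg" for Z e x
  proof (rule ccontr)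
    assume e: "e \<noteq> 0"
    obtain c z where xz: "x = scale c v + z" "z \<in> G.V_neg" using G.V_neg_decomp by blast
    have "scale e x \<in> G.V_neg" using x(2) Z xz by (metis add_0 scale_zero_right)
    then have "scale (1 / e) (scale e x) \<in> G.V_neg" using subspace_scale[OF G.subspace_V_neg] by blast
    then show False using x(1) e by simp
  qed
  show ?thesis
  proof (rule G.vacuum_nondegenerate)
    fix ys assume ys: "\<forall>y\<in>set ys. valid y \<and> G.deg y > 0"
    then have V: "\<forall>y\<in>set ys. valid y" by blast
    show "monomial ys u \<in> G.V_neg"
    proof (rule ccontr)
      assume x: "monomial ys u \<notin> G.V_neg"
      have "D u = scale (- of_nat l) u" using u by (simp add: corner_space_def)
      from eig0[OF x D_monomial[OF V this] D_add D_scale D_v G.D_V_neg]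
      have "of_int (- int l + (\<Sum>t\<leftarrow>ys. snd (snd t))) = (0 :: complex)" by simp
      then have 1: "(\<Sum>t\<leftarrow>ys. snd (snd t)) = int l" by (simp only: of_int_eq_0_iff)
      have 2: "(\<Sum>t\<leftarrow>ys. diag_weight q t) = - corner_weight n l q" if q: "q < n" for q
      proof -
        have "X q q 0 u = scale (of_int (corner_weight n l q)) u" using u q by (simp add: corner_space_def)
        from eig0[OF x diag_monomial[OF q V this] X_add X_scale]
        have "of_int (corner_weight n l q) + of_int (\<Sum>t\<leftarrow>ys. diag_weight q t) = (0 :: complex)"
          using q X_v[of q q 0] G.op_zero_V_neg[of "(q, q, 0)"] by (simp add: valid_def G.deg_def op_def)
        then have "of_int (corner_weight n l q + (\<Sum>t\<leftarrow>ys. diag_weight q t)) = (0 :: complex)" by simp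
        then show ?thesis by (simp only: of_int_eq_0_iff)
      qed
      \<comment> \<open>Transposing the factors turns a raising monomial into a lowering one of the required weight.\<close>
      define flip :: "loop_unit \<Rightarrow> loop_unit" where "flip = (\<lambda>(i, j, a). (j, i, - a))"
      have flip: "fst (flip t) = fst (snd t)" "fst (snd (flip t)) = fst t" "snd (snd (flip t)) = - snd (snd t)"
        "flip (flip t) = t" for t by (cases t; simp add: flip_def)+
      have "\<exists>p. p permutes {..<l} \<and> mset (map flip ys) = mset (lower l p)"
      proof (rule corner_weight_monomials[OF l])
        fix t assume "t \<in> set (map flip ys)"
        then obtain y where y: "y \<in> set ys" "t = flip y" by auto
        then have "valid y" "G.deg y > 0" using ys by auto
        then show "fst t < n \<and> fst (snd t) < n \<and> snd (snd t) \<le> -1"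
          unfolding y(2) flip by (cases y) (simp add: valid_def G.deg_def)
      next
        have "(\<Sum>t\<leftarrow>map flip ys. snd (snd t)) = - (\<Sum>t\<leftarrow>ys. snd (snd t))"
          by (simp add: o_def flip uminus_sum_list_map)
        then show "(\<Sum>t\<leftarrow>map flip ys. snd (snd t)) = - int l" using 1 by simp
      next
        fix q assume q: "q < n"
        have "diag_weight q (flip t) = - diag_weight q t" for t by (simp add: diag_weight_def flip)
        then have "(\<Sum>t\<leftarrow>map flip ys. diag_weight q t) = - (\<Sum>t\<leftarrow>ys. diag_weight q t)"
          by (simp add: o_def uminus_sum_list_map)
        then show "(\<Sum>t\<leftarrow>map flip ys. diag_weight q t) = corner_weight n l q" using 2[OF q] by simp
      qed
      then obtain p where p: "p permutes {..<l}" "mset (map flip ys) = mset (lower l p)" by blast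
      have "mset (map flip (map flip ys)) = mset (map flip (lower l p))" using p(2) by (metis mset_map)
      moreover have "map flip (map flip ys) = ys" by (simp add: o_def flip)
      moreover have "map flip (lower l p) = raise l p" by (simp add: lower_def raise_def flip_def)
      ultimately have "mset (raise l p) = mset ys" by (simp only:)
      then have "monomial (raise l p) u = monomial ys u"
        by (rule monomial_cong_mset) (rule raise_commute[OF p(1) l])
      then have "monomial ys u = 0" using zero[OF p(1)] by simp
      then show False using x subspace_0[OF G.subspace_V_neg] by simp
    qed
  qed
qed

end

section \<open>Colourings, relations and independence\<close>

text \<open>The digits of a permutation in base \<open>l\<close>, complemented, so that a lexicographically larger permutation has
the smaller key.\<close>

primrec prefix_key :: "nat \<Rightarrow> (nat \<Rightarrow> nat) \<Rightarrow> nat \<Rightarrow> nat" where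
  "prefix_key l p 0 = 0"
| "prefix_key l p (Suc i) = prefix_key l p i * l + (l - 1 - p i)"

lemma prefix_key_less:
  assumes p: "p permutes {..<l}" and q: "q permutes {..<l}"
    and i: "i < l" "\<And>j. j < i \<Longrightarrow> p j = q j" "p i < q i"
  shows "prefix_key l q l < prefix_key l p l"
proof -
  have plt: "p j < l" if "j < l" for j using permutes_in_image[OF p, of j] that by simp
  have qlt: "q j < l" if "j < l" for j using permutes_in_image[OF q, of j] that by simp
  have "j \<le> i \<Longrightarrow> prefix_key l q j = prefix_key l p j" for j
    by (induction j) (use i(2) in auto)
  then have "prefix_key l q (Suc i) < prefix_key l p (Suc i)"
    using i(1,3) plt[of i] qlt[of i] by simp
  moreover have "prefix_key l q m < prefix_key l p m \<Longrightarrow> m < l \<Longrightarrow> prefix_key l q (Suc m) < prefix_key l p (Suc m)" for m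
  proof -
    assume "prefix_key l q m < prefix_key l p m" and m: "m < l"
    then have "Suc (prefix_key l q m) * l \<le> prefix_key l p m * l" by (intro mult_right_mono) auto
    then show ?thesis using qlt[OF m] by simp
  qed
  ultimately have "Suc i + d \<le> l \<Longrightarrow> prefix_key l q (Suc i + d) < prefix_key l p (Suc i + d)" for d
    by (induction d) (simp_all del: prefix_key.simps)
  from this[of "l - Suc i"] show ?thesis using i(1) by simp
qed

lemma first_difference:
  fixes p q :: "nat \<Rightarrow> nat"
  assumes "p permutes {..<l}" "q permutes {..<l}" "p \<noteq> q"
  shows "\<exists>i<l. (\<forall>j<i. p j = q j) \<and> p i \<noteq> q i"
proof -
  obtain i where i: "p i \<noteq> q i" using assms(3) by blast
  define m where "m = (LEAST i. p i \<noteq> q i)"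
  have m: "p m \<noteq> q m" unfolding m_def using i by (rule LeastI)
  moreover have "p j = q j" if "j < m" for j using not_less_Least that unfolding m_def by blast
  moreover have "m < l"
    using m assms(1,2) unfolding permutes_def by (metis lessThan_iff)
  ultimately show ?thesis by blast
qed

definition colour_pairs :: "nat \<Rightarrow> nat \<Rightarrow> (nat \<Rightarrow> nat) \<Rightarrow> (nat \<Rightarrow> nat) \<Rightarrow> (nat \<Rightarrow> nat) set" where
  "colour_pairs k l p q = {e \<in> {..<l} \<rightarrow>\<^sub>E {..<k}. \<forall>i<l. e (p i) = e (q i)}"

lemma card_colour_pairs:
  assumes p: "p permutes {..<l}" and q: "q permutes {..<l}"
  shows "card (invariant_maps k l (inv_into UNIV q \<circ> p)) = card (colour_pairs k l p q)"
proof (rule bij_betw_same_card)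
  have lt: "r i < l" if "r permutes {..<l}" "i < l" for r i
    using permutes_in_image[OF that(1), of i] that(2) by simp
  note iq = permutes_inv[OF q]
  have q1: "q (inv_into UNIV q i) = i" "inv_into UNIV q (q i) = i" for i using permutes_inverses[OF q] by simp_all
  show "bij_betw (\<lambda>d. restrict (d \<circ> inv_into UNIV q) {..<l}) (invariant_maps k l (inv_into UNIV q \<circ> p)) (colour_pairs k l p q)"
  proof (rule bij_betw_byWitness[where f' = "\<lambda>e. restrict (e \<circ> q) {..<l}"])
    show "\<forall>d\<in>invariant_maps k l (inv_into UNIV q \<circ> p). restrict (restrict (d \<circ> inv_into UNIV q) {..<l} \<circ> q) {..<l} = d"
      using lt[OF q] by (auto simp: invariant_maps_def PiE_iff extensional_def fun_eq_iff q1)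
    show "\<forall>e\<in>colour_pairs k l p q. restrict (restrict (e \<circ> q) {..<l} \<circ> inv_into UNIV q) {..<l} = e"
      using lt[OF iq] by (auto simp: colour_pairs_def PiE_iff extensional_def fun_eq_iff q1)
    show "(\<lambda>d. restrict (d \<circ> inv_into UNIV q) {..<l}) ` invariant_maps k l (inv_into UNIV q \<circ> p) \<subseteq> colour_pairs k l p q"
      using lt[OF q] lt[OF p] lt[OF iq] by (auto simp: invariant_maps_def colour_pairs_def PiE_iff q1)
    show "(\<lambda>e. restrict (e \<circ> q) {..<l}) ` colour_pairs k l p q \<subseteq> invariant_maps k l (inv_into UNIV q \<circ> p)"
      using lt[OF q] lt[OF p] lt[OF iq] by (auto simp: invariant_maps_def colour_pairs_def PiE_iff q1)
  qed
qed

lemma finite_colourings: "finite ({..<l::nat} \<rightarrow>\<^sub>E {..<k::nat})"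
  by (intro finite_PiE) auto

lemma permutation_of_permutes: "p permutes {..<l::nat} \<Longrightarrow> permutation p"
  by (auto intro: permutation_permutes[THEN iffD2])

text \<open>In the tensor power of a \<open>k\<close>-dimensional space there are no nonzero antisymmetric tensors on
\<open>Suc k\<close> positions.\<close>

lemma antisymmetrizer_vanishes:
  assumes p: "p permutes {..<l}" and I: "I \<subseteq> {..<l}" "card I = Suc k"
    and q: "q permutes {..<l}"
  shows "(\<Sum>r | r permutes I. of_int (sign r) * of_nat (card (colour_pairs k l (p \<circ> r) q))) = (0 :: complex)"
proof -
  let ?E = "{..<l} \<rightarrow>\<^sub>E {..<k}"
  have fI: "finite I" using I by (simp add: finite_subset)
  define S where "S e r = (if \<forall>i<l. e (p (r i)) = e (q i) then 1 else (0::complex))" for e :: "nat \<Rightarrow> nat" and r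
  have card: "of_nat (card (colour_pairs k l (p \<circ> r) q)) = (\<Sum>e\<in>?E. S e r)" for r
  proof -
    have "(\<Sum>e\<in>?E. S e r) = (\<Sum>e\<in>colour_pairs k l (p \<circ> r) q. 1)"
      unfolding S_def by (intro sum.mono_neutral_cong_right finite_colourings) (auto simp: colour_pairs_def)
    then show ?thesis by simp
  qed
  have zero: "(\<Sum>r | r permutes I. of_int (sign r) * S e r) = 0" if e: "e \<in> ?E" for e
  proof -
    have "\<not> inj_on (e \<circ> p) I"
    proof
      assume "inj_on (e \<circ> p) I"
      moreover have "(e \<circ> p) ` I \<subseteq> {..<k}"
        using e I(1) permutes_in_image[OF p] by (auto simp: PiE_iff)
      ultimately have "card I \<le> card {..<k}" using card_inj_on_le finite_lessThan by blast
      then show False using I(2) by simp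
    qed
    then obtain a b where ab: "a \<in> I" "b \<in> I" "a \<noteq> b" "e (p a) = e (p b)" by (auto simp: inj_on_def)
    \<comment> \<open>Two of the \<open>Suc k\<close> positions have the same colour; the transposition of these two pairs off the terms
      with opposite signs.\<close>
    let ?t = "transpose a b"
    have t: "?t permutes I" using ab by (intro permutes_swap_id)
    have S_inv: "S e (?t \<circ> r) = S e r" for r
    proof -
      have "e (p (?t x)) = e (p x)" for x using ab(4) by (cases "x = a \<or> x = b") auto
      then show ?thesis by (simp add: S_def)
    qed
    have "(\<Sum>r | r permutes I. of_int (sign r) * S e r) = (\<Sum>r | r permutes I. of_int (sign (?t \<circ> r)) * S e (?t \<circ> r))"
      by (rule setum_permutations_compose_left[OF t])
    also have "\<dots> = (\<Sum>r | r permutes I. - (of_int (sign r) * S e r))"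
    proof (rule sum.cong)
      fix r assume "r \<in> {r. r permutes I}"
      then have "permutation r" using fI by (auto simp: permutation_permutes)
      then have "sign (?t \<circ> r) = - sign r"
        using sign_compose[OF permutation_swap_id, of r a b] ab(3) by (simp add: sign_swap_id)
      then show "of_int (sign (?t \<circ> r)) * S e (?t \<circ> r) = - (of_int (sign r) * S e r)"
        by (simp add: S_inv)
    qed simp
    also have "\<dots> = - (\<Sum>r | r permutes I. of_int (sign r) * S e r)" by (rule sum_negf)
    finally show ?thesis by simp
  qed
  have "(\<Sum>r | r permutes I. of_int (sign r) * of_nat (card (colour_pairs k l (p \<circ> r) q)))
     = (\<Sum>r | r permutes I. \<Sum>e\<in>?E. of_int (sign r) * S e r)"
    by (simp add: card sum_distrib_left)
  also have "\<dots> = (\<Sum>e\<in>?E. \<Sum>r | r permutes I. of_int (sign r) * S e r)" by (rule sum.swap)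
  also have "\<dots> = 0" using zero by (intro sum.neutral) blast
  finally show ?thesis .
qed

text \<open>Up to signs, the Gram matrix is \<open>\<Sum>\<^sub>e \<Sum>\<^sub>c [e \<circ> p = c] [e \<circ> q = c]\<close> over colourings \<open>e\<close> and \<open>c\<close>, so a vector in
its kernel is annihilated by each of the functionals \<open>p \<mapsto> [e \<circ> p = c]\<close>.\<close>

lemma gram_kernel:
  fixes x :: "(nat \<Rightarrow> nat) \<Rightarrow> complex"
  assumes A: "finite A" and perms: "\<And>p. p \<in> A \<Longrightarrow> p permutes {..<l}"
    and zero: "\<And>q. q \<in> A \<Longrightarrow> (\<Sum>p\<in>A. x p * of_nat (card (colour_pairs k l p q))) = 0"
    and e: "e \<in> {..<l} \<rightarrow>\<^sub>E {..<k}" and c: "c \<in> {..<l} \<rightarrow>\<^sub>E {..<k}"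
  shows "(\<Sum>p | p \<in> A \<and> restrict (e \<circ> p) {..<l} = c. x p) = 0"
proof -
  let ?E = "{..<l} \<rightarrow>\<^sub>E {..<k}"
  define T where "T e c p = (if restrict (e \<circ> p) {..<l} = c then 1 else (0::complex))" for e c :: "nat \<Rightarrow> nat" and p
  define S where "S e c = (\<Sum>p\<in>A. x p * T e c p)" for e c
  have mem: "restrict (e \<circ> p) {..<l} \<in> ?E" if "e \<in> ?E" "p \<in> A" for e p
    using that permutes_in_image[OF perms[OF that(2)]] by (auto simp: PiE_iff)
  have card: "of_nat (card (colour_pairs k l p q)) = (\<Sum>e\<in>?E. \<Sum>c\<in>?E. T e c p * T e c q)"
    if "p \<in> A" "q \<in> A" for p q
  proof -
    have "(\<Sum>c\<in>?E. T e c p * T e c q) = (if \<forall>i<l. e (p i) = e (q i) then 1 else 0)" if e: "e \<in> ?E" for e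
    proof -
      have "(\<Sum>c\<in>?E. T e c p * T e c q)
         = (\<Sum>c\<in>?E. if c = restrict (e \<circ> p) {..<l} then T e (restrict (e \<circ> p) {..<l}) q else 0)"
        by (intro sum.cong) (auto simp: T_def)
      also have "\<dots> = T e (restrict (e \<circ> p) {..<l}) q"
        using mem[OF e \<open>p \<in> A\<close>] finite_colourings[of l k] by simp
      also have "\<dots> = (if \<forall>i<l. e (p i) = e (q i) then 1 else 0)"
      proof -
        have "restrict (e \<circ> q) {..<l} = restrict (e \<circ> p) {..<l} \<longleftrightarrow> (\<forall>i<l. e (p i) = e (q i))"
          by (auto simp: restrict_def fun_eq_iff)
        then show ?thesis by (simp add: T_def)
      qed
      finally show ?thesis .
    qed
    then have "(\<Sum>e\<in>?E. \<Sum>c\<in>?E. T e c p * T e c q) = (\<Sum>e\<in>?E. if \<forall>i<l. e (p i) = e (q i) then 1 else 0)"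
      by (intro sum.cong) auto
    also have "\<dots> = (\<Sum>e\<in>colour_pairs k l p q. 1)"
      by (intro sum.mono_neutral_cong_right finite_colourings) (auto simp: colour_pairs_def)
    finally show ?thesis by simp
  qed
  have cnjT: "cnj (T e c p) = T e c p" for e c p by (simp add: T_def)
  have "0 = (\<Sum>q\<in>A. cnj (x q) * (\<Sum>p\<in>A. x p * of_nat (card (colour_pairs k l p q))))"
    using zero by simp
  also have "\<dots> = (\<Sum>q\<in>A. \<Sum>p\<in>A. \<Sum>e\<in>?E. \<Sum>c\<in>?E. (x p * T e c p) * cnj (x q * T e c q))"
    by (simp add: card sum_distrib_left cnjT mult_ac cong: sum.cong)
  also have "\<dots> = (\<Sum>q\<in>A. \<Sum>e\<in>?E. \<Sum>p\<in>A. \<Sum>c\<in>?E. (x p * T e c p) * cnj (x q * T e c q))"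
    by (rule sum.cong[OF refl], rule sum.swap)
  also have "\<dots> = (\<Sum>e\<in>?E. \<Sum>q\<in>A. \<Sum>p\<in>A. \<Sum>c\<in>?E. (x p * T e c p) * cnj (x q * T e c q))"
    by (rule sum.swap)
  also have "\<dots> = (\<Sum>e\<in>?E. \<Sum>c\<in>?E. S e c * cnj (S e c))"
  proof (rule sum.cong[OF refl])
    fix e
    have "(\<Sum>q\<in>A. \<Sum>p\<in>A. \<Sum>c\<in>?E. (x p * T e c p) * cnj (x q * T e c q)) = (\<Sum>q\<in>A. \<Sum>c\<in>?E. \<Sum>p\<in>A. (x p * T e c p) * cnj (x q * T e c q))"
      by (rule sum.cong[OF refl], rule sum.swap)
    also have "\<dots> = (\<Sum>c\<in>?E. \<Sum>q\<in>A. \<Sum>p\<in>A. (x p * T e c p) * cnj (x q * T e c q))" by (rule sum.swap)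
    also have "\<dots> = (\<Sum>c\<in>?E. \<Sum>p\<in>A. \<Sum>q\<in>A. (x p * T e c p) * cnj (x q * T e c q))"
      by (rule sum.cong[OF refl], rule sum.swap)
    also have "\<dots> = (\<Sum>c\<in>?E. S e c * cnj (S e c))"
      by (simp only: S_def cnj_sum sum_product)
    finally show "(\<Sum>q\<in>A. \<Sum>p\<in>A. \<Sum>c\<in>?E. (x p * T e c p) * cnj (x q * T e c q)) = (\<Sum>c\<in>?E. S e c * cnj (S e c))" .
  qed
  also have "\<dots> = of_real (\<Sum>e\<in>?E. \<Sum>c\<in>?E. (cmod (S e c))\<^sup>2)"
    by (simp only: of_real_sum complex_norm_square)
  finally have "complex_of_real (\<Sum>e\<in>?E. \<Sum>c\<in>?E. (cmod (S e c))\<^sup>2) = 0" by (rule sym)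
  then have "(\<Sum>e\<in>?E. \<Sum>c\<in>?E. (cmod (S e c))\<^sup>2) = 0" by (simp only: of_real_eq_0_iff)
  moreover have "0 \<le> (\<Sum>c\<in>?E. (cmod (S e c))\<^sup>2)" for e by (rule sum_nonneg) simp
  ultimately have "(\<Sum>c\<in>?E. (cmod (S e c))\<^sup>2) = 0"
    by (rule sum_nonneg_0[OF finite_colourings _ _ e, rotated])
  then have "(cmod (S e c))\<^sup>2 = 0"
    by (rule sum_nonneg_0[OF finite_colourings _ _ c, rotated]) simp
  then have "S e c = 0" by simp
  moreover have "S e c = (\<Sum>p | p \<in> A \<and> restrict (e \<circ> p) {..<l} = c. x p)"
    unfolding S_def T_def by (intro sum.mono_neutral_cong_right A) auto
  ultimately show ?thesis by simp
qed

text \<open>For a permutation \<open>r\<close> that is decreasing on the classes of \<open>c\<close>, the functional belonging to \<open>c\<close> and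
\<open>e = c \<circ> r\<inverse>\<close> is 1 at \<open>r\<close> and vanishes at all permutations lexicographically after \<open>r\<close>: the system is
triangular.\<close>

lemma colourable_independent:
  fixes x :: "(nat \<Rightarrow> nat) \<Rightarrow> complex"
  assumes A: "finite A" and perms: "\<And>p. p \<in> A \<Longrightarrow> p permutes {..<l}"
    and col: "\<And>p. p \<in> A \<Longrightarrow> \<exists>c. (\<forall>i<l. c i < k) \<and> (\<forall>j<l. \<forall>i<j. c i = c j \<longrightarrow> p j < p i)"
    and zero: "\<And>q. q \<in> A \<Longrightarrow> (\<Sum>p\<in>A. x p * of_nat (card (colour_pairs k l p q))) = 0"
    and p: "p \<in> A"
  shows "x p = 0"
proof (rule ccontr)
  assume "x p \<noteq> 0"
  let ?B = "{p \<in> A. x p \<noteq> 0}"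
  have B: "finite ?B" "?B \<noteq> {}" using A p \<open>x p \<noteq> 0\<close> by auto
  \<comment> \<open>Among the permutations with nonzero coefficient take the lexicographically first one. Any other
    permutation with the same colour statistics comes earlier, because on each colour class the chosen one
    is decreasing.\<close>
  obtain r where r: "r \<in> ?B" "\<And>p. p \<in> ?B \<Longrightarrow> prefix_key l p l \<le> prefix_key l r l"
  proof -
    have "Max ((\<lambda>p. prefix_key l p l) ` ?B) \<in> (\<lambda>p. prefix_key l p l) ` ?B" using B by (intro Max_in) auto
    then obtain r where "r \<in> ?B" "Max ((\<lambda>p. prefix_key l p l) ` ?B) = prefix_key l r l" by blast
    then show ?thesis using that[of r] Max_ge[of "(\<lambda>p. prefix_key l p l) ` ?B"] B(1) by auto
  qed
  have rA: "r \<in> A" "x r \<noteq> 0" using r by auto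
  note rp = perms[OF rA(1)]
  obtain c where c: "\<And>i. i < l \<Longrightarrow> c i < k" "\<And>i j. j < l \<Longrightarrow> i < j \<Longrightarrow> c i = c j \<Longrightarrow> r j < r i"
    using col[OF rA(1)] by blast
  define e where "e = restrict (c \<circ> inv_into UNIV r) {..<l}"
  define c' where "c' = restrict c {..<l}"
  have lt: "q i < l" if "q permutes {..<l}" "i < l" for q i
    using permutes_in_image[OF that(1), of i] that(2) by simp
  have er: "e (r i) = c i" if "i < l" for i
    using lt[OF rp that] permutes_inverses(2)[OF rp, of i] by (simp add: e_def)
  have "{p. p \<in> A \<and> restrict (e \<circ> p) {..<l} = c' \<and> x p \<noteq> 0} = {r}"
  proof (intro equalityI subsetI)
    fix q assume "q \<in> {p. p \<in> A \<and> restrict (e \<circ> p) {..<l} = c' \<and> x p \<noteq> 0}"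
    then have q: "q \<in> A" "restrict (e \<circ> q) {..<l} = c'" "x q \<noteq> 0" by auto
    note qp = perms[OF q(1)]
    have eq: "e (q i) = c i" if "i < l" for i
      using fun_cong[OF q(2), of i] that by (simp add: c'_def)
    have "q = r"
    proof (rule ccontr)
      assume "q \<noteq> r"
      then obtain i where i: "i < l" "\<And>j. j < i \<Longrightarrow> q j = r j" "q i \<noteq> r i"
        using first_difference[OF qp rp] by blast
      define j where "j = inv_into UNIV r (q i)"
      have rj: "r j = q i" unfolding j_def by (rule permutes_inverses(1)[OF rp])
      have jl: "j < l" unfolding j_def using lt[OF permutes_inv[OF rp] lt[OF qp i(1)]] .
      have "c j = c i" using er[OF jl] rj eq[OF i(1)] by simp
      have "\<not> j < i"
      proof
        assume "j < i"
        then have "q j = q i" using i(2) rj by simp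
        then show False using permutes_inj[OF qp] \<open>j < i\<close> by (simp add: inj_eq)
      qed
      moreover have "j \<noteq> i" using rj i(3) by auto
      ultimately have "i < j" by simp
      then have "q i < r i" using c(2)[OF jl] \<open>c j = c i\<close> rj by simp
      then have "prefix_key l r l < prefix_key l q l"
        by (intro prefix_key_less[OF qp rp i(1)]) (use i(2) in auto)
      then show False using r(2)[of q] q by simp
    qed
    then show "q \<in> {r}" by simp
  next
    fix q assume "q \<in> {r}"
    then show "q \<in> {p. p \<in> A \<and> restrict (e \<circ> p) {..<l} = c' \<and> x p \<noteq> 0}"
      using rA er by (auto simp: c'_def)
  qed
  moreover have "(\<Sum>p | p \<in> A \<and> restrict (e \<circ> p) {..<l} = c'. x p)
     = (\<Sum>p | p \<in> A \<and> restrict (e \<circ> p) {..<l} = c' \<and> x p \<noteq> 0. x p)"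
    using A by (intro sum.mono_neutral_cong_right) auto
  moreover have "e \<in> {..<l} \<rightarrow>\<^sub>E {..<k}"
    using c(1) lt[OF permutes_inv[OF rp]] by (auto simp: e_def)
  moreover have "c' \<in> {..<l} \<rightarrow>\<^sub>E {..<k}" using c(1) by (auto simp: c'_def)
  ultimately show False using gram_kernel[OF A perms zero, of e c'] rA(2) by simp
qed

context affine_vacuum
begin

abbreviation low_vec :: "nat \<Rightarrow> (nat \<Rightarrow> nat) \<Rightarrow> 'v" where
  "low_vec l p \<equiv> monomial (lower l p) v"

lemma raise_lower:
  assumes l: "2 * l \<le> n" and p: "p permutes {..<l}" and q: "q permutes {..<l}"
  shows "monomial (raise l q) (low_vec l p)
    = scale (of_int (sign q) * of_int (sign p) * of_nat (card (colour_pairs k l p q))) v"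
proof -
  have lt: "q i < l" if "i < l" for i using permutes_in_image[OF q, of i] that by simp
  have comp: "(inv_into UNIV q \<circ> p) permutes {..<l}" by (rule permutes_compose[OF p permutes_inv[OF q]])
  have eq: "(\<lambda>i. (i, n - l + q ((inv_into UNIV q \<circ> p) i), -1::int)) = (\<lambda>i. (i, n - l + p i, -1))"
    by (simp only: o_apply permutes_inverses(1)[OF q])
  have "monomial (map (\<lambda>i. (n - l + q i, i, 1)) [0..<l])
      (monomial (map (\<lambda>i. (i, n - l + q ((inv_into UNIV q \<circ> p) i), -1)) [0..<l]) v)
     = scale (signed_colourings k l (inv_into UNIV q \<circ> p)) v"
  proof (rule gram[where f = "\<lambda>i. i" and g = "\<lambda>i. n - l + q i", OF _ _ _ _ _ comp])
    show "inj_on (\<lambda>i. n - l + q i) {..<l}"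
      by (rule inj_onI) (metis add_left_cancel injD permutes_inj[OF q])
    show "n - l + q i < n" if "i < l" for i using lt[OF that] l by simp
  qed (use l in auto)
  moreover have "sign (inv_into UNIV q \<circ> p) = sign q * sign p"
    using sign_compose[of "inv_into UNIV q" p] sign_inverse[of q] permutation_of_permutes[OF p]
      permutation_of_permutes[OF q] permutation_of_permutes[OF permutes_inv[OF q]] by simp
  ultimately show ?thesis
    unfolding raise_def lower_def eq signed_colourings_def card_colour_pairs[OF p q] by simp
qed

lemma monomial_sum:
  assumes "\<forall>t\<in>set ts. valid t"
  shows "monomial ts (\<Sum>i\<in>A. f i) = (\<Sum>i\<in>A. monomial ts (f i))"
  by (induction A rule: infinite_finite_induct) (auto simp: monomial_0[OF assms] monomial_add[OF assms])

text \<open>The trace of integrability in this weight space: \<open>Suc k\<close> commuting factors, symmetrized, kill \<open>v\<close>. It is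
read off from the Gram matrix, which determines the lowered vectors.\<close>

lemma antisymmetric_relation:
  assumes l: "2 * l \<le> n" and p: "p permutes {..<l}" and I: "I \<subseteq> {..<l}" "card I = Suc k"
  shows "(\<Sum>r | r permutes I. low_vec l (p \<circ> r)) = 0"
proof (rule corner_space_nondegenerate[OF l])
  have r: "(p \<circ> r) permutes {..<l}" if "r permutes I" for r
    by (rule permutes_compose[OF permutes_subset[OF that I(1)] p])
  show "(\<Sum>r | r permutes I. low_vec l (p \<circ> r)) \<in> corner_space l"
    by (rule subspace_sum[OF subspace_corner_space]) (use r lower_in_corner_space l in blast)
  fix q assume q: "q permutes {..<l}"
  have "monomial (raise l q) (\<Sum>r | r permutes I. low_vec l (p \<circ> r))
      = (\<Sum>r | r permutes I. monomial (raise l q) (low_vec l (p \<circ> r)))"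
    by (rule monomial_sum) (use raise_valid[OF q l] in blast)
  also have "\<dots> = (\<Sum>r | r permutes I. scale (of_int (sign q) * of_int (sign p)
       * (of_int (sign r) * of_nat (card (colour_pairs k l (p \<circ> r) q)))) v)"
  proof (rule sum.cong)
    fix s assume "s \<in> {r. r permutes I}"
    then have s: "s permutes I" by simp
    have "permutation s" unfolding permutation_permutes using s finite_subset[OF I(1)] by blast
    then have "sign (p \<circ> s) = sign p * sign s" using permutation_of_permutes[OF p] sign_compose by blast
    then show "monomial (raise l q) (low_vec l (p \<circ> s)) = scale (of_int (sign q) * of_int (sign p)
       * (of_int (sign s) * of_nat (card (colour_pairs k l (p \<circ> s) q)))) v"
      unfolding raise_lower[OF l r[OF s] q] by (simp add: mult_ac)
  qed simp
  also have "\<dots> = scale (of_int (sign q) * of_int (sign p)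
      * (\<Sum>r | r permutes I. of_int (sign r) * of_nat (card (colour_pairs k l (p \<circ> r) q)))) v"
    by (simp add: scale_sum_left sum_distrib_left)
  also have "\<dots> = 0" using antisymmetrizer_vanishes[OF p I q] by simp
  finally show "monomial (raise l q) (\<Sum>r | r permutes I. low_vec l (p \<circ> r)) = 0" .
qed

text \<open>The antisymmetry relation on an increasing sequence of length \<open>Suc k\<close> rewrites the permutation in terms of
lexicographically larger ones; the permutations to which this does not apply are colourable, hence give
independent vectors.\<close>

lemma dim_corner_space:
  assumes l: "2 * l \<le> n"
    and A: "A \<subseteq> {p. p permutes {..<l}}"
    and col: "\<And>p. p \<in> A \<Longrightarrow> \<exists>c. (\<forall>i<l. c i < k) \<and> (\<forall>j<l. \<forall>i<j. c i = c j \<longrightarrow> p j < p i)"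
    and incr: "\<And>p. p permutes {..<l} \<Longrightarrow> p \<notin> A \<Longrightarrow>
      \<exists>I. I \<subseteq> {..<l} \<and> card I = Suc k \<and> (\<forall>i\<in>I. \<forall>j\<in>I. i < j \<longrightarrow> p i < p j)"
  shows "dim (corner_space l) = card A"
proof -
  have finA: "finite A" using A finite_permutations[of "{..<l}"] finite_subset by blast
  have perms: "p permutes {..<l}" if "p \<in> A" for p using A that by blast
  have indep: "x p = 0" if x: "(\<Sum>p\<in>A. scale (x p) (low_vec l p)) = 0" and p: "p \<in> A" for x p
  proof -
    have "(\<Sum>p\<in>A. (x p * of_int (sign p)) * of_nat (card (colour_pairs k l p q))) = 0" if q: "q \<in> A" for q
    proof -
      note qp = perms[OF q]
      have V: "\<forall>t\<in>set (raise l q). valid t" using raise_valid[OF qp l] by blast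
      have "0 = monomial (raise l q) (\<Sum>p\<in>A. scale (x p) (low_vec l p))"
        unfolding x using monomial_0[OF V] by simp
      also have "\<dots> = (\<Sum>p\<in>A. scale (x p) (monomial (raise l q) (low_vec l p)))"
        by (simp add: monomial_sum[OF V] monomial_scale[OF V])
      also have "\<dots> = (\<Sum>p\<in>A. scale (of_int (sign q) * ((x p * of_int (sign p)) * of_nat (card (colour_pairs k l p q)))) v)"
        by (intro sum.cong refl) (simp add: raise_lower[OF l perms qp] mult_ac)
      also have "\<dots> = scale (of_int (sign q) * (\<Sum>p\<in>A. (x p * of_int (sign p)) * of_nat (card (colour_pairs k l p q)))) v"
        by (simp add: scale_sum_left sum_distrib_left)
      finally show ?thesis using v_nonzero by (simp add: sign_def split: if_splits)
    qed
    then have "x p * of_int (sign p) = 0"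
      using colourable_independent[OF finA perms col _ p, of "\<lambda>p. x p * of_int (sign p)"] by blast
    then show ?thesis by (simp add: sign_def split: if_splits)
  qed
  have inj: "inj_on (low_vec l) A"
  proof (rule inj_onI)
    fix p q assume pq: "p \<in> A" "q \<in> A" "low_vec l p = low_vec l q"
    show "p = q"
    proof (rule ccontr)
      assume ne: "p \<noteq> q"
      define x where "x r = (if r = p then 1 else if r = q then -1 else (0::complex))" for r
      have "(\<Sum>r\<in>A. scale (x r) (low_vec l r)) = (\<Sum>r\<in>{p, q}. scale (x r) (low_vec l r))"
        using finA pq by (intro sum.mono_neutral_right) (auto simp: x_def)
      also have "\<dots> = 0" using ne pq(3) by (simp add: x_def)
      finally have "x p = 0" using indep pq(1) by blast
      then show False by (simp add: x_def)
    qed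
  qed
  have ind: "independent (low_vec l ` A)"
  proof
    assume "dependent (low_vec l ` A)"
    then obtain u where u: "\<exists>w\<in>low_vec l ` A. u w \<noteq> 0" "(\<Sum>w\<in>low_vec l ` A. scale (u w) w) = 0"
      using dependent_finite[of "low_vec l ` A"] finA by auto
    have "(\<Sum>p\<in>A. scale (u (low_vec l p)) (low_vec l p)) = 0"
      using u(2) by (simp add: sum.reindex[OF inj])
    from indep[OF this] u(1) show False by blast
  qed
  have low_span: "low_vec l p \<in> span (low_vec l ` A)" if "p permutes {..<l}" for p
    using that
  proof (induction "prefix_key l p l" arbitrary: p rule: less_induct)
    case less
    show ?case
    proof (cases "p \<in> A")
      case True
      then show ?thesis by (auto intro: span_base)
    next
      case False
      then obtain I where I: "I \<subseteq> {..<l}" "card I = Suc k" "\<And>i j. i \<in> I \<Longrightarrow> j \<in> I \<Longrightarrow> i < j \<Longrightarrow> p i < p j"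
        using incr[OF less.prems] by blast
      have fI: "finite I" using I(1) finite_subset by blast
      have "low_vec l (p \<circ> r) \<in> span (low_vec l ` A)" if r: "r permutes I" "r \<noteq> id" for r
      proof -
        note rl = permutes_subset[OF r(1) I(1)]
        have pr: "(p \<circ> r) permutes {..<l}" by (rule permutes_compose[OF rl less.prems])
        obtain i where i: "i < l" "\<And>j. j < i \<Longrightarrow> r j = j" "r i \<noteq> i"
          using first_difference[OF rl permutes_id r(2)] by auto
        have iI: "i \<in> I" using r(1) i(3) by (auto simp: permutes_def)
        have "\<not> r i < i"
        proof
          assume "r i < i"
          then have "r (r i) = r i" using i(2) by blast
          then show False using permutes_inj[OF r(1)] i(3) by (simp add: inj_eq)
        qed
        then have "p i < p (r i)" using i(3) I(3)[of i "r i"] iI permutes_in_image[OF r(1), of i] by simp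
        then have "prefix_key l (p \<circ> r) l < prefix_key l p l"
          by (intro prefix_key_less[OF less.prems pr i(1)]) (use i(2) in auto)
        then show ?thesis using less.hyps pr by blast
      qed
      then have rest: "(\<Sum>r\<in>{r. r permutes I} - {id}. low_vec l (p \<circ> r)) \<in> span (low_vec l ` A)"
        by (intro span_sum) auto
      have "(\<Sum>r | r permutes I. low_vec l (p \<circ> r))
         = low_vec l (p \<circ> id) + (\<Sum>r\<in>{r. r permutes I} - {id}. low_vec l (p \<circ> r))"
        using finite_permutations[OF fI] permutes_id[of I] by (intro sum.remove) auto
      then have "low_vec l p + (\<Sum>r\<in>{r. r permutes I} - {id}. low_vec l (p \<circ> r)) = 0"
        using antisymmetric_relation[OF l less.prems I(1,2)] by simp
      then have "low_vec l p = - (\<Sum>r\<in>{r. r permutes I} - {id}. low_vec l (p \<circ> r))"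
        by (simp add: add_eq_0_iff2)
      then show ?thesis using span_neg[OF rest] by simp
    qed
  qed
  have "corner_space l = span (low_vec l ` A)"
  proof
    have "span (low_vec l ` {p. p permutes {..<l}}) \<subseteq> span (low_vec l ` A)"
      by (rule span_minimal) (use low_span in auto)
    then show "corner_space l \<subseteq> span (low_vec l ` A)" using corner_space_spanned[OF l] by blast
    show "span (low_vec l ` A) \<subseteq> corner_space l"
      by (rule span_minimal[OF _ subspace_corner_space]) (use lower_in_corner_space l perms in blast)
  qed
  then have "dim (corner_space l) = card (low_vec l ` A)"
    using dim_span_eq_card_independent[OF ind] by simp
  then show ?thesis using card_image[OF inj] by simp
qed

end

section \<open>The action of the affine algebra by matrix units\<close>

definition traceless_unit :: "nat \<Rightarrow> nat \<Rightarrow> nat \<Rightarrow> complex mat" where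
  "traceless_unit n i j = mat n n (\<lambda>(r, s). (if r = i \<and> s = j then 1 else 0)
      - (if i = j \<and> r = s then 1 / of_nat n else 0))"

lemma traceless_unit_carrier [simp]: "traceless_unit n i j \<in> carrier_mat n n"
  by (simp add: traceless_unit_def)

lemma traceless_unit_dim [simp]: "dim_row (traceless_unit n i j) = n" "dim_col (traceless_unit n i j) = n"
  by (simp_all add: traceless_unit_def)

lemma traceless_unit_index: "r < n \<Longrightarrow> s < n \<Longrightarrow> traceless_unit n i j $$ (r, s)
   = (if r = i \<and> s = j then 1 else 0) - (if i = j \<and> r = s then 1 / of_nat n else 0)"
  by (simp add: traceless_unit_def)

lemma mat_trace_mat: "mat_trace (mat n n f) = (\<Sum>i<n. f (i, i))"
  by (simp add: mat_trace_def)

lemma traceless_unit_trace: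
  assumes "i < n" "j < n"
  shows "mat_trace (traceless_unit n i j) = 0"
proof -
  have "mat_trace (traceless_unit n i j)
      = (\<Sum>r<n. (if r = i then (if i = j then 1 else 0) else 0) - (if i = j then 1 / of_nat n else 0))"
    unfolding traceless_unit_def mat_trace_mat by (intro sum.cong) auto
  then show ?thesis using assms by (simp add: sum_subtractf)
qed

lemma traceless_unit_mult:
  assumes "i < n" "j < n" "p < n" "q < n" "r < n" "s < n"
  defines "al \<equiv> (if i = j then 1 / of_nat n else 0 :: complex)"
    and "be \<equiv> (if p = q then 1 / of_nat n else 0 :: complex)"
  shows "(traceless_unit n i j * traceless_unit n p q) $$ (r, s)
    = (if r = i \<and> j = p \<and> s = q then 1 else 0) - al * (if r = p \<and> s = q then 1 else 0)
      - be * (if r = i \<and> s = j then 1 else 0) + al * be * (if r = s then 1 else 0)"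
proof -
  have "(traceless_unit n i j * traceless_unit n p q) $$ (r, s)
     = (\<Sum>t<n. traceless_unit n i j $$ (r, t) * traceless_unit n p q $$ (t, s))"
    using assms(5,6) by (simp add: scalar_prod_def atLeast0LessThan)
  also have "\<dots> = (\<Sum>t<n. (if t = j then (if r = i \<and> j = p \<and> s = q then 1 else 0) else 0)
      - (if t = r then al * (if r = p \<and> s = q then 1 else 0) else 0)
      - (if t = j then be * (if r = i \<and> s = j then 1 else 0) else 0)
      + (if t = r then al * be * (if r = s then 1 else 0) else 0))"
    using assms(5,6) by (intro sum.cong refl) (auto simp: traceless_unit_index al_def be_def algebra_simps)
  finally show ?thesis using assms(1-6) by (simp add: sum.distrib sum_subtractf)
qed

lemma traceless_unit_commutator:
  assumes "i < n" "j < n" "p < n" "q < n"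
  shows "traceless_unit n i j * traceless_unit n p q - traceless_unit n p q * traceless_unit n i j
    = (if j = p then traceless_unit n i q else 0\<^sub>m n n) - (if q = i then traceless_unit n p j else 0\<^sub>m n n)"
    (is "?L = ?R")
proof (rule eq_matI)
  fix r s assume "r < dim_row ?R" "s < dim_col ?R"
  then have rs: "r < n" "s < n" by (auto split: if_splits)
  have "?L $$ (r, s) = (if r = i \<and> j = p \<and> s = q then 1 else 0) - (if r = p \<and> q = i \<and> s = j then 1 else 0)"
    using rs by (simp add: traceless_unit_mult[OF assms rs] traceless_unit_mult[OF assms(3,4,1,2) rs] mult.commute
        del: index_mult_mat(1))
  also have "\<dots> = ?R $$ (r, s)" using rs by (auto simp: traceless_unit_index)
  finally show "?L $$ (r, s) = ?R $$ (r, s)" .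
qed auto

lemma traceless_unit_form:
  assumes "i < n" "j < n" "p < n" "q < n"
  shows "mat_trace (traceless_unit n i j * traceless_unit n p q)
    = (if j = p \<and> i = q then 1 else 0) - (if i = j \<and> p = q then 1 / of_nat n else 0)"
proof -
  define al where "al = (if i = j then 1 / of_nat n else 0 :: complex)"
  define be where "be = (if p = q then 1 / of_nat n else 0 :: complex)"
  have "mat_trace (traceless_unit n i j * traceless_unit n p q)
     = (\<Sum>r<n. (if r = i then (if j = p \<and> i = q then 1 else 0) else 0)
         - (if r = p then al * (if p = q then 1 else 0) else 0)
         - (if r = i then be * (if i = j then 1 else 0) else 0) + al * be)"
    unfolding mat_trace_def
    by (intro sum.cong) (auto simp: traceless_unit_mult[OF assms] al_def be_def simp del: index_mult_mat(1))
  also have "\<dots> = (if j = p \<and> i = q then 1 else 0) - al * (if p = q then 1 else 0)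
      - be * (if i = j then 1 else 0) + of_nat n * (al * be)"
    using assms by (simp add: sum.distrib sum_subtractf)
  also have "\<dots> = (if j = p \<and> i = q then 1 else 0) - (if i = j \<and> p = q then 1 / of_nat n else 0)"
    using assms(1) by (auto simp: al_def be_def)
  finally show ?thesis .
qed

lemma affine_eqI: "(\<And>m. loop_part x m = loop_part y m) \<Longrightarrow> c_part x = c_part y \<Longrightarrow> d_part x = d_part y \<Longrightarrow> x = y"
  by (rule affine.expand) auto

lemma affine_parts [simp]:
  "loop_part (affine_add x y) m = loop_part x m + loop_part y m"
  "c_part (affine_add x y) = c_part x + c_part y"
  "d_part (affine_add x y) = d_part x + d_part y"
  "loop_part (affine_smult s x) m = s \<cdot>\<^sub>m loop_part x m"
  "c_part (affine_smult s x) = s * c_part x"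
  "d_part (affine_smult s x) = s * d_part x"
  "loop_part (tensor_t n A p) m = (if m = p then A else 0\<^sub>m n n)"
  "c_part (tensor_t n A p) = 0" "d_part (tensor_t n A p) = 0"
  "loop_part (central_c n) m = 0\<^sub>m n n" "c_part (central_c n) = 1" "d_part (central_c n) = 0"
  "loop_part (deriv_d n) m = 0\<^sub>m n n" "c_part (deriv_d n) = 0" "d_part (deriv_d n) = 1"
  by (simp_all add: affine_add_def affine_smult_def tensor_t_def central_c_def deriv_d_def)

lemma mat_trace_zero [simp]: "mat_trace (0\<^sub>m n n) = 0"
  by (simp add: mat_trace_def)

lemma mat_trace_add: "A \<in> carrier_mat n n \<Longrightarrow> B \<in> carrier_mat n n \<Longrightarrow> mat_trace (A + B) = mat_trace A + mat_trace B"
  by (simp add: mat_trace_def sum.distrib)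

lemma mat_trace_minus: "A \<in> carrier_mat n n \<Longrightarrow> B \<in> carrier_mat n n \<Longrightarrow> mat_trace (A - B) = mat_trace A - mat_trace B"
  by (simp add: mat_trace_def sum_subtractf)

lemma mat_trace_smult: "A \<in> carrier_mat n n \<Longrightarrow> mat_trace (s \<cdot>\<^sub>m A) = s * mat_trace A"
  by (simp add: mat_trace_def sum_distrib_left)

lemma tensor_in_affine_sl:
  assumes "A \<in> carrier_mat n n" "mat_trace A = 0"
  shows "tensor_t n A m \<in> affine_sl n"
proof -
  have "{p. (if p = m then A else 0\<^sub>m n n) \<noteq> 0\<^sub>m n n} \<subseteq> {m}" by auto
  then have "finite {p. (if p = m then A else 0\<^sub>m n n) \<noteq> 0\<^sub>m n n}" by (rule finite_subset) simp
  then show ?thesis using assms by (simp add: affine_sl_def)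
qed

lemma central_in_affine_sl: "central_c n \<in> affine_sl n"
  and deriv_in_affine_sl: "deriv_d n \<in> affine_sl n"
  by (simp_all add: affine_sl_def)

lemma affine_add_in_affine_sl:
  assumes "x \<in> affine_sl n" "y \<in> affine_sl n"
  shows "affine_add x y \<in> affine_sl n"
proof -
  have "finite ({m. loop_part x m \<noteq> 0\<^sub>m n n} \<union> {m. loop_part y m \<noteq> 0\<^sub>m n n})"
    using assms by (simp add: affine_sl_def)
  then have "finite {m. loop_part x m + loop_part y m \<noteq> 0\<^sub>m n n}"
    by (rule rev_finite_subset) auto
  then show ?thesis using assms by (auto simp: affine_sl_def mat_trace_add[of _ n])
qed

lemma affine_smult_in_affine_sl:
  assumes "x \<in> affine_sl n"
  shows "affine_smult s x \<in> affine_sl n"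
proof -
  have "finite {m. s \<cdot>\<^sub>m loop_part x m \<noteq> 0\<^sub>m n n}"
    by (rule finite_subset[of _ "{m. loop_part x m \<noteq> 0\<^sub>m n n}"]) (use assms in \<open>auto simp: affine_sl_def\<close>)
  then show ?thesis using assms by (auto simp: affine_sl_def mat_trace_smult[of _ n])
qed

lemma bracket_tensor:
  assumes A: "A \<in> carrier_mat n n" and B: "B \<in> carrier_mat n n"
  shows "affine_bracket n (tensor_t n A p) (tensor_t n B q)
    = affine_add (tensor_t n (A * B - B * A) (p + q))
        (affine_smult (if p + q = 0 then of_int p * mat_trace (A * B) else 0) (central_c n))"
proof (rule affine_eqI)
  let ?S = "{r. (if r = p then A else 0\<^sub>m n n) \<noteq> 0\<^sub>m n n}"
  have S: "?S = (if A = 0\<^sub>m n n then {} else {p})" by auto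
  have zero: "0\<^sub>m n n * C = 0\<^sub>m n n" "C * 0\<^sub>m n n = 0\<^sub>m n n" if "C \<in> carrier_mat n n" for C
    using that by auto
  fix m
  show "loop_part (affine_bracket n (tensor_t n A p) (tensor_t n B q)) m
    = loop_part (affine_add (tensor_t n (A * B - B * A) (p + q))
        (affine_smult (if p + q = 0 then of_int p * mat_trace (A * B) else 0) (central_c n))) m"
    (is "?L = ?R")
  proof (rule eq_matI)
    fix i j assume "i < dim_row ?R" "j < dim_col ?R"
    then have ij: "i < n" "j < n" using A B by (auto split: if_splits)
    have Y: "(if m - p = q then B else 0\<^sub>m n n) \<in> carrier_mat n n" using B by simp
    have "?L $$ (i, j) = (\<Sum>r\<in>?S. ((if r = p then A else 0\<^sub>m n n) * (if m - r = q then B else 0\<^sub>m n n)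
         - (if m - r = q then B else 0\<^sub>m n n) * (if r = p then A else 0\<^sub>m n n)) $$ (i, j))"
      using ij by (simp add: affine_bracket_def Let_def)
    also have "\<dots> = (A * (if m - p = q then B else 0\<^sub>m n n) - (if m - p = q then B else 0\<^sub>m n n) * A) $$ (i, j)"
      unfolding S using zero[OF Y] ij by auto
    also have "\<dots> = ?R $$ (i, j)" using A B ij zero[OF A] by auto
    finally show "?L $$ (i, j) = ?R $$ (i, j)" .
  qed (use A B in \<open>auto simp: affine_bracket_def Let_def\<close>)
  have "c_part (affine_bracket n (tensor_t n A p) (tensor_t n B q))
      = (\<Sum>r\<in>?S. of_int r * mat_trace ((if r = p then A else 0\<^sub>m n n) * (if - r = q then B else 0\<^sub>m n n)))"
    by (simp add: affine_bracket_def Let_def)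
  also have "\<dots> = of_int p * mat_trace (A * (if - p = q then B else 0\<^sub>m n n))"
    unfolding S using zero B by (auto split: if_splits)
  also have "\<dots> = (if p + q = 0 then of_int p * mat_trace (A * B) else 0)"
    using zero[OF A] by auto
  finally show "c_part (affine_bracket n (tensor_t n A p) (tensor_t n B q))
    = c_part (affine_add (tensor_t n (A * B - B * A) (p + q))
        (affine_smult (if p + q = 0 then of_int p * mat_trace (A * B) else 0) (central_c n)))" by simp
qed (simp add: affine_bracket_def Let_def)

lemma bracket_deriv:
  assumes A: "A \<in> carrier_mat n n"
  shows "affine_bracket n (deriv_d n) (tensor_t n A p) = affine_smult (of_int p) (tensor_t n A p)"
proof (rule affine_eqI)
  show "loop_part (affine_bracket n (deriv_d n) (tensor_t n A p)) m = loop_part (affine_smult (of_int p) (tensor_t n A p)) m" for m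
    using A by (intro eq_matI) (auto simp: affine_bracket_def Let_def)
qed (simp_all add: affine_bracket_def Let_def)

lemma bracket_central: "affine_bracket n (central_c n) x = affine_smult 0 (central_c n)"
proof (rule affine_eqI)
  show "loop_part (affine_bracket n (central_c n) x) m = loop_part (affine_smult 0 (central_c n)) m" for m
    by (intro eq_matI) (auto simp: affine_bracket_def Let_def)
qed (simp_all add: affine_bracket_def Let_def)

context affine_module
begin

definition X :: "nat \<Rightarrow> nat \<Rightarrow> int \<Rightarrow> 'v \<Rightarrow> 'v" where
  "X i j a = act (tensor_t n (traceless_unit n i j) a)"

lemma unit_in_affine_sl: "i < n \<Longrightarrow> j < n \<Longrightarrow> tensor_t n (traceless_unit n i j) a \<in> affine_sl n"
  by (rule tensor_in_affine_sl) (simp_all add: traceless_unit_trace)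

lemma act_vector_add: "x \<in> affine_sl n \<Longrightarrow> act x (u + w) = act x u + act x w"
  using act_linear[of x] by (simp add: Vector_Spaces.linear.axioms(3) module_hom.add Vector_Spaces.linear_iff)

lemma act_vector_scale: "x \<in> affine_sl n \<Longrightarrow> act x (scale c u) = scale c (act x u)"
  using act_linear[of x] by (simp add: Vector_Spaces.linear_iff)

lemma act_tensor_zero: "act (tensor_t n (0\<^sub>m n n) a) u = 0"
proof -
  have Z: "tensor_t n (0\<^sub>m n n) a \<in> affine_sl n" by (rule tensor_in_affine_sl) auto
  have "tensor_t n (0\<^sub>m n n) a = affine_smult 0 (tensor_t n (0\<^sub>m n n) a)"
    by (rule affine_eqI) (auto simp: smult_zero_mat)
  then show ?thesis using act_smult[OF Z, of 0 u] by simp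
qed

lemma act_tensor_add:
  assumes "A \<in> carrier_mat n n" "mat_trace A = 0" "B \<in> carrier_mat n n" "mat_trace B = 0"
  shows "act (tensor_t n (A + B) a) u = act (tensor_t n A a) u + act (tensor_t n B a) u"
proof -
  have "tensor_t n (A + B) a = affine_add (tensor_t n A a) (tensor_t n B a)"
    by (rule affine_eqI) auto
  then show ?thesis using act_add[of "tensor_t n A a" "tensor_t n B a" u] assms tensor_in_affine_sl by simp
qed

lemma act_tensor_smult:
  assumes "A \<in> carrier_mat n n" "mat_trace A = 0"
  shows "act (tensor_t n (s \<cdot>\<^sub>m A) a) u = scale s (act (tensor_t n A a) u)"
proof -
  have "tensor_t n (s \<cdot>\<^sub>m A) a = affine_smult s (tensor_t n A a)"
    by (rule affine_eqI) auto
  then show ?thesis using act_smult[of "tensor_t n A a" s u] assms tensor_in_affine_sl by simp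
qed

lemma act_tensor_diff:
  assumes "A \<in> carrier_mat n n" "mat_trace A = 0" "B \<in> carrier_mat n n" "mat_trace B = 0"
  shows "act (tensor_t n (A - B) a) u = act (tensor_t n A a) u - act (tensor_t n B a) u"
proof -
  have "A - B = A + (-1) \<cdot>\<^sub>m B" using assms by (intro eq_matI) auto
  then show ?thesis
    using act_tensor_add[of A "(-1) \<cdot>\<^sub>m B" a u] act_tensor_smult[of B "-1" a u] assms
    by (simp add: mat_trace_smult[of B n])
qed

text \<open>Finite sums of units are formed entrywise, as the matrix type has no zero that fits all dimensions.\<close>

lemma sum_units:
  fixes c :: "nat \<Rightarrow> nat \<Rightarrow> complex"
  assumes F: "finite F" "F \<subseteq> {..<n} \<times> {..<n}"
  defines "M \<equiv> mat n n (\<lambda>rs. \<Sum>(i, j)\<in>F. c i j * traceless_unit n i j $$ rs)"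
  shows "mat_trace M = 0 \<and> act (tensor_t n M a) u = (\<Sum>(i, j)\<in>F. scale (c i j) (X i j a u))"
  using F unfolding M_def
proof (induction F rule: finite_induct)
  case empty
  have "mat n n (\<lambda>_. 0) = (0\<^sub>m n n :: complex mat)" by (intro eq_matI) auto
  then show ?case by (simp add: act_tensor_zero)
next
  case (insert ij F)
  obtain i j where ij: "ij = (i, j)" by (cases ij)
  have lt: "i < n" "j < n" using insert.prems ij by auto
  let ?M = "\<lambda>F. mat n n (\<lambda>rs. \<Sum>(i, j)\<in>F. c i j * traceless_unit n i j $$ rs)"
  have IH: "mat_trace (?M F) = 0" "act (tensor_t n (?M F) a) u = (\<Sum>(i, j)\<in>F. scale (c i j) (X i j a u))"
    using insert by auto
  have M: "?M (insert ij F) = c i j \<cdot>\<^sub>m traceless_unit n i j + ?M F"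
    using insert.hyps by (intro eq_matI) (auto simp: ij)
  have tr: "mat_trace (c i j \<cdot>\<^sub>m traceless_unit n i j) = 0"
    by (simp add: mat_trace_smult[of _ n] traceless_unit_trace lt)
  have "mat_trace (?M (insert ij F)) = 0"
    unfolding M using mat_trace_add[of "c i j \<cdot>\<^sub>m traceless_unit n i j" n "?M F"] tr IH(1) by simp
  moreover have "act (tensor_t n (?M (insert ij F)) a) u
     = act (tensor_t n (c i j \<cdot>\<^sub>m traceless_unit n i j) a) u + act (tensor_t n (?M F) a) u"
    unfolding M by (rule act_tensor_add) (simp_all add: tr IH(1))
  moreover have "act (tensor_t n (c i j \<cdot>\<^sub>m traceless_unit n i j) a) u = scale (c i j) (X i j a u)"
    unfolding X_def by (rule act_tensor_smult) (simp_all add: traceless_unit_trace lt)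
  ultimately show ?case using insert.hyps IH(2) by (simp add: ij)
qed

lemma act_tensor_expand:
  assumes A: "A \<in> carrier_mat n n" "mat_trace A = 0"
  shows "act (tensor_t n A a) u = (\<Sum>(i, j)\<in>{..<n} \<times> {..<n}. scale (A $$ (i, j)) (X i j a u))"
proof -
  have "mat n n (\<lambda>rs. \<Sum>(i, j)\<in>{..<n} \<times> {..<n}. A $$ (i, j) * traceless_unit n i j $$ rs) = A"
    (is "?M = A")
  proof (rule eq_matI)
    fix r s assume "r < dim_row A" "s < dim_col A"
    then have rs: "r < n" "s < n" using A by auto
    have "?M $$ (r, s) = (\<Sum>i<n. \<Sum>j<n. A $$ (i, j) * traceless_unit n i j $$ (r, s))"
      using rs by (simp add: sum.cartesian_product)
    also have "\<dots> = (\<Sum>i<n. \<Sum>j<n. (if j = s then (if i = r then A $$ (r, s) else 0) else 0)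
        - (if j = i then (if r = s then A $$ (i, i) / of_nat n else 0) else 0))"
      using rs by (intro sum.cong refl) (auto simp: traceless_unit_index algebra_simps)
    also have "\<dots> = (\<Sum>i<n. (if i = r then A $$ (r, s) else 0) - (if r = s then A $$ (i, i) / of_nat n else 0))"
      using rs by (intro sum.cong refl) (simp add: sum_subtractf)
    also have "\<dots> = A $$ (r, s) - (if r = s then (\<Sum>i<n. A $$ (i, i)) / of_nat n else 0)"
      using rs by (simp add: sum_subtractf sum_divide_distrib)
    also have "(\<Sum>i<n. A $$ (i, i)) = 0" using A by (simp add: mat_trace_def)
    finally have e: "?M $$ (r, s) = A $$ (r, s) - (if r = s then 0 / of_nat n else 0)" .
    show "?M $$ (r, s) = A $$ (r, s)" unfolding e by simp
  qed (use A in auto)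
  then show ?thesis
    using sum_units[of "{..<n} \<times> {..<n}" "\<lambda>i j. A $$ (i, j)" a u] by simp
qed

lemma sum_diag: "(\<Sum>i<n. X i i a u) = 0"
proof -
  let ?F = "(\<lambda>i. (i, i)) ` {..<n}"
  have inj: "inj_on (\<lambda>i. (i, i)) {..<n}" by (auto simp: inj_on_def)
  have "mat n n (\<lambda>rs. \<Sum>(i, j)\<in>?F. 1 * traceless_unit n i j $$ rs) = 0\<^sub>m n n" (is "?M = _")
  proof (rule eq_matI)
    fix r s assume "r < dim_row (0\<^sub>m n n :: complex mat)" "s < dim_col (0\<^sub>m n n :: complex mat)"
    then have rs: "r < n" "s < n" by auto
    have "?M $$ (r, s) = (\<Sum>i<n. traceless_unit n i i $$ (r, s))"
      using rs by (simp add: sum.reindex[OF inj])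
    also have "\<dots> = (\<Sum>i<n. (if i = r then (if r = s then 1 else 0) else 0) - (if r = s then 1 / of_nat n else 0))"
      using rs by (intro sum.cong refl) (auto simp: traceless_unit_index)
    also have "\<dots> = 0" using rs by (simp add: sum_subtractf)
    finally show "?M $$ (r, s) = 0\<^sub>m n n $$ (r, s)" using rs by simp
  qed auto
  then have "(\<Sum>(i, j)\<in>?F. scale 1 (X i j a u)) = 0"
    using sum_units[of ?F "\<lambda>i j. 1" a u] by (auto simp: act_tensor_zero)
  then show ?thesis by (simp add: sum.reindex[OF inj])
qed

text \<open>Commutators produce only differences of diagonal units; the trace relation \<open>sum_diag\<close> recovers each one.\<close>

lemma diag_zeroI:
  assumes "n > 0" "\<And>i j. i < n \<Longrightarrow> j < n \<Longrightarrow> X i i a u = X j j a u" "i < n"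
  shows "X i i a u = 0"
proof -
  have "0 = (\<Sum>j<n. X j j a u)" using sum_diag by simp
  also have "\<dots> = (\<Sum>j<n. X i i a u)" by (rule sum.cong[OF refl], rule assms(2)) (use assms(3) in simp_all)
  also have "\<dots> = scale (of_nat n) (X i i a u)" by (simp add: sum_constant_scale)
  finally show ?thesis using assms(1) by simp
qed

lemma submoduleI:
  assumes W: "subspace W"
    and XW: "\<And>i j a w. i < n \<Longrightarrow> j < n \<Longrightarrow> w \<in> W \<Longrightarrow> X i j a w \<in> W"
    and cW: "\<And>w. w \<in> W \<Longrightarrow> act (central_c n) w \<in> W"
    and dW: "\<And>w. w \<in> W \<Longrightarrow> act (deriv_d n) w \<in> W"
  shows "submodule W"
proof -
  have main: "act x w \<in> W" if "finite S" "x \<in> affine_sl n" "{m. loop_part x m \<noteq> 0\<^sub>m n n} \<subseteq> S" "w \<in> W" for S x w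
    using that
  proof (induction S arbitrary: x rule: finite_induct)
    case empty
    then have "x = affine_add (affine_smult (c_part x) (central_c n)) (affine_smult (d_part x) (deriv_d n))"
      by (intro affine_eqI) auto
    then have "act x w = scale (c_part x) (act (central_c n) w) + scale (d_part x) (act (deriv_d n) w)"
      using act_add[of "affine_smult (c_part x) (central_c n)" "affine_smult (d_part x) (deriv_d n)" w]
        act_smult central_in_affine_sl deriv_in_affine_sl affine_smult_in_affine_sl by simp
    then show ?case using cW dW empty W subspace_add subspace_scale by simp
  next
    case (insert m S)
    define y where "y = Affine (\<lambda>p. if p = m then 0\<^sub>m n n else loop_part x p) (c_part x) (d_part x)"
    have X: "loop_part x p \<in> carrier_mat n n" "mat_trace (loop_part x p) = 0" for p
      using insert.prems(1) by (auto simp: affine_sl_def)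
    have supp: "{p. loop_part y p \<noteq> 0\<^sub>m n n} \<subseteq> S" using insert.prems(2) by (auto simp: y_def)
    then have "finite {p. loop_part y p \<noteq> 0\<^sub>m n n}" using insert.hyps(1) finite_subset by blast
    then have y: "y \<in> affine_sl n" using X by (auto simp: affine_sl_def y_def)
    have t: "tensor_t n (loop_part x m) m \<in> affine_sl n" using X by (intro tensor_in_affine_sl)
    have "x = affine_add (tensor_t n (loop_part x m) m) y"
      using X by (intro affine_eqI) (auto simp: y_def)
    then have "act x w = act (tensor_t n (loop_part x m) m) w + act y w"
      using act_add[OF t y] by metis
    moreover have "act y w \<in> W" using insert.IH[OF y supp] insert.prems(3) by blast
    moreover have "act (tensor_t n (loop_part x m) m) w \<in> W"
      unfolding act_tensor_expand[OF X]
      using insert.prems(3) XW by (intro subspace_sum W) (auto intro!: subspace_scale W)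
    ultimately show ?case using W subspace_add by simp
  qed
  show ?thesis unfolding submodule_def
  proof (intro conjI ballI W)
    fix x w assume x: "x \<in> affine_sl n" and w: "w \<in> W"
    then have "finite {m. loop_part x m \<noteq> 0\<^sub>m n n}" by (simp add: affine_sl_def)
    from main[OF this x order_refl w] show "act x w \<in> W" .
  qed
qed

lemma X_X_central:
  assumes "i < n" "j < n" "p < n" "q < n"
  shows "X i j a (X p q b u) = X p q b (X i j a u)
      + ((if j = p then X i q (a + b) u else 0) - (if q = i then X p j (a + b) u else 0)
      + scale (if a + b = 0 then of_int a * ((if j = p \<and> i = q then 1 else 0)
           - (if i = j \<and> p = q then 1 / of_nat n else 0)) else 0) (act (central_c n) u))"
proof -
  let ?A = "traceless_unit n i j" and ?B = "traceless_unit n p q"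
  let ?C = "if j = p then traceless_unit n i q else 0\<^sub>m n n" and ?D = "if q = i then traceless_unit n p j else 0\<^sub>m n n"
  let ?z = "if a + b = 0 then of_int a * ((if j = p \<and> i = q then 1 else 0)
           - (if i = j \<and> p = q then 1 / of_nat n else 0)) else (0::complex)"
  have C: "?C \<in> carrier_mat n n" "mat_trace ?C = 0" and D: "?D \<in> carrier_mat n n" "mat_trace ?D = 0"
    using assms by (auto simp: traceless_unit_trace)
  have tr: "mat_trace (?C - ?D) = 0" using mat_trace_minus[OF C(1) D(1)] C D by simp
  have cd: "?C - ?D \<in> carrier_mat n n" by (rule minus_carrier_mat[OF D(1)])
  have "X i j a (X p q b u) - X p q b (X i j a u) = act (affine_bracket n (tensor_t n ?A a) (tensor_t n ?B b)) u"
    unfolding X_def using act_bracket unit_in_affine_sl assms by simp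
  also have "affine_bracket n (tensor_t n ?A a) (tensor_t n ?B b)
      = affine_add (tensor_t n (?C - ?D) (a + b)) (affine_smult ?z (central_c n))"
    by (simp only: bracket_tensor[OF traceless_unit_carrier traceless_unit_carrier]
        traceless_unit_commutator[OF assms] traceless_unit_form[OF assms])
  also have "act (affine_add (tensor_t n (?C - ?D) (a + b)) (affine_smult ?z (central_c n))) u
      = act (tensor_t n (?C - ?D) (a + b)) u + scale ?z (act (central_c n) u)"
    using act_add[OF tensor_in_affine_sl[OF cd tr] affine_smult_in_affine_sl[OF central_in_affine_sl]]
      act_smult[OF central_in_affine_sl] by (simp only:)
  also have "act (tensor_t n (?C - ?D) (a + b)) u
     = (if j = p then X i q (a + b) u else 0) - (if q = i then X p j (a + b) u else 0)"
    unfolding act_tensor_diff[OF C D] by (simp add: X_def act_tensor_zero)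
  finally show ?thesis by (simp only: diff_eq_eq add.commute)
qed

lemma deriv_X:
  assumes "i < n" "j < n"
  shows "act (deriv_d n) (X i j a u) = X i j a (act (deriv_d n) u) + scale (of_int a) (X i j a u)"
proof -
  note x = unit_in_affine_sl[OF assms, of a]
  have "act (deriv_d n) (X i j a u) - X i j a (act (deriv_d n) u)
     = act (affine_bracket n (deriv_d n) (tensor_t n (traceless_unit n i j) a)) u"
    unfolding X_def using act_bracket[OF deriv_in_affine_sl x] by simp
  also have "\<dots> = scale (of_int a) (X i j a u)"
    unfolding bracket_deriv[OF traceless_unit_carrier] X_def by (rule act_smult[OF x])
  finally show ?thesis by (simp only: diff_eq_eq add.commute)
qed

lemma central_commute:
  assumes "x \<in> affine_sl n"
  shows "act (central_c n) (act x u) = act x (act (central_c n) u)"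
proof -
  have "act (central_c n) (act x u) - act x (act (central_c n) u) = act (affine_bracket n (central_c n) x) u"
    using act_bracket[OF central_in_affine_sl assms] by simp
  also have "\<dots> = 0" unfolding bracket_central act_smult[OF central_in_affine_sl] by simp
  finally show ?thesis by simp
qed

lemma coroot_action:
  assumes "i < n" "n \<ge> 2"
  shows "act (coroot n i) u = (if i = 0 then X (n - 1) (n - 1) 0 u - X 0 0 0 u + act (central_c n) u
     else X (i - 1) (i - 1) 0 u - X i i 0 u)"
proof -
  have E: "elem_mat n a a - elem_mat n b b = traceless_unit n a a - traceless_unit n b b" for a b
    by (intro eq_matI) (auto simp: elem_mat_def traceless_unit_index)
  have T: "act (tensor_t n (elem_mat n a a - elem_mat n b b) 0) u = X a a 0 u - X b b 0 u"
    "tensor_t n (elem_mat n a a - elem_mat n b b) 0 \<in> affine_sl n"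
    if "a < n" "b < n" for a b
  proof -
    let ?a = "traceless_unit n a a" and ?b = "traceless_unit n b b"
    have tr: "mat_trace ?a = 0" "mat_trace ?b = 0" using that by (simp_all add: traceless_unit_trace)
    show "act (tensor_t n (elem_mat n a a - elem_mat n b b) 0) u = X a a 0 u - X b b 0 u"
      unfolding E X_def by (rule act_tensor_diff) (simp_all add: tr)
    have "mat_trace (?a - ?b) = 0"
      using mat_trace_minus[of ?a n ?b] tr by simp
    then show "tensor_t n (elem_mat n a a - elem_mat n b b) 0 \<in> affine_sl n"
      unfolding E by (intro tensor_in_affine_sl minus_carrier_mat traceless_unit_carrier)
  qed
  show ?thesis
  proof (cases "i = 0")
    case True
    then show ?thesis using act_add[OF T(2) central_in_affine_sl, of "n - 1" 0 u] T(1)[of "n - 1" 0] assms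
      by (simp add: coroot_def)
  next
    case False
    then show ?thesis using T(1)[of "i - 1" i] assms by (simp add: coroot_def)
  qed
qed

lemma cartan_in_affine_sl:
  assumes "n \<ge> 2" "h \<in> cartan n"
  shows "h \<in> affine_sl n"
  using assms(2)
proof induction
  case (coroot i)
  have tr: "mat_trace (elem_mat n a a) = 1" if "a < n" for a
  proof -
    have "mat_trace (elem_mat n a a) = (\<Sum>r<n. if r = a then 1 else 0)"
      unfolding elem_mat_def mat_trace_mat by (intro sum.cong) auto
    then show ?thesis using that by simp
  qed
  have c: "elem_mat n a a \<in> carrier_mat n n" for a by (simp add: elem_mat_def)
  have T: "tensor_t n (elem_mat n a a - elem_mat n b b) 0 \<in> affine_sl n" if "a < n" "b < n" for a b
    using that by (intro tensor_in_affine_sl minus_carrier_mat c) (simp add: mat_trace_minus[OF c c] tr)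
  show ?case
  proof (cases "i = 0")
    case True
    then show ?thesis using affine_add_in_affine_sl[OF T[of "n - 1" 0] central_in_affine_sl] assms(1)
      by (simp add: coroot_def)
  next
    case False
    then show ?thesis using T[of "i - 1" i] coroot by (simp add: coroot_def)
  qed
qed (simp_all add: deriv_in_affine_sl affine_add_in_affine_sl affine_smult_in_affine_sl)

end

section \<open>The weight in coordinates\<close>

text \<open>The values of \<open>k \<Lambda>\<^sub>0 - \<gamma>\<^sub>l\<close> at the coroots.\<close>

definition weight_coord :: "nat \<Rightarrow> nat \<Rightarrow> nat \<Rightarrow> nat \<Rightarrow> int" where
  "weight_coord n k l i = (if i = 0 then int k + corner_weight n l (n - 1) - corner_weight n l 0
     else corner_weight n l (i - 1) - corner_weight n l i)"

lemma dual_ext_lincomb: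
  assumes "finite A"
  shows "(\<Sum>t\<in>A. c t * dual_ext n (f t) (w t) h)
    = dual_ext n (\<lambda>i. \<Sum>t\<in>A. c t * f t i) (\<Sum>t\<in>A. c t * w t) h"
proof -
  have "(\<Sum>t\<in>A. c t * (\<Sum>i<n. f t i * coroot_coord i h)) = (\<Sum>i<n. (\<Sum>t\<in>A. c t * f t i) * coroot_coord i h)"
    unfolding sum_distrib_left sum_distrib_right by (subst sum.swap) (simp add: mult_ac)
  then show ?thesis
    by (simp add: dual_ext_def distrib_left sum.distrib sum_distrib_right mult.assoc)
qed

lemma affine_gcm_cyclic:
  assumes "n \<ge> 2" "i < n" "j < n"
  shows "affine_gcm n i j = 2 * (if j = i then 1 else 0)
    - (if j = (if i = 0 then n - 1 else i - 1) then 1 else 0)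
    - (if j = (if i = n - 1 then 0 else i + 1) then 1 else 0)"
proof (cases "n = 2")
  case True
  have "i = 0 \<or> i = 1" "j = 0 \<or> j = 1" using assms(2,3) unfolding True by linarith+
  then show ?thesis unfolding True by (elim disjE) (simp_all add: affine_gcm_def)
next
  case False
  then have "n \<ge> 3" using assms(1) by simp
  consider "i = 0" | "0 < i" "i < n - 1" | "i = n - 1" "0 < i" using assms(2) by linarith
  then show ?thesis
  proof cases
    case 1
    then show ?thesis using \<open>n \<ge> 3\<close> assms(3) by (simp add: affine_gcm_def) arith
  next
    case 2
    then show ?thesis using \<open>n \<ge> 3\<close> assms(3) by (simp add: affine_gcm_def) arith
  next
    case 3
    then show ?thesis using \<open>n \<ge> 3\<close> assms(3) by (simp add: affine_gcm_def) arith
  qed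
qed

text \<open>The coefficient of \<open>\<alpha>\<^sub>j\<close> in \<open>\<gamma>\<^sub>l\<close>. Truncated subtraction makes each of the two summands vanish outside
its range; as \<open>2 l \<le> n\<close>, at most one of them is nonzero.\<close>

definition root_coeff :: "nat \<Rightarrow> nat \<Rightarrow> nat \<Rightarrow> nat" where
  "root_coeff n l j = (if j = 0 then l else (l - j) + (l - (n - j)))"

lemma gamma_wt_coeff:
  assumes "1 \<le> l" "2 * l \<le> n"
  shows "gamma_wt n l h = (\<Sum>j<n. of_nat (root_coeff n l j) * simple_root n j h)"
proof -
  have "{..<n} = insert 0 {1..n-1}" using assms by auto
  then have "(\<Sum>j<n. of_nat (root_coeff n l j) * simple_root n j h)
     = of_nat l * simple_root n 0 h + (\<Sum>j=1..n-1. of_nat (root_coeff n l j) * simple_root n j h)"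
    by (simp add: root_coeff_def)
  also have "(\<Sum>j=1..n-1. of_nat (root_coeff n l j) * simple_root n j h)
     = (\<Sum>j=1..n-1. of_nat (l - j) * simple_root n j h)
      + (\<Sum>j=1..n-1. of_nat (l - (n - j)) * simple_root n j h)"
    unfolding sum.distrib[symmetric] by (intro sum.cong) (auto simp: root_coeff_def distrib_right)
  also have "(\<Sum>j=1..n-1. of_nat (l - j) * simple_root n j h) = (\<Sum>j=1..l-1. of_nat (l - j) * simple_root n j h)"
    using assms by (intro sum.mono_neutral_right) auto
  also have "(\<Sum>j=1..n-1. of_nat (l - (n - j)) * simple_root n j h)
     = (\<Sum>j=1..n-1. of_nat (l - j) * simple_root n (n - j) h)"
    by (rule sum.reindex_bij_witness[where i = "\<lambda>j. n - j" and j = "\<lambda>j. n - j"]) auto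
  also have "\<dots> = (\<Sum>j=1..l-1. of_nat (l - j) * simple_root n (n - j) h)"
    using assms by (intro sum.mono_neutral_right) auto
  finally show ?thesis by (simp add: gamma_wt_def add.assoc)
qed

text \<open>The affine Cartan matrix is the negative of the second difference on the cycle of length \<open>n\<close>, also for
\<open>n = 2\<close>, where the two neighbours of a vertex coincide.\<close>

lemma root_coeff_second_difference:
  assumes "1 \<le> l" "2 * l \<le> n" "i < n"
  shows "(\<Sum>j<n. int (root_coeff n l j) * affine_gcm n i j)
    = (if i = 0 then corner_weight n l 0 - corner_weight n l (n - 1) else corner_weight n l i - corner_weight n l (i - 1))"
proof -
  define a where "a = (if i = 0 then n - 1 else i - 1)"
  define b where "b = (if i = n - 1 then 0 else i + 1)"
  have ab: "a < n" "b < n" using assms by (auto simp: a_def b_def)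
  have n2: "n \<ge> 2" using assms by simp
  have "(\<Sum>j<n. int (root_coeff n l j) * affine_gcm n i j)
     = (\<Sum>j<n. (if j = i then 2 * int (root_coeff n l i) else 0)
         - (if j = a then int (root_coeff n l a) else 0) - (if j = b then int (root_coeff n l b) else 0))"
    using affine_gcm_cyclic[OF n2 assms(3)] by (intro sum.cong) (auto simp: a_def b_def)
  also have "\<dots> = 2 * int (root_coeff n l i) - int (root_coeff n l a) - int (root_coeff n l b)"
    using assms(3) ab by (simp add: sum_subtractf)
  also have "\<dots> = (if i = 0 then corner_weight n l 0 - corner_weight n l (n - 1) else corner_weight n l i - corner_weight n l (i - 1))"
  proof -
    consider "i = 0" | "0 < i" "i < n - 1" | "i = n - 1" "i \<noteq> 0" using assms(3) by linarith
    then show ?thesis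
    proof cases
      case 1
      then show ?thesis using assms n2 by (auto simp: a_def b_def root_coeff_def corner_weight_def)
    next
      case 2
      then show ?thesis using assms by (auto simp: a_def b_def root_coeff_def corner_weight_def)
    next
      case 3
      then show ?thesis using assms n2 by (auto simp: a_def b_def root_coeff_def corner_weight_def)
    qed
  qed
  finally show ?thesis .
qed

lemma weight_as_dual_ext:
  assumes l: "1 \<le> l" "2 * l \<le> n"
  shows "of_nat k * fund_weight n 0 h - gamma_wt n l h
    = dual_ext n (\<lambda>i. of_int (weight_coord n k l i)) (- of_nat l) h"
proof -
  let ?S = "\<lambda>i. \<Sum>j<n. of_nat (root_coeff n l j) * of_int (affine_gcm n i j) :: complex"
  have "gamma_wt n l h = dual_ext n ?S (\<Sum>j<n. of_nat (root_coeff n l j) * (if j = 0 then 1 else 0)) h"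
    unfolding gamma_wt_coeff[OF l] simple_root_def by (rule dual_ext_lincomb) simp
  also have "(\<Sum>j<n. of_nat (root_coeff n l j) * (if j = 0 then 1 else 0)) = (\<Sum>j<n. if j = 0 then of_nat l else (0::complex))"
    by (intro sum.cong) (auto simp: root_coeff_def)
  also have "\<dots> = of_nat l" using l by simp
  finally have g: "gamma_wt n l h = dual_ext n ?S (of_nat l) h" .
  have S: "?S i = of_int (if i = 0 then corner_weight n l 0 - corner_weight n l (n - 1)
      else corner_weight n l i - corner_weight n l (i - 1))" if "i < n" for i
  proof -
    have "?S i = of_int (\<Sum>j<n. int (root_coeff n l j) * affine_gcm n i j)" by simp
    then show ?thesis unfolding root_coeff_second_difference[OF l that] .
  qed
  have coord: "of_int (weight_coord n k l i) = of_nat k * (if 0 = i then 1 else 0) - ?S i" if "i < n" for i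
    unfolding S[OF that] by (simp add: weight_coord_def)
  have "(\<Sum>i<n. of_int (weight_coord n k l i) * coroot_coord i h)
     = (\<Sum>i<n. of_nat k * ((if 0 = i then 1 else 0) * coroot_coord i h) - ?S i * coroot_coord i h)"
    by (intro sum.cong refl) (simp only: coord lessThan_iff left_diff_distrib mult.assoc)
  also have "\<dots> = of_nat k * (\<Sum>i<n. (if 0 = i then 1 else 0) * coroot_coord i h) - (\<Sum>i<n. ?S i * coroot_coord i h)"
    by (simp only: sum_subtractf sum_distrib_left)
  finally show ?thesis unfolding g fund_weight_def dual_ext_def by (simp add: algebra_simps)
qed

context affine_module
begin

text \<open>The Chevalley generators generate the positive part: first the strictly upper triangular units, then all
units in \<open>t\<close>-degree one from \<open>E\<^bsub>n-1,0\<^esub> t\<close>, then the higher degrees.\<close>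

lemma vacuum_kills:
  assumes n: "n \<ge> 2" and e: "\<And>i. i < n \<Longrightarrow> act (chev_e n i) v = 0"
    and diag: "\<And>i. i < n \<Longrightarrow> X i i 0 v = 0"
    and ij: "i < n" "j < n" "a > 0 \<or> a = 0 \<and> i \<le> j"
  shows "X i j a v = 0"
proof -
  have X0: "X i j a 0 = 0" if "i < n" "j < n" for i j a
    using act_vector_scale[OF unit_in_affine_sl[OF that], of a 0 0] by (simp add: X_def)
  have comm: "(if j = p then X i q (a + b) v else 0) = (if q = i then X p j (a + b) v else 0)"
    if "i < n" "j < n" "p < n" "q < n" "X i j a v = 0" "X p q b v = 0" "a + b \<noteq> 0 \<or> a = 0" for i j p q a b
  proof -
    have z: "(if a + b = 0 then of_int a * ((if j = p \<and> i = q then 1 else 0)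
           - (if i = j \<and> p = q then 1 / of_nat n else 0)) else 0) = (0::complex)"
      using that(7) by auto
    have "(if j = p then X i q (a + b) v else 0) - (if q = i then X p j (a + b) v else 0) = 0"
      using X_X_central[OF that(1-4), of a b v] that(5,6) X0[OF that(1,2), of a] X0[OF that(3,4), of b]
      unfolding z by (simp only: scale_zero_left add_0_left add_0_right)
    then show ?thesis by (simp only: right_minus_eq)
  qed
  have chev: "X (i - 1) i 0 v = 0" if "0 < i" "i < n" for i
  proof -
    have "elem_mat n (i - 1) i = traceless_unit n (i - 1) i"
      using that by (intro eq_matI) (auto simp: elem_mat_def traceless_unit_index)
    then show ?thesis using e[OF that(2)] that by (simp add: chev_e_def X_def)
  qed
  have up: "X i j 0 v = 0" if "i < j" "j < n" for i j
    using that
  proof (induction "j - i" arbitrary: j rule: less_induct)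
    case less
    show ?case
    proof (cases "i = j - 1")
      case True
      then show ?thesis using chev[of j] less by simp
    next
      case False
      then have "X i (j - 1) 0 v = 0" using less by (intro less.hyps) auto
      then show ?thesis using comm[of i "j - 1" "j - 1" j 0 0] chev[of j] less.prems by simp
    qed
  qed
  have e0: "X (n - 1) 0 1 v = 0"
  proof -
    have "elem_mat n (n - 1) 0 = traceless_unit n (n - 1) 0"
      using n by (intro eq_matI) (auto simp: elem_mat_def traceless_unit_index)
    then show ?thesis using e[of 0] n by (simp add: chev_e_def X_def)
  qed
  have col: "X i 0 1 v = 0" if "0 < i" "i < n" for i
  proof (cases "i = n - 1")
    case False
    then show ?thesis using comm[of i "n - 1" "n - 1" 0 0 1] up[of i "n - 1"] e0 that by simp
  qed (use e0 in simp)
  \<comment> \<open>For \<open>i = j\<close> only differences of diagonal units are reached by commutators; that each vanishes follows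
    from \<open>sum_diag\<close>.\<close>
  have low: "X i j 1 v = (if i = j then X 0 0 1 v else 0)" if "0 < i" "i < n" "0 < j" "j < n" for i j
    using comm[of i 0 0 j 1 0] col[of i] up[of 0 j] that by (auto split: if_splits)
  have d1: "X i i 1 v = 0" if "i < n" for i
  proof (rule diag_zeroI[OF _ _ that])
    show "X i i 1 v = X j j 1 v" if "i < n" "j < n" for i j
      using low[of i i] low[of j j] that by (cases "i = 0"; cases "j = 0") simp_all
  qed (use n in simp)
  have one: "X i j 1 v = 0" if ij: "i < n" "j < n" for i j
  proof -
    consider "i = j" | "i \<noteq> j" "i = 0" | "i \<noteq> j" "0 < i" "j = 0" | "i \<noteq> j" "0 < i" "0 < j" by linarith
    then show ?thesis
    proof cases
      case 1
      then show ?thesis using d1 ij by simp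
    next
      case 2
      then show ?thesis using comm[of 0 0 0 j 1 0] d1[of 0] up[of 0 j] ij by simp
    next
      case 3
      then show ?thesis using col ij by simp
    next
      case 4
      then show ?thesis using low[of i j] ij by simp
    qed
  qed
  have pos: "X i j (1 + int m) v = 0" if "i < n" "j < n" for i j m
    using that
  proof (induction m arbitrary: i j)
    case 0
    then show ?case using one by simp
  next
    case (Suc m)
    have off: "X i j (1 + int (Suc m)) v = 0" if "i < n" "j < n" "i \<noteq> j" for i j
      using comm[of i i i j 1 "1 + int m"] one[of i i] Suc.IH[of i j] that by (simp add: add_ac)
    have diff: "X i i (1 + int (Suc m)) v = X j j (1 + int (Suc m)) v" if "i < n" "j < n" for i j
    proof (cases "i = j")
      case False
      then show ?thesis
        using comm[of i j j i 1 "1 + int m"] one[of i j] Suc.IH[of j i] that by (simp add: add_ac)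
    qed simp
    show ?case
    proof (cases "i = j")
      case True
      then show ?thesis using diag_zeroI[OF _ diff, of i] n Suc.prems by simp
    next
      case False
      then show ?thesis using off Suc.prems by blast
    qed
  qed
  show ?thesis
  proof (cases "a > 0")
    case True
    then have "a = 1 + int (nat (a - 1))" by simp
    then show ?thesis using pos[OF ij(1,2), of "nat (a - 1)"] by simp
  next
    case False
    then have "a = 0" "i \<le> j" using ij(3) by auto
    then show ?thesis using diag[OF ij(1)] up[of i j] ij by (cases "i = j") auto
  qed
qed

text \<open>Coroots only see differences of the diagonal units; the missing constant is fixed by the trace.\<close>

lemma diag_eigenI:
  assumes n: "n \<ge> 2" and w: "(\<Sum>i<n. w i) = (0::complex)"
    and step: "\<And>i. 0 < i \<Longrightarrow> i < n \<Longrightarrow> X (i - 1) (i - 1) 0 u - X i i 0 u = scale (w (i - 1) - w i) u"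
    and i: "i < n"
  shows "X i i 0 u = scale (w i) u"
proof -
  define z where "z i = X i i 0 u - scale (w i) u" for i
  have const: "z i = z 0" if "i < n" for i
    using that
  proof (induction i)
    case (Suc i)
    have "X i i 0 u - X (Suc i) (Suc i) 0 u = scale (w i) u - scale (w (Suc i)) u"
      using step[of "Suc i"] Suc.prems by (simp add: scale_left_diff_distrib)
    then have "z i = z (Suc i)" by (simp add: z_def algebra_simps)
    then show ?case using Suc by simp
  qed simp
  have "(\<Sum>i<n. z i) = (\<Sum>i<n. z 0)" by (rule sum.cong[OF refl], rule const) simp
  also have "\<dots> = scale (of_nat n) (z 0)" by (simp add: sum_constant_scale)
  finally have "scale (of_nat n) (z 0) = (\<Sum>i<n. X i i 0 u) - (\<Sum>i<n. scale (w i) u)"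
    by (simp add: z_def sum_subtractf)
  also have "\<dots> = 0" using sum_diag[of 0 u] w by (simp flip: scale_sum_left)
  finally have "z 0 = 0" using n by simp
  then show ?thesis using const[OF i] by (simp add: z_def)
qed

lemma affine_vacuum_of_highest_weight:
  assumes n: "n \<ge> 2" and irr: irreducible_module
    and v: "highest_weight_vector (\<lambda>h. of_nat k * fund_weight n 0 h) v"
    and gen: "\<And>W. submodule W \<Longrightarrow> v \<in> W \<Longrightarrow> W = UNIV"
  shows "affine_vacuum scale n k X (act (deriv_d n)) v"
    and "\<And>u. act (central_c n) u = scale (of_nat k) u"
proof -
  have hv: "act h v = scale (of_nat k * fund_weight n 0 h) v" if "h \<in> cartan n" for h
    using v that by (simp add: highest_weight_vector_def)
  have cor: "act (coroot n i) v = scale (if i = 0 then of_nat k else 0) v" if "i < n" for i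
    using hv[OF cartan.coroot[OF that]] dual_ext_coroot[OF that n] by (simp add: fund_weight_def)
  have diag: "X i i 0 v = 0" if "i < n" for i
  proof -
    have "X i i 0 v = scale 0 v"
    proof (rule diag_eigenI[OF n _ _ that, where w = "\<lambda>_. 0"])
      fix i assume "0 < i" "i < n"
      then show "X (i - 1) (i - 1) 0 v - X i i 0 v = scale (0 - 0) v"
        using cor[of i] coroot_action[OF _ n, of i v] by simp
    qed simp
    then show ?thesis by simp
  qed
  have cv: "act (central_c n) v = scale (of_nat k) v"
    using cor[of 0] coroot_action[OF _ n, of 0 v] diag[of 0] diag[of "n - 1"] n by simp
  have Dv: "act (deriv_d n) v = 0"
    using hv[OF cartan.deriv] by (simp add: fund_weight_def dual_ext_deriv)
  have lin: "act (central_c n) (u + w) = act (central_c n) u + act (central_c n) w"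
    "act (central_c n) (scale c u) = scale c (act (central_c n) u)" for u w c
    using act_vector_add act_vector_scale central_in_affine_sl by blast+
  show central: "act (central_c n) u = scale (of_nat k) u" for u
  proof -
    \<comment> \<open>The eigenspace of a central element is a submodule.\<close>
    define W where "W = {u. act (central_c n) u = scale (of_nat k) u}"
    have "subspace W"
    proof (rule subspaceI)
      show "0 \<in> W" using lin(2)[of 0 0] by (simp add: W_def)
      show "x + y \<in> W" if "x \<in> W" "y \<in> W" for x y
        using that by (simp add: W_def lin(1) scale_right_distrib)
      show "scale c x \<in> W" if "x \<in> W" for c x
        using that unfolding W_def mem_Collect_eq lin(2) by (simp only: scale_left_commute)
    qed
    moreover have "act x w \<in> W" if "x \<in> affine_sl n" "w \<in> W" for x w
      using that central_commute[OF that(1), of w] act_vector_scale[OF that(1)] by (simp add: W_def)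
    ultimately have "submodule W" by (simp add: submodule_def)
    then have "W = UNIV" using gen cv by (simp add: W_def)
    then show ?thesis by (auto simp: W_def)
  qed
  show "affine_vacuum scale n k X (act (deriv_d n)) v"
  proof
    show "X i j a (u + w) = X i j a u + X i j a w" "X i j a (scale c u) = scale c (X i j a u)"
      if "i < n" "j < n" for i j a u w c
      unfolding X_def using act_vector_add act_vector_scale unit_in_affine_sl[OF that] by blast+
    show "act (deriv_d n) (u + w) = act (deriv_d n) u + act (deriv_d n) w"
      "act (deriv_d n) (scale c u) = scale c (act (deriv_d n) u)" for u w c
      using act_vector_add act_vector_scale deriv_in_affine_sl by blast+
    show "X i j a (X p q b u) = X p q b (X i j a u)
        + ((if j = p then X i q (a + b) u else 0) - (if q = i then X p j (a + b) u else 0)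
        + scale (if a + b = 0 then of_int a * ((if j = p \<and> i = q then 1 else 0)
             - (if i = j \<and> p = q then 1 / of_nat n else 0)) * of_nat k else 0) u)"
      if "i < n" "j < n" "p < n" "q < n" for i j p q a b u
      unfolding X_X_central[OF that, of a b u] central by simp
    show "act (deriv_d n) (X i j a u) = X i j a (act (deriv_d n) u) + scale (of_int a) (X i j a u)"
      if "i < n" "j < n" for i j a u using deriv_X[OF that] .
    show "X i j a v = 0" if "i < n" "j < n" "a > 0 \<or> a = 0 \<and> i \<le> j" for i j a
      using vacuum_kills[OF n _ diag that] v by (simp add: highest_weight_vector_def)
    show "act (deriv_d n) v = 0" by (rule Dv)
    show "v \<noteq> 0" using v by (simp add: highest_weight_vector_def)
    show "W = {0} \<or> W = UNIV"
      if W: "subspace W" "\<And>i j a w. i < n \<Longrightarrow> j < n \<Longrightarrow> w \<in> W \<Longrightarrow> X i j a w \<in> W"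
        "\<And>w. w \<in> W \<Longrightarrow> act (deriv_d n) w \<in> W" for W
    proof -
      have "submodule W"
        by (rule submoduleI[OF W(1) W(2) _ W(3)]) (simp_all add: central subspace_scale[OF W(1)])
      then show ?thesis using irr by (simp add: irreducible_module_def)
    qed
  qed
qed

lemma weight_space_eq:
  assumes n: "n \<ge> 2" and l: "1 \<le> l" "2 * l \<le> n"
    and central: "\<And>u. act (central_c n) u = scale (of_nat k) u"
  shows "weight_space (\<lambda>h. of_nat k * fund_weight n 0 h - gamma_wt n l h)
    = {u. act (deriv_d n) u = scale (- of_nat l) u
        \<and> (\<forall>i<n. X i i 0 u = scale (of_int (corner_weight n l i)) u)}"
proof -
  let ?w = "\<lambda>i. of_int (weight_coord n k l i) :: complex"
  let ?mu = "dual_ext n ?w (- of_nat l)"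
  have mu: "(\<lambda>h. of_nat k * fund_weight n 0 h - gamma_wt n l h) = ?mu"
    using weight_as_dual_ext[OF l] by blast
  have sum0: "(\<Sum>i<n. of_int (corner_weight n l i)) = (0::complex)"
  proof -
    have "(\<Sum>i<n. corner_weight n l i) = (\<Sum>i<n. if i < l then 1 else 0) - (\<Sum>i<n. if n - l \<le> i then 1 else 0)"
      by (simp add: corner_weight_def sum_subtractf)
    also have "(\<Sum>i<n. if i < l then 1 else 0) = (\<Sum>i\<in>{..<l}. 1::int)"
      using l by (intro sum.mono_neutral_cong_right) auto
    also have "(\<Sum>i<n. if n - l \<le> i then 1 else 0) = (\<Sum>i\<in>{n-l..<n}. 1::int)"
      by (intro sum.mono_neutral_cong_right) auto
    finally have "(\<Sum>i<n. corner_weight n l i) = 0" using l by simp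
    then show ?thesis by (metis of_int_0 of_int_sum)
  qed
  have "(\<forall>h\<in>cartan n. act h u = scale (?mu h) u) \<longleftrightarrow>
     act (deriv_d n) u = scale (- of_nat l) u \<and> (\<forall>i<n. X i i 0 u = scale (of_int (corner_weight n l i)) u)" for u
  proof
    assume h: "\<forall>h\<in>cartan n. act h u = scale (?mu h) u"
    have "act (deriv_d n) u = scale (- of_nat l) u"
      using h cartan.deriv[of n] by (simp add: dual_ext_deriv)
    moreover have "X i i 0 u = scale (of_int (corner_weight n l i)) u" if "i < n" for i
    proof (rule diag_eigenI[OF n sum0 _ that])
      fix i assume i: "0 < i" "i < n"
      have "act (coroot n i) u = scale (?w i) u"
        using h cartan.coroot[OF i(2)] dual_ext_coroot[OF i(2) n] by simp
      then show "X (i - 1) (i - 1) 0 u - X i i 0 u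
          = scale (of_int (corner_weight n l (i - 1)) - of_int (corner_weight n l i)) u"
        using coroot_action[OF i(2) n, of u] i(1) by (simp add: weight_coord_def)
    qed
    ultimately show "act (deriv_d n) u = scale (- of_nat l) u \<and> (\<forall>i<n. X i i 0 u = scale (of_int (corner_weight n l i)) u)"
      by blast
  next
    assume u: "act (deriv_d n) u = scale (- of_nat l) u \<and> (\<forall>i<n. X i i 0 u = scale (of_int (corner_weight n l i)) u)"
    show "\<forall>h\<in>cartan n. act h u = scale (?mu h) u"
    proof
      fix h assume "h \<in> cartan n"
      then show "act h u = scale (?mu h) u"
      proof induction
        case (coroot i)
        have "act (coroot n i) u = scale (?w i) u"
        proof -
          have e: "X q q 0 u = scale (of_int (corner_weight n l q)) u" if "q < n" for q
            using u that by blast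
          show ?thesis
          proof (cases "i = 0")
            case True
            have "act (coroot n i) u = scale (of_int (corner_weight n l (n - 1))) u
                - scale (of_int (corner_weight n l 0)) u + scale (of_nat k) u"
              using coroot_action[OF coroot n, of u] True e[of "n - 1"] e[of 0] n central[of u] by simp
            also have "\<dots> = scale (of_int (corner_weight n l (n - 1)) - of_int (corner_weight n l 0) + of_nat k) u"
              by (simp only: scale_left_diff_distrib scale_left_distrib)
            finally show ?thesis using True by (simp add: weight_coord_def add_ac)
          next
            case False
            then show ?thesis using coroot_action[OF coroot n, of u] e[of "i - 1"] e[OF coroot] coroot
              by (simp add: weight_coord_def scale_left_diff_distrib)
          qed
        qed
        then show ?case using dual_ext_coroot[OF coroot n] by simp
      next
        case deriv
        then show ?case using u by (simp add: dual_ext_deriv)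
      next
        case (add x y)
        have xy: "x \<in> affine_sl n" "y \<in> affine_sl n" using cartan_in_affine_sl[OF n] add.hyps by blast+
        show ?case unfolding act_add[OF xy] dual_ext_add[OF xy] add.IH by (rule scale_left_distrib[symmetric])
      next
        case (smult x s)
        have x: "x \<in> affine_sl n" using cartan_in_affine_sl[OF n] smult.hyps by blast
        show ?case unfolding act_smult[OF x] dual_ext_smult[OF x] smult.IH by simp
      qed
    qed
  qed
  then show ?thesis unfolding weight_space_def mu by blast
qed

end

section \<open>The multiplicity\<close>

definition bounded_perms :: "nat \<Rightarrow> nat \<Rightarrow> (nat \<Rightarrow> nat) set" where
  "bounded_perms l k = {p. p permutes {..<l} \<and> count_list (fst (rsk l (map p [0..<l]))) 1 \<le> k}"

lemma word_of_permutation: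
  assumes p: "p permutes {..<l}"
  shows "map p [0..<l] \<in> partial_perms l l"
proof -
  have "set (map p [0..<l]) = p ` {..<l}" by (simp add: atLeast0LessThan)
  also have "\<dots> = {..<l}" by (rule permutes_image[OF p])
  finally have "set (map p [0..<l]) \<subseteq> {..<l}" by simp
  moreover have "distinct (map p [0..<l])"
    unfolding distinct_map using inj_on_subset[OF permutes_inj[OF p] subset_UNIV] by simp
  ultimately show ?thesis by (simp add: partial_perms_def)
qed

lemma permutation_of_word:
  assumes "xs \<in> partial_perms l l"
  shows "\<exists>p. p permutes {..<l} \<and> map p [0..<l] = xs"
proof -
  define p where "p i = (if i < l then xs ! i else i)" for i
  have xs: "distinct xs" "set xs \<subseteq> {..<l}" "length xs = l" using assms by (auto simp: partial_perms_def)
  have "inj_on p {..<l}" using xs by (auto simp: inj_on_def p_def nth_eq_iff_index_eq)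
  moreover have "p ` {..<l} \<subseteq> {..<l}" using xs nth_mem by (fastforce simp: p_def)
  ultimately have "bij_betw p {..<l} {..<l}" by (simp add: bij_betw_def endo_inj_surj)
  then have "p permutes {..<l}" by (rule bij_imp_permutes) (simp add: p_def)
  moreover have "map p [0..<l] = xs" using xs by (intro nth_equalityI) (auto simp: p_def)
  ultimately show ?thesis by blast
qed

lemma card_bounded_perms:
  "card (bounded_perms l k) = (\<Sum>ps | ps \<in> partitions_of l \<and> length ps \<le> k. (num_syt ps)\<^sup>2)"
proof -
  have "bij_betw (\<lambda>p. map p [0..<l]) (bounded_perms l k)
      {xs \<in> partial_perms l l. count_list (fst (rsk l xs)) 1 \<le> k}"
    unfolding bij_betw_def
  proof
    show "inj_on (\<lambda>p. map p [0..<l]) (bounded_perms l k)"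
    proof (rule inj_onI)
      fix p q assume pq: "p \<in> bounded_perms l k" "q \<in> bounded_perms l k" "map p [0..<l] = map q [0..<l]"
      have "p i = q i" for i
      proof (cases "i < l")
        case True
        then show ?thesis using pq(3) by (auto simp: map_eq_conv)
      next
        case False
        then show ?thesis using pq(1,2) by (auto simp: bounded_perms_def permutes_def)
      qed
      then show "p = q" by blast
    qed
    show "(\<lambda>p. map p [0..<l]) ` bounded_perms l k = {xs \<in> partial_perms l l. count_list (fst (rsk l xs)) 1 \<le> k}"
    proof
      show "(\<lambda>p. map p [0..<l]) ` bounded_perms l k \<subseteq> {xs \<in> partial_perms l l. count_list (fst (rsk l xs)) 1 \<le> k}"
        using word_of_permutation by (auto simp: bounded_perms_def)
      show "{xs \<in> partial_perms l l. count_list (fst (rsk l xs)) 1 \<le> k} \<subseteq> (\<lambda>p. map p [0..<l]) ` bounded_perms l k"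
      proof
        fix xs assume xs: "xs \<in> {xs \<in> partial_perms l l. count_list (fst (rsk l xs)) 1 \<le> k}"
        then obtain p where p: "p permutes {..<l}" "map p [0..<l] = xs" using permutation_of_word by blast
        then have "p \<in> bounded_perms l k" using xs by (simp add: bounded_perms_def)
        then show "xs \<in> (\<lambda>p. map p [0..<l]) ` bounded_perms l k" using p(2) by blast
      qed
    qed
  qed
  from bij_betw_same_card[OF this] show ?thesis using card_rsk_bounded by simp
qed

theorem corollary3p2:
  fixes n k l :: nat
    and scale :: "complex \<Rightarrow> 'v::ab_group_add \<Rightarrow> 'v"
    and act :: "affine \<Rightarrow> 'v \<Rightarrow> 'v"
  assumes "n \<ge> 2" and "k \<ge> 2" and "1 \<le> l" and "l \<le> n div 2"
    and "irreducible_highest_weight_module scale n act (\<lambda>h. of_nat k * fund_weight n 0 h)"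
  shows "affine_module.weight_mult scale n act
           (\<lambda>h. of_nat k * fund_weight n 0 h - gamma_wt n l h)
       = (\<Sum>ps | ps \<in> partitions_of l \<and> length ps \<le> k. (num_syt ps)\<^sup>2)"
proof -
  interpret M: irreducible_highest_weight_module scale n act "\<lambda>h. of_nat k * fund_weight n 0 h"
    by (rule assms(5))
  have l2: "2 * l \<le> n" using assms(4) by linarith
  obtain v where v: "M.highest_weight_vector (\<lambda>h. of_nat k * fund_weight n 0 h) v"
    and gen: "\<And>W. M.submodule W \<Longrightarrow> v \<in> W \<Longrightarrow> W = UNIV"
    using M.highest_weight unfolding M.highest_weight_module_def by blast
  note V = M.affine_vacuum_of_highest_weight[OF assms(1) M.irreducible v gen]
  interpret V: affine_vacuum scale n k M.X "act (deriv_d n)" v by (rule V(1))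
  have "M.weight_space (\<lambda>h. of_nat k * fund_weight n 0 h - gamma_wt n l h) = V.corner_space l"
    using M.weight_space_eq[OF assms(1,3) l2 V(2)] by (simp add: V.corner_space_def)
  moreover have "M.dim (V.corner_space l) = card (bounded_perms l k)"
  proof (rule V.dim_corner_space[OF l2])
    show "bounded_perms l k \<subseteq> {p. p permutes {..<l}}" by (auto simp: bounded_perms_def)
    show "\<exists>c. (\<forall>i<l. c i < k) \<and> (\<forall>j<l. \<forall>i<j. c i = c j \<longrightarrow> p j < p i)" if "p \<in> bounded_perms l k" for p
    proof -
      have p: "map p [0..<l] \<in> partial_perms l l" "count_list (fst (rsk l (map p [0..<l]))) 1 \<le> k"
        using that word_of_permutation by (auto simp: bounded_perms_def)
      from first_row_colouring[OF this] show ?thesis by (auto cong: if_cong)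
    qed
    show "\<exists>I. I \<subseteq> {..<l} \<and> card I = Suc k \<and> (\<forall>i\<in>I. \<forall>j\<in>I. i < j \<longrightarrow> p i < p j)"
      if p: "p permutes {..<l}" "p \<notin> bounded_perms l k" for p
    proof -
      have "Suc k \<le> count_list (fst (rsk l (map p [0..<l]))) 1" using p by (simp add: bounded_perms_def)
      from first_row_increasing[OF word_of_permutation[OF p(1)] this]
      obtain I where I: "increasing_at (map p [0..<l]) I" "card I = Suc k" by blast
      have sub: "I \<subseteq> {..<l}" using I(1) by (simp add: increasing_at_def)
      have "p i < p j" if "i \<in> I" "j \<in> I" "i < j" for i j
      proof -
        have "i < l" "j < l" using sub that by auto
        then show ?thesis using I(1) that unfolding increasing_at_def by fastforce
      qed
      then show ?thesis using sub I(2) by blast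
    qed
  qed
  ultimately show ?thesis using card_bounded_perms[of l k] by (simp add: M.weight_mult_def)
qed

end
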